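(* Let $k>0$, let $q\in L^\infty(W)$ be real-valued, $1$-periodic in $x_1$ and satisfy $q\ge c>0$ on $W=\mathbb{R}\times(0,1)$. For each $m\in\mathbb{N}$ set $$r_m:=\exp\left(-\pi\sqrt{\tfrac{m^2+(m+1)^2}{2}}\right),\qquad R_m:=\exp\left(\pi\sqrt{\tfrac{m^2+(m+1)^2}{2}}\right).$$ Then there is a constant $C>0$, independent of $m$, $n$ and $g$, such that for every integer $n\ge 1$, every $g\in L^2(W_0)$ and every $m\in\mathbb{N}$ for which the respective circle $\{|z|=r_m\}$ (for the first estimate) or $\{|z|=R_m\}$ (for the second estimate) does not meet $\mathbb{F}$, $$\left\|I^+_{n,r_m}\,g\right\|_{V}\le C e^{-\pi(n-1)m}\|g\|_{L^2(W_0)}\qquad\text{and}\qquad \left\|I^-_{-n,R_m}\,g\right\|_{V}\le C e^{-\pi(n-1)m}\|g\|_{L^2(W_0)} .$$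
   Context: $W_0:=(0,1)\times(0,1)$, $\Gamma_0:=\{0\}\times(0,1)$, $\Gamma_1:=\{1\}\times(0,1)$. $V:=\widetilde H^1(W_0)$ is the space of (complex-valued) functions in $H^1(W_0)$ with zero trace on $(0,1)\times\{0\}$ and on $(0,1)\times\{1\}$, with the $H^1(W_0)$ norm. For $z\in\mathbb{C}\setminus\{0\}$ let $\mathcal V_z:=\{\phi\in V:\ \phi|_{\Gamma_1}=z\,\phi|_{\Gamma_0}\}$. For $g\in L^2(W_0)$, $w(z,\cdot)\in\mathcal V_z$ denotes the $z$-quasi-periodic solution of $\Delta w(z,\cdot)+k^2q\,w(z,\cdot)=g$ in $W_0$. It is understood variationally: writing $z=e^{\mathrm{i}\alpha}$ and $v_\alpha(x):=e^{-\mathrm{i}\alpha x_1}w(z,x)\in\mathcal V_1$, $$\int_{W_0}\Big[\nabla v_\alpha\cdot\nabla\overline{\phi}-2\mathrm{i}\alpha\frac{\partial v_\alpha}{\partial x_1}\overline\phi-(k^2q-\alpha^2)v_\alpha\overline\phi\Big]dx=-\int_{W_0}e^{-\mathrm{i}\alpha x_1}g\,\overline\phi\,dx\qquad\text{for all }\phi\in\mathcal V_1 .$$ $\mathbb{F}\subset\mathbb{C}\setminus\{0\}$ is the discrete set of all $z$ for which the homogeneous problem ($g=0$) has a nontrivial solution in $\mathcal V_z$; for $z\notin\mathbb{F}$, $w(z,\cdot)$ exists uniquely and depends analytically on $z$. For $0<r<1<R$ such that the circles $|z|=r$ and $|z|=R$ do not meet $\mathbb{F}$, and for $n\ge1$,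 define (counterclockwise contours, values in $V$) $$I^+_{n,r}\,g:=\oint_{|z|=r}w(z,\cdot)z^{n-1}\,dz,\qquad I^-_{-n,R}\,g:=\oint_{|z|=R}w(z,\cdot)z^{-n-1}\,dz .$$ *)

theory Defs
  imports "HOL-Complex_Analysis.Complex_Analysis"
begin

section \<open>Square-integrable functions\<close>

text \<open>
  Elements of $L^2$ and $H^1$ are represented by functions; every notion below depends only on
  their values almost everywhere, and the norms are seminorms on representatives.
\<close>

definition L2 :: "'a::euclidean_space set \<Rightarrow> ('a \<Rightarrow> complex) set" where
  "L2 \<Omega> = {f. f \<in> borel_measurable (lebesgue_on \<Omega>) \<and>
               integrable (lebesgue_on \<Omega>) (\<lambda>x. (cmod (f x))\<^sup>2)}"

definition L2_norm :: "'a::euclidean_space set \<Rightarrow> ('a \<Rightarrow> complex) \<Rightarrow> real" where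
  "L2_norm \<Omega> f = sqrt (LINT x|lebesgue_on \<Omega>. (cmod (f x))\<^sup>2)"

section \<open>Smooth functions, weak derivatives and $H^1$\<close>

primrec Ck :: "nat \<Rightarrow> ('a::euclidean_space \<Rightarrow> complex) \<Rightarrow> bool" where
  "Ck 0 f \<longleftrightarrow> continuous_on UNIV f"
| "Ck (Suc n) f \<longleftrightarrow> (\<forall>x. f differentiable (at x)) \<and>
     (\<forall>e\<in>Basis. Ck n (\<lambda>x. frechet_derivative f (at x) e))"

definition smooth :: "('a::euclidean_space \<Rightarrow> complex) \<Rightarrow> bool" where
  "smooth f \<longleftrightarrow> (\<forall>n. Ck n f)"

definition test_function :: "'a::euclidean_space set \<Rightarrow> ('a \<Rightarrow> complex) \<Rightarrow> bool" where
  "test_function \<Omega> \<phi> \<longleftrightarrow> smooth \<phi> \<and> compact (closure {x. \<phi> x \<noteq> 0}) \<and> closure {x. \<phi> x \<noteq> 0} \<subseteq> \<Omega>"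

definition has_weak_deriv ::
    "'a::euclidean_space set \<Rightarrow> 'a \<Rightarrow> ('a \<Rightarrow> complex) \<Rightarrow> ('a \<Rightarrow> complex) \<Rightarrow> bool" where
  "has_weak_deriv \<Omega> e u u' \<longleftrightarrow>
     (\<forall>\<phi>. test_function \<Omega> \<phi> \<longrightarrow>
       (LINT x|lebesgue_on \<Omega>. u x * frechet_derivative \<phi> (at x) e) =
       - (LINT x|lebesgue_on \<Omega>. u' x * \<phi> x))"

definition H1 :: "'a::euclidean_space set \<Rightarrow> ('a \<Rightarrow> complex) set" where
  "H1 \<Omega> = {u \<in> L2 \<Omega>. \<forall>e\<in>Basis. \<exists>u'\<in>L2 \<Omega>. has_weak_deriv \<Omega> e u u'}"

text \<open>For open \<open>\<Omega>\<close> the weak derivative is determined up to a null set.\<close>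

definition weak_deriv :: "'a::euclidean_space set \<Rightarrow> 'a \<Rightarrow> ('a \<Rightarrow> complex) \<Rightarrow> 'a \<Rightarrow> complex" where
  "weak_deriv \<Omega> e u = (SOME u'. u' \<in> L2 \<Omega> \<and> has_weak_deriv \<Omega> e u u')"

definition H1_norm :: "'a::euclidean_space set \<Rightarrow> ('a \<Rightarrow> complex) \<Rightarrow> real" where
  "H1_norm \<Omega> u = sqrt ((L2_norm \<Omega> u)\<^sup>2 + (\<Sum>e\<in>Basis. (L2_norm \<Omega> (weak_deriv \<Omega> e u))\<^sup>2))"

section \<open>The periodicity cell, traces and quasi-periodic functions\<close>

definition W :: "(real \<times> real) set" where
  "W = UNIV \<times> {0<..<1}"

definition W0 :: "(real \<times> real) set" where
  "W0 = {0<..<1} \<times> {0<..<1}"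

text \<open>
  The trace operator on a side of \<open>W0\<close>, parametrised by arc length over $(0,1)$ through
  \<open>\<gamma>\<close>, is the continuous extension to $H^1$ of the restriction of functions
  that are smooth up to the boundary.
\<close>

definition has_trace ::
    "(real \<Rightarrow> real \<times> real) \<Rightarrow> (real \<times> real \<Rightarrow> complex) \<Rightarrow> (real \<Rightarrow> complex) \<Rightarrow> bool" where
  "has_trace \<gamma> u h \<longleftrightarrow> h \<in> L2 {0<..<1} \<and>
     (\<exists>U :: nat \<Rightarrow> real \<times> real \<Rightarrow> complex. (\<forall>j. smooth (U j)) \<and>
        (\<lambda>j. H1_norm W0 (\<lambda>x. U j x - u x)) \<longlonglongrightarrow> 0 \<and>
        (\<lambda>j. L2_norm {0<..<1} (\<lambda>t. U j (\<gamma> t) - h t)) \<longlonglongrightarrow> 0)"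

definition V :: "(real \<times> real \<Rightarrow> complex) set" where
  "V = {u \<in> H1 W0. has_trace (\<lambda>t. (t, 0)) u (\<lambda>_. 0) \<and> has_trace (\<lambda>t. (t, 1)) u (\<lambda>_. 0)}"

definition Vqp :: "complex \<Rightarrow> (real \<times> real \<Rightarrow> complex) set" where
  "Vqp z = {u \<in> V. \<exists>h. has_trace (\<lambda>t. (0, t)) u h \<and> has_trace (\<lambda>t. (1, t)) u (\<lambda>t. z * h t)}"

section \<open>The quasi-periodic problem\<close>

definition variational_solution ::
    "real \<Rightarrow> (real \<times> real \<Rightarrow> real) \<Rightarrow> (real \<times> real \<Rightarrow> complex) \<Rightarrow> complex \<Rightarrow>
     (real \<times> real \<Rightarrow> complex) \<Rightarrow> bool" where
  "variational_solution k q g \<alpha> v \<longleftrightarrow> v \<in> Vqp 1 \<and>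
     (\<forall>\<phi>\<in>Vqp 1.
       (LINT x|lebesgue_on W0.
          (\<Sum>e\<in>Basis. weak_deriv W0 e v x * cnj (weak_deriv W0 e \<phi> x))
          - 2 * \<i> * \<alpha> * weak_deriv W0 (1, 0) v x * cnj (\<phi> x)
          - (complex_of_real (k\<^sup>2 * q x) - \<alpha>\<^sup>2) * v x * cnj (\<phi> x)) =
       - (LINT x|lebesgue_on W0. exp (- \<i> * \<alpha> * complex_of_real (fst x)) * g x * cnj (\<phi> x)))"

text \<open>
  The exponent \<open>\<alpha>\<close> is determined by $z$ only modulo $2\pi$, and the
  variational problems for all its values are equivalent to each other.
\<close>

definition qp_solution ::
    "real \<Rightarrow> (real \<times> real \<Rightarrow> real) \<Rightarrow> (real \<times> real \<Rightarrow> complex) \<Rightarrow> complex \<Rightarrow>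
     (real \<times> real \<Rightarrow> complex) \<Rightarrow> bool" where
  "qp_solution k q g z w \<longleftrightarrow> z \<noteq> 0 \<and> w \<in> Vqp z \<and>
     (\<forall>\<alpha>. exp (\<i> * \<alpha>) = z \<longrightarrow>
       variational_solution k q g \<alpha> (\<lambda>x. exp (- \<i> * \<alpha> * complex_of_real (fst x)) * w x))"

definition exceptional_set :: "real \<Rightarrow> (real \<times> real \<Rightarrow> real) \<Rightarrow> complex set" where
  "exceptional_set k q =
     {z. \<exists>w. qp_solution k q (\<lambda>_. 0) z w \<and> \<not> (AE x in lebesgue_on W0. w x = 0)}"

text \<open>
  Off the exceptional set the solution exists and is unique up to a null set; elsewhere the value
  is irrelevant, and it is set to 0 where there is no solution.
\<close>

definition qp_sol ::
    "real \<Rightarrow> (real \<times> real \<Rightarrow> real) \<Rightarrow> (real \<times> real \<Rightarrow> complex) \<Rightarrow> complex \<Rightarrow>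
     real \<times> real \<Rightarrow> complex" where
  "qp_sol k q g z =
     (if \<exists>w. qp_solution k q g z w then SOME w. qp_solution k q g z w else (\<lambda>_. 0))"

section \<open>Contour integrals with values in \<open>V\<close>\<close>

text \<open>
  This is \<^const>\<open>has_contour_integral\<close> for integrands with values in \<open>V\<close>: the
  Riemann sums converge in the $H^1$ norm along \<^const>\<open>division_filter\<close>.  The library
  constant cannot be used itself, because \<open>V\<close> consists of representatives, on which the norm
  is only a seminorm.  As with \<^const>\<open>integral\<close>, the value is 0 if there is no integral.
\<close>

definition has_V_contour_integral ::
    "(complex \<Rightarrow> real \<times> real \<Rightarrow> complex) \<Rightarrow> (real \<times> real \<Rightarrow> complex) \<Rightarrow> (real \<Rightarrow> complex) \<Rightarrow> bool"
  where
  "has_V_contour_integral F u \<gamma> \<longleftrightarrow> u \<in> V \<and>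
     ((\<lambda>\<D>. H1_norm W0 (\<lambda>x.
          (\<Sum>(t, K)\<in>\<D>. measure lborel K *\<^sub>R (F (\<gamma> t) x * vector_derivative \<gamma> (at t within {0..1}))) - u x))
        \<longlongrightarrow> 0) (division_filter (cbox 0 1))"

definition V_contour_integral ::
    "(real \<Rightarrow> complex) \<Rightarrow> (complex \<Rightarrow> real \<times> real \<Rightarrow> complex) \<Rightarrow> real \<times> real \<Rightarrow> complex" where
  "V_contour_integral \<gamma> F =
     (if \<exists>u. has_V_contour_integral F u \<gamma> then SOME u. has_V_contour_integral F u \<gamma> else (\<lambda>_. 0))"

definition I_plus ::
    "real \<Rightarrow> (real \<times> real \<Rightarrow> real) \<Rightarrow> nat \<Rightarrow> real \<Rightarrow> (real \<times> real \<Rightarrow> complex) \<Rightarrow>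
     real \<times> real \<Rightarrow> complex" where
  "I_plus k q n r g =
     V_contour_integral (circlepath 0 r) (\<lambda>z x. qp_sol k q g z x * z powi (int n - 1))"

text \<open>\<open>I_minus k q n R g\<close> stands for $I^-_{-n,R}\,g$.\<close>

definition I_minus ::
    "real \<Rightarrow> (real \<times> real \<Rightarrow> real) \<Rightarrow> nat \<Rightarrow> real \<Rightarrow> (real \<times> real \<Rightarrow> complex) \<Rightarrow>
     real \<times> real \<Rightarrow> complex" where
  "I_minus k q n R g =
     V_contour_integral (circlepath 0 R) (\<lambda>z x. qp_sol k q g z x * z powi (- int n - 1))"

definition r_m :: "nat \<Rightarrow> real" where
  "r_m m = exp (- pi * sqrt (((real m)\<^sup>2 + (real m + 1)\<^sup>2) / 2))"

definition R_m :: "nat \<Rightarrow> real" where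
  "R_m m = exp (pi * sqrt (((real m)\<^sup>2 + (real m + 1)\<^sup>2) / 2))"

end

(*
  On the circle |z| = exp (- y) write z = exp (i alpha) with Im alpha = y and |Re alpha| at most pi, and
  expand v = exp (- i alpha x1) w in the waves exp (2 pi i j x1) sin (pi l x2). The operator becomes
  multiplication by the symbol (2 pi j + alpha)^2 + (pi l)^2, whose modulus is at least |y^2 - (pi l)^2|.
  The radii r_m and R_m correspond to y^2 = pi^2 (m^2 + m + 1/2), which keeps y^2 away from all the (pi l)^2
  by pi^2 (m + 1/2). For large m the potential k^2 q is therefore a small perturbation, and testing the
  equation with v bounds the H^1 norm of v by a multiple of the norm of the right-hand side, uniformly in m.
  For the finitely many remaining m a compactness argument gives the same bound: high modes are uniformly
  small, low modes form a finite-dimensional space, and a limit of counterexamples would solve the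
  homogeneous problem on the circle. Since |z|^n sup |exp (i alpha x1)| sup |exp (- i alpha x1)| is at most
  |z|^(n-1) on the circle |z| = r_m (and symmetrically for R_m), integration gives the estimates.
  Only a priori bounds are needed: where a solution or the integral does not exist, its value is 0.
*)
theory Submission
  imports Defs
begin

section \<open>Square-integrable functions: inequalities, completeness, closures of
  subspaces\<close>

section \<open>The space \<open>L2\<close>\<close>

text \<open>The function to be bounded is w = exp (i alpha x1) v, and differentiating the
  exponential costs |alpha| times the L2 norm of v, where |alpha| grows like m. A bound for v that
  is merely uniform in m would not suffice; the gap pi^2 (m + 1/2) in the symbol grows at the same
  rate and compensates. This is why the estimates carry |alpha| times the L2 norm along. Elements of
  V are representatives and traces are limits along smooth sequences. Closedness of the
  quasi-periodicity condition and integration by parts are therefore derived from Green's formula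
  for smooth functions by passing to limits. No infinite Fourier series is summed: finite sums of
  the waves are dense, and norms are bounded by duality against them, so that finitely many
  coefficients occur at a time. The point z fixes alpha only up to 2 pi, and a solution must satisfy
  the equation for every admissible alpha. A limit of solutions has to keep all these equations to
  be an exceptional one. The normalisation |Re alpha| <= pi keeps the exponents of one circle in a
  compact set.\<close>

lemma L2I:
  assumes "f \<in> borel_measurable (lebesgue_on \<Omega>)" "integrable (lebesgue_on \<Omega>) (\<lambda>x. (cmod (f x))\<^sup>2)"
  shows "f \<in> L2 \<Omega>"
  using assms by (simp add: L2_def)

lemma L2_measurable [measurable_dest]: "f \<in> L2 \<Omega> \<Longrightarrow> f \<in> borel_measurable (lebesgue_on \<Omega>)"
  by (simp add: L2_def)

lemma L2_square_integrable: "f \<in> L2 \<Omega> \<Longrightarrow> integrable (lebesgue_on \<Omega>) (\<lambda>x. (cmod (f x))\<^sup>2)"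
  by (simp add: L2_def)

lemma L2_norm_nonneg [simp]: "0 \<le> L2_norm \<Omega> f"
  by (simp add: L2_norm_def)

lemma L2_norm_square: "(L2_norm \<Omega> f)\<^sup>2 = (LINT x|lebesgue_on \<Omega>. (cmod (f x))\<^sup>2)"
  by (simp add: L2_norm_def)

lemma L2_mult_integrable:
  assumes "f \<in> L2 \<Omega>" "g \<in> L2 \<Omega>"
  shows "integrable (lebesgue_on \<Omega>) (\<lambda>x. f x * g x)"
proof (rule Bochner_Integration.integrable_bound)
  show "integrable (lebesgue_on \<Omega>) (\<lambda>x. (cmod (f x))\<^sup>2 + (cmod (g x))\<^sup>2)"
    using assms by (intro Bochner_Integration.integrable_add L2_square_integrable)
  show "(\<lambda>x. f x * g x) \<in> borel_measurable (lebesgue_on \<Omega>)"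
    using assms by (auto dest!: L2_measurable)
  have "a * b \<le> a\<^sup>2 + b\<^sup>2" if "a \<ge> 0" "b \<ge> 0" for a b :: real
    using that sum_squares_bound[of a b] mult_nonneg_nonneg[OF that] by linarith
  then show "AE x in lebesgue_on \<Omega>. norm (f x * g x) \<le> norm ((cmod (f x))\<^sup>2 + (cmod (g x))\<^sup>2)"
    by (auto simp: norm_mult)
qed

lemma L2_mono_AE:
  assumes "f \<in> borel_measurable (lebesgue_on \<Omega>)" "g \<in> L2 \<Omega>" "K \<ge> 0"
    and le: "AE x in lebesgue_on \<Omega>. cmod (f x) \<le> K * cmod (g x)"
  shows "f \<in> L2 \<Omega>" and "L2_norm \<Omega> f \<le> K * L2_norm \<Omega> g"
proof -
  have le2: "AE x in lebesgue_on \<Omega>. (cmod (f x))\<^sup>2 \<le> K\<^sup>2 * (cmod (g x))\<^sup>2"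
    using le
  proof (rule AE_mp, intro AE_I2 impI)
    fix x assume "cmod (f x) \<le> K * cmod (g x)"
    from power_mono[OF this, of 2] show "(cmod (f x))\<^sup>2 \<le> K\<^sup>2 * (cmod (g x))\<^sup>2"
      by (simp add: power_mult_distrib)
  qed
  have gi: "integrable (lebesgue_on \<Omega>) (\<lambda>x. K\<^sup>2 * (cmod (g x))\<^sup>2)"
    using assms L2_square_integrable by auto
  have fi: "integrable (lebesgue_on \<Omega>) (\<lambda>x. (cmod (f x))\<^sup>2)"
    by (rule Bochner_Integration.integrable_bound[OF gi]) (use assms le2 in auto)
  show "f \<in> L2 \<Omega>" using assms(1) fi by (rule L2I)
  have "(L2_norm \<Omega> f)\<^sup>2 \<le> (LINT x|lebesgue_on \<Omega>. K\<^sup>2 * (cmod (g x))\<^sup>2)"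
    unfolding L2_norm_square by (rule integral_mono_AE[OF fi gi le2])
  also have "\<dots> = (K * L2_norm \<Omega> g)\<^sup>2"
    by (simp add: power_mult_distrib L2_norm_square)
  finally show "L2_norm \<Omega> f \<le> K * L2_norm \<Omega> g"
    by (rule power2_le_imp_le) (use assms(3) in simp)
qed

lemma L2_norm_cong_AE:
  assumes "AE x in lebesgue_on \<Omega>. f x = g x"
    and "f \<in> borel_measurable (lebesgue_on \<Omega>)" "g \<in> borel_measurable (lebesgue_on \<Omega>)"
  shows "L2_norm \<Omega> f = L2_norm \<Omega> g"
  unfolding L2_norm_def
  by (rule arg_cong[of _ _ sqrt], rule integral_cong_AE) (use assms in auto)

lemma L2_bounded_mult:
  assumes "f \<in> L2 \<Omega>" "b \<in> borel_measurable (lebesgue_on \<Omega>)" "K \<ge> 0"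
    and "AE x in lebesgue_on \<Omega>. cmod (b x) \<le> K"
  shows "(\<lambda>x. b x * f x) \<in> L2 \<Omega>" and "L2_norm \<Omega> (\<lambda>x. b x * f x) \<le> K * L2_norm \<Omega> f"
proof -
  have m: "(\<lambda>x. b x * f x) \<in> borel_measurable (lebesgue_on \<Omega>)"
    using assms by (auto dest!: L2_measurable)
  have le: "AE x in lebesgue_on \<Omega>. cmod (b x * f x) \<le> K * cmod (f x)"
    using assms(4) by eventually_elim (auto simp: norm_mult intro!: mult_right_mono)
  show "(\<lambda>x. b x * f x) \<in> L2 \<Omega>" "L2_norm \<Omega> (\<lambda>x. b x * f x) \<le> K * L2_norm \<Omega> f"
    using L2_mono_AE[OF m assms(1,3) le] by auto
qed

lemma L2_zero [simp]: "(\<lambda>_. 0) \<in> L2 \<Omega>"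
  by (rule L2I) auto

lemma L2_norm_zero [simp]: "L2_norm \<Omega> (\<lambda>_. 0) = 0"
  by (simp add: L2_norm_def)

lemma L2_cmult: "f \<in> L2 \<Omega> \<Longrightarrow> (\<lambda>x. c * f x) \<in> L2 \<Omega>"
  using L2_bounded_mult(1)[of f \<Omega> "\<lambda>_. c" "cmod c"] by auto

lemma L2_norm_cmult: "L2_norm \<Omega> (\<lambda>x. c * f x) = cmod c * L2_norm \<Omega> f"
  by (simp add: L2_norm_def norm_mult power_mult_distrib real_sqrt_mult)

lemma L2_cnj: "f \<in> L2 \<Omega> \<Longrightarrow> (\<lambda>x. cnj (f x)) \<in> L2 \<Omega>"
  by (rule L2I)
    (auto dest: L2_square_integrable
      intro!: measurable_compose[OF L2_measurable, of _ _ cnj] borel_measurable_continuous_onI continuous_intros)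

lemma L2_norm_cnj: "L2_norm \<Omega> (\<lambda>x. cnj (f x)) = L2_norm \<Omega> f"
  by (simp add: L2_norm_def)

lemma L2_add:
  assumes "f \<in> L2 \<Omega>" "g \<in> L2 \<Omega>"
  shows "(\<lambda>x. f x + g x) \<in> L2 \<Omega>"
proof (rule L2I)
  show "(\<lambda>x. f x + g x) \<in> borel_measurable (lebesgue_on \<Omega>)"
    using assms by (auto dest!: L2_measurable)
  have "integrable (lebesgue_on \<Omega>) (\<lambda>x. 2 * (cmod (f x))\<^sup>2 + 2 * (cmod (g x))\<^sup>2)"
    using assms by (intro Bochner_Integration.integrable_add integrable_mult_right L2_square_integrable)
  then show "integrable (lebesgue_on \<Omega>) (\<lambda>x. (cmod (f x + g x))\<^sup>2)"
  proof (rule Bochner_Integration.integrable_bound)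
    have "(cmod (a + b))\<^sup>2 \<le> 2 * (cmod a)\<^sup>2 + 2 * (cmod b)\<^sup>2" for a b :: complex
    proof -
      have "(cmod (a + b))\<^sup>2 \<le> (cmod a + cmod b)\<^sup>2"
        by (intro power_mono norm_triangle_ineq) auto
      also have "\<dots> \<le> 2 * (cmod a)\<^sup>2 + 2 * (cmod b)\<^sup>2"
        using sum_squares_bound[of "cmod a" "cmod b"] by (simp add: power2_sum)
      finally show ?thesis .
    qed
    then show "AE x in lebesgue_on \<Omega>.
        norm ((cmod (f x + g x))\<^sup>2) \<le> norm (2 * (cmod (f x))\<^sup>2 + 2 * (cmod (g x))\<^sup>2)"
      by (auto simp: abs_of_nonneg)
  qed (use assms in \<open>auto dest!: L2_measurable\<close>)
qed

lemma L2_uminus: "f \<in> L2 \<Omega> \<Longrightarrow> (\<lambda>x. - f x) \<in> L2 \<Omega>"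
  using L2_cmult[of f \<Omega> "-1"] by simp

lemma L2_diff: "f \<in> L2 \<Omega> \<Longrightarrow> g \<in> L2 \<Omega> \<Longrightarrow> (\<lambda>x. f x - g x) \<in> L2 \<Omega>"
  using L2_add[of f \<Omega> "\<lambda>x. - g x"] L2_uminus by auto

lemma L2_sum: "finite I \<Longrightarrow> (\<And>i. i \<in> I \<Longrightarrow> f i \<in> L2 \<Omega>) \<Longrightarrow> (\<lambda>x. \<Sum>i\<in>I. f i x) \<in> L2 \<Omega>"
  by (induction I rule: finite_induct) (auto intro: L2_add)

lemma L2_norm_uminus [simp]: "L2_norm \<Omega> (\<lambda>x. - f x) = L2_norm \<Omega> f"
  by (simp add: L2_norm_def)

lemma L2_norm_minus_commute: "L2_norm \<Omega> (\<lambda>x. f x - g x) = L2_norm \<Omega> (\<lambda>x. g x - f x)"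
  by (simp add: L2_norm_def norm_minus_commute)

text \<open>The discriminant criterion. For \<open>A = 0\<close> the expression is affine in
  \<open>t\<close>, and an affine function bounded below on the whole line is constant.\<close>

lemma quadratic_nonneg_imp:
  fixes A B C :: real
  assumes "\<And>t. 0 \<le> t\<^sup>2 * A - 2 * t * C + B" "A \<ge> 0"
  shows "C\<^sup>2 \<le> A * B"
proof (cases "A = 0")
  case True
  have "C = 0"
  proof (rule ccontr)
    assume "C \<noteq> 0"
    \<comment> \<open>At this \<open>t\<close> the expression equals -1.\<close>
    with assms(1)[of "(B + 1) / (2 * C)"] True show False by simp
  qed
  with True show ?thesis by simp
next
  case False
  with assms(1)[of "C / A"] assms(2) show ?thesis
    by (simp add: power2_eq_square field_simps)
qed

text \<open>Discriminant of the quadratic in t given by the integral of (t |f| - |g|)^2. Working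
  with moduli keeps it real; the bound for the complex pairing is a consequence.\<close>

lemma L2_Cauchy_Schwarz_abs:
  assumes "f \<in> L2 \<Omega>" "g \<in> L2 \<Omega>"
  shows "(LINT x|lebesgue_on \<Omega>. cmod (f x) * cmod (g x)) \<le> L2_norm \<Omega> f * L2_norm \<Omega> g"
proof -
  let ?C = "LINT x|lebesgue_on \<Omega>. cmod (f x) * cmod (g x)"
  have i: "integrable (lebesgue_on \<Omega>) (\<lambda>x. cmod (f x) * cmod (g x))"
    using integrable_norm[OF L2_mult_integrable[OF assms]] by (simp add: norm_mult)
  note ii = L2_square_integrable[OF assms(1)] L2_square_integrable[OF assms(2)] i
  have "0 \<le> t\<^sup>2 * (L2_norm \<Omega> f)\<^sup>2 - 2 * t * ?C + (L2_norm \<Omega> g)\<^sup>2" for t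
  proof -
    have "0 \<le> (LINT x|lebesgue_on \<Omega>. (t * cmod (f x) - cmod (g x))\<^sup>2)"
      by simp
    also have "\<dots> = (LINT x|lebesgue_on \<Omega>. t\<^sup>2 * (cmod (f x))\<^sup>2 - 2 * t * (cmod (f x) * cmod (g x)) + (cmod (g x))\<^sup>2)"
      by (simp add: power2_diff power_mult_distrib algebra_simps)
    also have "\<dots> = t\<^sup>2 * (L2_norm \<Omega> f)\<^sup>2 - 2 * t * ?C + (L2_norm \<Omega> g)\<^sup>2"
      using ii by (simp add: L2_norm_square)
    finally show ?thesis .
  qed
  then have "?C\<^sup>2 \<le> (L2_norm \<Omega> f)\<^sup>2 * (L2_norm \<Omega> g)\<^sup>2"
    by (rule quadratic_nonneg_imp) simp
  then have "?C\<^sup>2 \<le> (L2_norm \<Omega> f * L2_norm \<Omega> g)\<^sup>2"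
    by (simp add: power_mult_distrib)
  then show ?thesis by (rule power2_le_imp_le) simp
qed

lemma L2_Cauchy_Schwarz:
  assumes "f \<in> L2 \<Omega>" "g \<in> L2 \<Omega>"
  shows "cmod (LINT x|lebesgue_on \<Omega>. f x * g x) \<le> L2_norm \<Omega> f * L2_norm \<Omega> g"
proof -
  have "cmod (LINT x|lebesgue_on \<Omega>. f x * g x) \<le> (LINT x|lebesgue_on \<Omega>. cmod (f x * g x))"
    by (rule integral_norm_bound)
  also have "\<dots> \<le> L2_norm \<Omega> f * L2_norm \<Omega> g"
    using L2_Cauchy_Schwarz_abs[OF assms] by (simp add: norm_mult)
  finally show ?thesis .
qed

lemma L2_norm_triangle:
  assumes "f \<in> L2 \<Omega>" "g \<in> L2 \<Omega>"
  shows "L2_norm \<Omega> (\<lambda>x. f x + g x) \<le> L2_norm \<Omega> f + L2_norm \<Omega> g"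
proof -
  have i: "integrable (lebesgue_on \<Omega>) (\<lambda>x. cmod (f x) * cmod (g x))"
    using integrable_norm[OF L2_mult_integrable[OF assms]] by (simp add: norm_mult)
  note ii = L2_square_integrable[OF assms(1)] L2_square_integrable[OF assms(2)] i
  have "(L2_norm \<Omega> (\<lambda>x. f x + g x))\<^sup>2 \<le>
      (LINT x|lebesgue_on \<Omega>. (cmod (f x))\<^sup>2 + 2 * (cmod (f x) * cmod (g x)) + (cmod (g x))\<^sup>2)"
    unfolding L2_norm_square
  proof (rule integral_mono)
    show "integrable (lebesgue_on \<Omega>) (\<lambda>x. (cmod (f x + g x))\<^sup>2)"
      by (rule L2_square_integrable[OF L2_add[OF assms]])
    fix x
    have "(cmod (f x + g x))\<^sup>2 \<le> (cmod (f x) + cmod (g x))\<^sup>2"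
      by (intro power_mono norm_triangle_ineq) auto
    then show "(cmod (f x + g x))\<^sup>2 \<le> (cmod (f x))\<^sup>2 + 2 * (cmod (f x) * cmod (g x)) + (cmod (g x))\<^sup>2"
      by (simp add: power2_sum algebra_simps)
  qed (use ii in auto)
  also have "\<dots> = (L2_norm \<Omega> f)\<^sup>2 + 2 * (LINT x|lebesgue_on \<Omega>. cmod (f x) * cmod (g x)) + (L2_norm \<Omega> g)\<^sup>2"
    using ii by (simp add: L2_norm_square)
  also have "\<dots> \<le> (L2_norm \<Omega> f + L2_norm \<Omega> g)\<^sup>2"
    using L2_Cauchy_Schwarz_abs[OF assms] by (simp add: power2_sum)
  finally show ?thesis by (rule power2_le_imp_le) simp
qed

lemma L2_norm_triangle_diff:
  assumes "f \<in> L2 \<Omega>" "g \<in> L2 \<Omega>"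
  shows "L2_norm \<Omega> (\<lambda>x. f x - g x) \<le> L2_norm \<Omega> f + L2_norm \<Omega> g"
  using L2_norm_triangle[OF assms(1) L2_uminus[OF assms(2)]] by simp

lemma L2_norm_triangle_sub:
  assumes "f \<in> L2 \<Omega>" "g \<in> L2 \<Omega>"
  shows "L2_norm \<Omega> f \<le> L2_norm \<Omega> g + L2_norm \<Omega> (\<lambda>x. f x - g x)"
  using L2_norm_triangle[OF assms(2) L2_diff[OF assms]] by simp

lemma L2_norm_triangle_via:
  assumes "f \<in> L2 \<Omega>" "g \<in> L2 \<Omega>" "h \<in> L2 \<Omega>"
  shows "L2_norm \<Omega> (\<lambda>x. f x - h x) \<le> L2_norm \<Omega> (\<lambda>x. f x - g x) + L2_norm \<Omega> (\<lambda>x. g x - h x)"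
  using L2_norm_triangle[OF L2_diff[OF assms(1,2)] L2_diff[OF assms(2,3)]] by simp

lemma L2_norm_zero_iff:
  assumes "f \<in> L2 \<Omega>"
  shows "L2_norm \<Omega> f = 0 \<longleftrightarrow> (AE x in lebesgue_on \<Omega>. f x = 0)"
  unfolding L2_norm_def real_sqrt_eq_0_iff
  by (subst integral_nonneg_eq_0_iff_AE) (use L2_square_integrable[OF assms] in auto)

lemma L2_norm_tendsto:
  assumes "\<And>n. f n \<in> L2 \<Omega>" "g \<in> L2 \<Omega>" "(\<lambda>n. L2_norm \<Omega> (\<lambda>x. f n x - g x)) \<longlonglongrightarrow> 0"
  shows "(\<lambda>n. L2_norm \<Omega> (f n)) \<longlonglongrightarrow> L2_norm \<Omega> g"
proof -
  have "\<bar>L2_norm \<Omega> (f n) - L2_norm \<Omega> g\<bar> \<le> L2_norm \<Omega> (\<lambda>x. f n x - g x)" for n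
    using L2_norm_triangle_sub[OF assms(1,2), of n] L2_norm_triangle_sub[OF assms(2) assms(1), of n]
      L2_norm_minus_commute[of \<Omega> "f n" g] by linarith
  then have "(\<lambda>n. L2_norm \<Omega> (f n) - L2_norm \<Omega> g) \<longlonglongrightarrow> 0"
    by (intro Lim_null_comparison[OF _ assms(3)]) auto
  then show ?thesis using LIM_zero_iff by blast
qed

lemma L2_pairing_tendsto:
  assumes f: "\<And>n. f n \<in> L2 \<Omega>" "f' \<in> L2 \<Omega>" "(\<lambda>n. L2_norm \<Omega> (\<lambda>x. f n x - f' x)) \<longlonglongrightarrow> 0"
    and g: "g \<in> L2 \<Omega>"
  shows "(\<lambda>n. LINT x|lebesgue_on \<Omega>. f n x * g x) \<longlonglongrightarrow> (LINT x|lebesgue_on \<Omega>. f' x * g x)"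
proof -
  have "(\<lambda>n. (LINT x|lebesgue_on \<Omega>. f n x * g x) - (LINT x|lebesgue_on \<Omega>. f' x * g x)) \<longlonglongrightarrow> 0"
  proof (rule Lim_null_comparison)
    show "(\<lambda>n. L2_norm \<Omega> (\<lambda>x. f n x - f' x) * L2_norm \<Omega> g) \<longlonglongrightarrow> 0"
      using tendsto_mult_right[OF f(3), of "L2_norm \<Omega> g"] by simp
    have "(LINT x|lebesgue_on \<Omega>. f n x * g x) - (LINT x|lebesgue_on \<Omega>. f' x * g x)
        = (LINT x|lebesgue_on \<Omega>. (f n x - f' x) * g x)" for n
      using L2_mult_integrable[OF f(1) g] L2_mult_integrable[OF f(2) g]
      by (simp add: left_diff_distrib)
    then show "\<forall>\<^sub>F n in sequentially. norm ((LINT x|lebesgue_on \<Omega>. f n x * g x) - (LINT x|lebesgue_on \<Omega>. f' x * g x))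
        \<le> L2_norm \<Omega> (\<lambda>x. f n x - f' x) * L2_norm \<Omega> g"
      using L2_Cauchy_Schwarz[OF L2_diff[OF f(1,2)] g] by auto
  qed
  then show ?thesis using LIM_zero_iff by blast
qed

lemma L2_bounded:
  assumes "f \<in> borel_measurable (lebesgue_on \<Omega>)" "\<Omega> \<in> lmeasurable" "\<And>x. x \<in> \<Omega> \<Longrightarrow> cmod (f x) \<le> K"
  shows "f \<in> L2 \<Omega>"
proof -
  interpret finite_measure "lebesgue_on \<Omega>"
    using assms(2) by (simp add: finite_measure_lebesgue_on)
  show ?thesis
  proof (rule L2I[OF assms(1)])
    show "integrable (lebesgue_on \<Omega>) (\<lambda>x. (cmod (f x))\<^sup>2)"
      by (rule integrable_const_bound[where B="K\<^sup>2"])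
        (use assms in \<open>auto intro!: AE_I2 power_mono\<close>)
  qed
qed

lemma L2_integrable:
  assumes "f \<in> L2 \<Omega>" "\<Omega> \<in> lmeasurable"
  shows "integrable (lebesgue_on \<Omega>) f"
proof -
  have "(\<lambda>_. 1) \<in> L2 \<Omega>" by (rule L2_bounded[OF _ assms(2), of _ 1]) auto
  from L2_mult_integrable[OF assms(1) this] show ?thesis by simp
qed

subsection \<open>Completeness\<close>

text \<open>Fatou's lemma for the squared moduli: closed balls survive limits almost everywhere. In
  the completeness proof this turns a bound between two members of a sequence into a bound against
  the limit.\<close>

lemma L2_Fatou:
  assumes f: "\<And>n. f n \<in> L2 \<Omega>" and "\<And>n. L2_norm \<Omega> (f n) \<le> K"
    and g: "g \<in> borel_measurable (lebesgue_on \<Omega>)"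
    and lim: "AE x in lebesgue_on \<Omega>. (\<lambda>n. f n x) \<longlonglongrightarrow> g x"
  shows "g \<in> L2 \<Omega>" and "L2_norm \<Omega> g \<le> K"
proof -
  let ?M = "lebesgue_on \<Omega>"
  have K: "K \<ge> 0" using assms(2)[of 0] L2_norm_nonneg[of \<Omega> "f 0"] by linarith
  have [measurable]: "\<And>n. f n \<in> borel_measurable ?M" using f L2_measurable by auto
  have "(\<integral>\<^sup>+x. ennreal ((cmod (g x))\<^sup>2) \<partial>?M) = (\<integral>\<^sup>+x. liminf (\<lambda>n. ennreal ((cmod (f n x))\<^sup>2)) \<partial>?M)"
  proof (rule nn_integral_cong_AE)
    show "AE x in ?M. ennreal ((cmod (g x))\<^sup>2) = liminf (\<lambda>n. ennreal ((cmod (f n x))\<^sup>2))"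
      using lim
    proof eventually_elim
      case (elim x)
      have "(\<lambda>n. ennreal ((cmod (f n x))\<^sup>2)) \<longlonglongrightarrow> ennreal ((cmod (g x))\<^sup>2)"
        by (intro tendsto_intros elim)
      from lim_imp_Liminf[OF _ this] show ?case by simp
    qed
  qed
  also have "\<dots> \<le> liminf (\<lambda>n. \<integral>\<^sup>+x. ennreal ((cmod (f n x))\<^sup>2) \<partial>?M)"
    by (rule nn_integral_liminf) measurable
  also have "\<dots> \<le> ennreal (K\<^sup>2)"
  proof -
    have "(\<integral>\<^sup>+x. ennreal ((cmod (f n x))\<^sup>2) \<partial>?M) \<le> ennreal (K\<^sup>2)" for n
    proof -
      have "(\<integral>\<^sup>+x. ennreal ((cmod (f n x))\<^sup>2) \<partial>?M) = ennreal ((L2_norm \<Omega> (f n))\<^sup>2)"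
        unfolding L2_norm_square by (rule nn_integral_eq_integral[OF L2_square_integrable[OF f]]) auto
      also have "\<dots> \<le> ennreal (K\<^sup>2)"
        by (intro ennreal_leI power_mono assms(2)) auto
      finally show ?thesis .
    qed
    then show ?thesis by (intro Liminf_le) auto
  qed
  finally have le: "(\<integral>\<^sup>+x. ennreal ((cmod (g x))\<^sup>2) \<partial>?M) \<le> ennreal (K\<^sup>2)" .
  have gi: "integrable ?M (\<lambda>x. (cmod (g x))\<^sup>2)"
    by (rule integrableI_bounded) (use g le in \<open>auto simp: le_less_trans\<close>)
  show "g \<in> L2 \<Omega>" by (rule L2I[OF g gi])
  have "ennreal ((L2_norm \<Omega> g)\<^sup>2) = (\<integral>\<^sup>+x. ennreal ((cmod (g x))\<^sup>2) \<partial>?M)"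
    unfolding L2_norm_square by (rule nn_integral_eq_integral[OF gi, symmetric]) auto
  with le have "(L2_norm \<Omega> g)\<^sup>2 \<le> K\<^sup>2" by (metis ennreal_le_iff zero_le_power2)
  then show "L2_norm \<Omega> g \<le> K" using K by (rule power2_le_imp_le)
qed

text \<open>The Riesz-Fischer argument: a subsequence with summable increments converges almost
  everywhere, and Fatou's lemma shows that the whole sequence tends to its limit in norm.\<close>

lemma L2_complete:
  fixes f :: "nat \<Rightarrow> 'a::euclidean_space \<Rightarrow> complex"
  assumes \<Omega>: "\<Omega> \<in> lmeasurable" and f: "\<And>n. f n \<in> L2 \<Omega>"
    and Cauchy: "\<And>e. e > 0 \<Longrightarrow> \<exists>N. \<forall>m\<ge>N. \<forall>n\<ge>N. L2_norm \<Omega> (\<lambda>x. f m x - f n x) < e"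
  obtains g where "g \<in> L2 \<Omega>" "(\<lambda>n. L2_norm \<Omega> (\<lambda>x. f n x - g x)) \<longlonglongrightarrow> 0"
proof -
  let ?M = "lebesgue_on \<Omega>"
  let ?one = "\<lambda>_::'a. 1::complex"
  have one: "?one \<in> L2 \<Omega>" by (rule L2_bounded[OF _ \<Omega>, of _ 1]) auto
  have [measurable]: "\<And>n. f n \<in> borel_measurable ?M" using f L2_measurable by auto
  obtain N where N: "\<And>k m n. m \<ge> N k \<Longrightarrow> n \<ge> N k \<Longrightarrow> L2_norm \<Omega> (\<lambda>x. f m x - f n x) < (1/2)^k"
    using Cauchy[of "(1/2)^k" for k] by (metis zero_less_divide_1_iff zero_less_numeral zero_less_power)
  \<comment> \<open>Partial sums make the indices monotone while keeping \<open>r k\<close> above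
    \<open>N k\<close>.\<close>
  define r where "r k = (\<Sum>i\<le>k. N i + 1)" for k
  have rN: "r k \<ge> N k" for k
    unfolding r_def by (metis (no_types, lifting) Suc_eq_plus1 atMost_iff finite_atMost le_SucI le_refl member_le_sum not_less_eq_eq zero_le)
  have rS: "r (Suc k) \<ge> r k" for k by (simp add: r_def)
  have rk: "r k \<ge> k" for k by (induction k) (auto simp: r_def)
  define d where "d k x = f (r (Suc k)) x - f (r k) x" for k x
  have dL2: "d k \<in> L2 \<Omega>" for k unfolding d_def using f by (intro L2_diff)
  have dn: "L2_norm \<Omega> (d k) \<le> (1/2)^k" for k
    using N[of k "r (Suc k)" "r k"] rN[of k] rS[of k] unfolding d_def by force
  have [measurable]: "\<And>n. d n \<in> borel_measurable ?M" using dL2 L2_measurable by auto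
  have di: "integrable ?M (\<lambda>x. cmod (d k x))" for k
    using integrable_norm[OF L2_integrable[OF dL2 \<Omega>]] .
  \<comment> \<open>On a set of finite measure, Cauchy-Schwarz against the constant 1 bounds the L1
    norm by the L2 norm. The sum of the |d k| is therefore integrable, hence finite almost
    everywhere.\<close>
  have d1: "(\<integral>\<^sup>+x. ennreal (cmod (d k x)) \<partial>?M) \<le> ennreal (L2_norm \<Omega> ?one * (1/2)^k)" for k
  proof -
    have "(\<integral>\<^sup>+x. ennreal (cmod (d k x)) \<partial>?M) = ennreal (LINT x|?M. cmod (d k x))"
      by (rule nn_integral_eq_integral[OF di]) auto
    also have "(LINT x|?M. cmod (d k x)) \<le> L2_norm \<Omega> ?one * L2_norm \<Omega> (d k)"
      using L2_Cauchy_Schwarz_abs[OF one dL2[of k]] by simp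
    also have "\<dots> \<le> L2_norm \<Omega> ?one * (1/2)^k"
      using dn[of k] by (intro mult_left_mono) auto
    finally show ?thesis by (simp add: ennreal_leI)
  qed
  have "(\<integral>\<^sup>+x. (\<Sum>k. ennreal (cmod (d k x))) \<partial>?M) = (\<Sum>k. \<integral>\<^sup>+x. ennreal (cmod (d k x)) \<partial>?M)"
    by (rule nn_integral_suminf) measurable
  also have "\<dots> \<le> (\<Sum>k. ennreal (L2_norm \<Omega> ?one * (1/2)^k))"
    by (intro suminf_le d1) auto
  also have "\<dots> < \<infinity>"
  proof -
    have "summable (\<lambda>k. L2_norm \<Omega> ?one * (1/2)^k)"
      by (intro summable_mult summable_geometric) auto
    then show ?thesis
      by (subst suminf_ennreal2) (auto intro!: mult_nonneg_nonneg)
  qed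
  finally have "(\<integral>\<^sup>+x. (\<Sum>k. ennreal (cmod (d k x))) \<partial>?M) \<noteq> \<infinity>" by simp
  then have "AE x in ?M. (\<Sum>k. ennreal (cmod (d k x))) \<noteq> \<infinity>"
    by (intro nn_integral_PInf_AE) auto
  then have conv: "AE x in ?M. convergent (\<lambda>k. f (r k) x)"
  proof eventually_elim
    case (elim x)
    then have "summable (\<lambda>k. cmod (d k x))"
      by (intro summable_suminf_not_top) auto
    then have "summable (\<lambda>k. d k x)" by (rule summable_norm_cancel)
    then have "convergent (\<lambda>n. (\<Sum>k<n. d k x) + f (r 0) x)"
      by (intro convergent_add convergent_const) (simp add: summable_iff_convergent)
    moreover have "(\<Sum>k<n. d k x) + f (r 0) x = f (r n) x" for n
      unfolding d_def by (subst sum_lessThan_telescope) simp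
    ultimately show ?case by simp
  qed
  define g where "g x = lim (\<lambda>k. f (r k) x)" for x
  have gm [measurable]: "g \<in> borel_measurable ?M"
    unfolding g_def by measurable
  have lim: "AE x in ?M. (\<lambda>k. f (r k) x) \<longlonglongrightarrow> g x"
    using conv by eventually_elim (simp add: g_def convergent_LIMSEQ_iff)
  \<comment> \<open>The index \<open>n\<close> stays fixed while the other one runs along the
    subsequence.\<close>
  have est: "(\<lambda>x. f n x - g x) \<in> L2 \<Omega> \<and> L2_norm \<Omega> (\<lambda>x. f n x - g x) \<le> (1/2)^k" if "n \<ge> N k" for n k
  proof -
    have 1: "(\<lambda>x. f n x - f (r (i + k)) x) \<in> L2 \<Omega>" for i using f by (intro L2_diff)
    have rr: "r (i + k) \<ge> r k" for i by (induction i) (auto intro: order_trans[OF _ rS])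
    have 2: "L2_norm \<Omega> (\<lambda>x. f n x - f (r (i + k)) x) \<le> (1/2)^k" for i
      using N[of k n "r (i + k)"] that rr[of i] rN[of k] by force
    have 4: "AE x in ?M. (\<lambda>i. f n x - f (r (i + k)) x) \<longlonglongrightarrow> f n x - g x"
      using lim by eventually_elim (intro tendsto_intros LIMSEQ_ignore_initial_segment)
    have 3: "(\<lambda>x. f n x - g x) \<in> borel_measurable ?M" by measurable
    show ?thesis using L2_Fatou[OF 1 2 3 4] by blast
  qed
  have gL2: "g \<in> L2 \<Omega>"
    using L2_diff[OF f[of "N 0"] conjunct1[OF est[of 0 "N 0"]]] by simp
  have "(\<lambda>n. L2_norm \<Omega> (\<lambda>x. f n x - g x)) \<longlonglongrightarrow> 0"
  proof (rule LIMSEQ_I)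
    fix e :: real assume "e > 0"
    then obtain k where k: "(1/2::real)^k < e"
      using real_arch_pow_inv[of e "1/2"] by auto
    show "\<exists>no. \<forall>n\<ge>no. norm (L2_norm \<Omega> (\<lambda>x. f n x - g x) - 0) < e"
      using est[of k] k by (intro exI[of _ "N k"]) (auto intro: le_less_trans)
  qed
  with gL2 show ?thesis by (rule that)
qed

subsection \<open>Dense subspaces\<close>

text \<open>The closure of \<open>S\<close> in the seminorm, formulated without passing to classes
  of functions.\<close>

definition L2_approximable :: "'a::euclidean_space set \<Rightarrow> ('a \<Rightarrow> complex) set \<Rightarrow> ('a \<Rightarrow> complex) \<Rightarrow> bool" where
  "L2_approximable \<Omega> S f \<longleftrightarrow> f \<in> L2 \<Omega> \<and> (\<forall>e>0. \<exists>s\<in>S. L2_norm \<Omega> (\<lambda>x. f x - s x) < e)"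

text \<open>Shared by the test functions and the trigonometric sums. Because the measure is finite,
  bounded pointwise limits stay in the closure, which is what the approximation arguments rely
  on.\<close>

locale L2_subspace =
  fixes \<Omega> :: "'a::euclidean_space set" and S :: "('a \<Rightarrow> complex) set"
  assumes finite_\<Omega>: "\<Omega> \<in> lmeasurable"
    and sub: "S \<subseteq> L2 \<Omega>" and zero: "(\<lambda>_. 0) \<in> S"
    and add: "f \<in> S \<Longrightarrow> g \<in> S \<Longrightarrow> (\<lambda>x. f x + g x) \<in> S"
    and scale: "f \<in> S \<Longrightarrow> (\<lambda>x. c * f x) \<in> S"
begin

abbreviation "approx \<equiv> L2_approximable \<Omega> S"

lemma approx_member: "f \<in> S \<Longrightarrow> approx f"
  unfolding L2_approximable_def using sub by (auto intro!: bexI[of _ f])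

lemma approx_close:
  assumes "f \<in> L2 \<Omega>" "\<And>e. e > 0 \<Longrightarrow> \<exists>g. approx g \<and> L2_norm \<Omega> (\<lambda>x. f x - g x) < e"
  shows "approx f"
  unfolding L2_approximable_def
proof (intro conjI allI impI assms(1))
  fix e :: real assume "e > 0"
  then obtain g where g: "approx g" "L2_norm \<Omega> (\<lambda>x. f x - g x) < e/2"
    using assms(2)[of "e/2"] by auto
  then obtain s where s: "s \<in> S" "L2_norm \<Omega> (\<lambda>x. g x - s x) < e/2"
    unfolding L2_approximable_def using \<open>e > 0\<close> half_gt_zero by blast
  have "L2_norm \<Omega> (\<lambda>x. f x - s x) \<le> L2_norm \<Omega> (\<lambda>x. f x - g x) + L2_norm \<Omega> (\<lambda>x. g x - s x)"
    using L2_norm_triangle_via[OF assms(1), of g s] g(1) s(1) sub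
    by (auto simp: L2_approximable_def)
  with g s show "\<exists>s\<in>S. L2_norm \<Omega> (\<lambda>x. f x - s x) < e" by force
qed

lemma approx_add:
  assumes "approx f" "approx g" shows "approx (\<lambda>x. f x + g x)"
  unfolding L2_approximable_def
proof (intro conjI allI impI)
  show "(\<lambda>x. f x + g x) \<in> L2 \<Omega>" using assms by (auto simp: L2_approximable_def intro: L2_add)
  fix e :: real assume "e > 0"
  then obtain s t where st: "s \<in> S" "L2_norm \<Omega> (\<lambda>x. f x - s x) < e/2"
      "t \<in> S" "L2_norm \<Omega> (\<lambda>x. g x - t x) < e/2"
    using assms unfolding L2_approximable_def by (metis half_gt_zero)
  have "L2_norm \<Omega> (\<lambda>x. (f x - s x) + (g x - t x)) \<le> L2_norm \<Omega> (\<lambda>x. f x - s x) + L2_norm \<Omega> (\<lambda>x. g x - t x)"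
    using assms st sub by (intro L2_norm_triangle L2_diff) (auto simp: L2_approximable_def)
  then have "L2_norm \<Omega> (\<lambda>x. f x + g x - (s x + t x)) < e"
    using st by (simp add: algebra_simps)
  with add[OF st(1,3)] show "\<exists>s\<in>S. L2_norm \<Omega> (\<lambda>x. f x + g x - s x) < e"
    by (intro bexI[of _ "\<lambda>x. s x + t x"])
qed

lemma approx_scale:
  assumes "approx f" shows "approx (\<lambda>x. c * f x)"
  unfolding L2_approximable_def
proof (intro conjI allI impI)
  show "(\<lambda>x. c * f x) \<in> L2 \<Omega>" using assms by (auto simp: L2_approximable_def intro: L2_cmult)
  fix e :: real assume "e > 0"
  then obtain s where s: "s \<in> S" "L2_norm \<Omega> (\<lambda>x. f x - s x) < e / (cmod c + 1)"
    using assms unfolding L2_approximable_def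
    by (metis add.commute add_nonneg_pos divide_pos_pos norm_ge_zero zero_less_one)
  have "L2_norm \<Omega> (\<lambda>x. c * f x - c * s x) = cmod c * L2_norm \<Omega> (\<lambda>x. f x - s x)"
    using L2_norm_cmult[of \<Omega> c "\<lambda>x. f x - s x"] by (simp add: right_diff_distrib)
  also have "\<dots> \<le> (cmod c + 1) * L2_norm \<Omega> (\<lambda>x. f x - s x)"
    by (intro mult_right_mono) auto
  also have "\<dots> < e"
    using s(2) by (simp add: pos_less_divide_eq mult.commute add_nonneg_pos)
  finally show "\<exists>s\<in>S. L2_norm \<Omega> (\<lambda>x. c * f x - s x) < e" using scale[OF s(1), of c]
    by (intro bexI[of _ "\<lambda>x. c * s x"])
qed

lemma approx_diff: "approx f \<Longrightarrow> approx g \<Longrightarrow> approx (\<lambda>x. f x - g x)"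
  using approx_add[of f "\<lambda>x. (-1) * g x"] approx_scale[of g "-1"] by simp

text \<open>Dominated convergence for |g - f n|^2, which is at most 4 G^2.\<close>

lemma approx_dominated:
  assumes "\<And>n. approx (f n)" "\<And>x. x \<in> \<Omega> \<Longrightarrow> (\<lambda>n. f n x) \<longlonglongrightarrow> g x"
    and "\<And>n x. x \<in> \<Omega> \<Longrightarrow> cmod (f n x) \<le> G x" and "G \<in> borel_measurable (lebesgue_on \<Omega>)"
      "integrable (lebesgue_on \<Omega>) (\<lambda>x. (G x)\<^sup>2)"
  shows "approx g"
proof -
  let ?M = "lebesgue_on \<Omega>"
  have sp: "space ?M = \<Omega>" by (simp add: space_restrict_space)
  have fL: "f n \<in> L2 \<Omega>" for n using assms(1) by (auto simp: L2_approximable_def)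
  then have [measurable]: "\<And>n. f n \<in> borel_measurable ?M" using L2_measurable by auto
  have gm [measurable]: "g \<in> borel_measurable ?M"
    by (rule borel_measurable_LIMSEQ_metric[of f]) (auto simp: sp assms(2))
  have gb: "cmod (g x) \<le> G x" if "x \<in> \<Omega>" for x
    by (rule LIMSEQ_le_const2[OF tendsto_norm[OF assms(2)[OF that]]]) (use assms(3)[OF that] in auto)
  have gL: "g \<in> L2 \<Omega>"
  proof (rule L2I[OF gm])
    show "integrable ?M (\<lambda>x. (cmod (g x))\<^sup>2)"
      by (rule Bochner_Integration.integrable_bound[OF assms(5)])
        (auto simp: sp intro!: AE_I2 power_mono gb)
  qed
  have "(\<lambda>n. LINT x|?M. (cmod (g x - f n x))\<^sup>2) \<longlonglongrightarrow> (LINT x|?M. 0)"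
  proof (rule integral_dominated_convergence[where w="\<lambda>x. 4 * (G x)\<^sup>2"])
    show "AE x in ?M. (\<lambda>n. (cmod (g x - f n x))\<^sup>2) \<longlonglongrightarrow> 0"
    proof (rule AE_I2)
      fix x assume "x \<in> space ?M"
      then have "(\<lambda>n. (cmod (g x - f n x))\<^sup>2) \<longlonglongrightarrow> (cmod (g x - g x))\<^sup>2"
        by (intro tendsto_intros assms(2)) (simp add: sp)
      then show "(\<lambda>n. (cmod (g x - f n x))\<^sup>2) \<longlonglongrightarrow> 0" by simp
    qed
    show "AE x in ?M. norm ((cmod (g x - f n x))\<^sup>2) \<le> 4 * (G x)\<^sup>2" for n
    proof (rule AE_I2)
      fix x assume "x \<in> space ?M"
      then have "cmod (g x - f n x) \<le> 2 * G x"
        using gb[of x] assms(3)[of x n] norm_triangle_ineq4[of "g x" "f n x"] by (simp add: sp)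
      from power_mono[OF this, of 2] show "norm ((cmod (g x - f n x))\<^sup>2) \<le> 4 * (G x)\<^sup>2"
        by (simp add: power_mult_distrib)
    qed
  qed (use assms in auto)
  then have *: "(\<lambda>n. L2_norm \<Omega> (\<lambda>x. g x - f n x)) \<longlonglongrightarrow> 0"
    unfolding L2_norm_def using tendsto_real_sqrt by fastforce
  show ?thesis
  proof (rule approx_close[OF gL])
    fix e :: real assume "e > 0"
    from order_tendstoD(2)[OF * this] obtain n where "L2_norm \<Omega> (\<lambda>x. g x - f n x) < e"
      by (auto simp: eventually_sequentially)
    with assms(1) show "\<exists>h. approx h \<and> L2_norm \<Omega> (\<lambda>x. g x - h x) < e" by blast
  qed
qed

lemma approx_bounded_limit:
  assumes "\<And>n. approx (f n)" "\<And>x. x \<in> \<Omega> \<Longrightarrow> (\<lambda>n. f n x) \<longlonglongrightarrow> g x"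
    and "\<And>n x. x \<in> \<Omega> \<Longrightarrow> cmod (f n x) \<le> K"
  shows "approx g"
proof -
  interpret finite_measure "lebesgue_on \<Omega>"
    using finite_\<Omega> by (simp add: finite_measure_lebesgue_on)
  show ?thesis by (rule approx_dominated[where f=f and G="\<lambda>_. K"]) (use assms in auto)
qed

lemma approx_cong_AE:
  assumes "approx f" "AE x in lebesgue_on \<Omega>. f x = g x" "g \<in> borel_measurable (lebesgue_on \<Omega>)"
  shows "approx g"
proof -
  have fL: "f \<in> L2 \<Omega>" using assms(1) by (simp add: L2_approximable_def)
  have gL: "g \<in> L2 \<Omega>"
    by (rule L2_mono_AE(1)[OF assms(3) fL, of 1]) (use assms(2) in auto)
  have z: "L2_norm \<Omega> (\<lambda>x. g x - f x) = 0"
    using L2_norm_zero_iff[OF L2_diff[OF gL fL]] assms(2) by auto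
  show ?thesis
    by (rule approx_close[OF gL]) (use assms(1) z in auto)
qed

text \<open>Indicators are handled by Dynkin's theorem: boxes are stable under intersection and
  generate the Borel sets, while complements and countable disjoint unions preserve approximability.
  Null sets, simple functions and dominated limits lead from Borel indicators to all of L2.\<close>

theorem dense_if_boxes:
  assumes box: "\<And>a b. approx (indicator (box a b))" and f: "f \<in> L2 \<Omega>"
  shows "approx f"
proof -
  let ?M = "lebesgue_on \<Omega>"
  have \<Omega>m: "\<Omega> \<in> sets lebesgue" using finite_\<Omega> by (simp add: fmeasurableD)
  have sp: "space ?M = \<Omega>" by (simp add: space_restrict_space)
  \<comment> \<open>The constant 1 is what complements are formed with; it is the limit of
    indicators of growing boxes.\<close>
  have one: "approx (\<lambda>_. 1)"
  proof (rule approx_bounded_limit[where K=1])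
    fix x :: 'a assume "x \<in> \<Omega>"
    let ?B = "\<lambda>n. box (- (real n *\<^sub>R One)) (real n *\<^sub>R One) :: 'a set"
    show "(\<lambda>n. indicator (?B n) x) \<longlonglongrightarrow> (1::complex)"
    proof (rule tendsto_eventually)
      obtain n where n: "norm x < real n" using reals_Archimedean2 by blast
      show "\<forall>\<^sub>F n in sequentially. indicator (?B n) x = (1::complex)"
        unfolding eventually_sequentially
      proof (intro exI[of _ n] allI impI)
        fix k assume "n \<le> k"
        then have k: "norm x < real k" using n by linarith
        have "- real k < x \<bullet> i \<and> x \<bullet> i < real k" if "i \<in> Basis" for i
          using Basis_le_norm[OF that, of x] k by linarith
        then have "x \<in> ?B k" by (auto simp: mem_box)
        then show "indicator (?B k) x = (1::complex)" by simp
      qed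
    qed
  qed (rule box, simp add: indicator_def)
  have borel: "approx (indicator A)" if "A \<in> sets borel" for A :: "'a set"
  proof -
    let ?G = "range (\<lambda>(a, b). box a b :: 'a set)"
    have A: "A \<in> sigma_sets UNIV ?G"
      using that unfolding borel_eq_box by (simp add: sets_measure_of)
    have "Int_stable ?G"
      unfolding Int_stable_def by (auto simp: box_Int_box)
    moreover have "?G \<subseteq> Pow UNIV" by simp
    ultimately show ?thesis using A
    proof (induction rule: sigma_sets_induct_disjoint)
      case (basic A) then show ?case using box by auto
    next
      case empty show ?case using approx_member[OF zero] by (simp add: indicator_def[abs_def])
    next
      case (compl A)
      have "indicator (UNIV - A) = (\<lambda>x. 1 - indicator A x :: complex)"
        by (auto simp: indicator_def fun_eq_iff)
      with approx_diff[OF one compl(2)] show ?case by simp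
    next
      case (union A)
      have 1: "approx (\<lambda>x. \<Sum>i<n. indicator (A i) x)" for n
        by (induction n) (use approx_member[OF zero] approx_add union in auto)
      have 2: "(\<Sum>i<n. indicator (A i) x) = (indicator (\<Union>i<n. A i) x :: complex)" for x n
        using union(1) by (subst indicator_UN_disjoint) (auto simp: disjoint_family_on_def)
      show ?case
      proof (rule approx_bounded_limit[OF 1, where K=1])
        fix x show "(\<lambda>n. \<Sum>i<n. indicator (A i) x) \<longlonglongrightarrow> (indicator (\<Union>(range A)) x :: complex)"
          unfolding 2 by (rule LIMSEQ_indicator_UN)
      next
        show "cmod (\<Sum>i<n. indicator (A i) x) \<le> 1" for n x
          unfolding 2 by (simp add: indicator_def)
      qed
    qed
  qed
  have leb: "approx (indicator A)" if A: "A \<in> sets lebesgue" for A :: "'a set"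
  proof -
    obtain B N where B: "B \<in> sets borel" "negligible N" "B \<union> N = A"
      using sets_lebesgue_almost_borel[OF A] .
    have "AE x in lebesgue. x \<notin> N"
      using B(2) by (simp add: negligible_iff_null_sets AE_not_in)
    then have "AE x in ?M. x \<notin> N"
      using \<Omega>m by (simp add: AE_restrict_space_iff eventually_mono)
    then have "AE x in ?M. indicator B x = (indicator A x :: complex)"
      by eventually_elim (use B(3) in \<open>auto simp: indicator_def\<close>)
    then show ?thesis
      by (rule approx_cong_AE[OF borel[OF B(1)]])
        (use that in \<open>auto intro!: borel_measurable_indicator measurable_restrict_space1\<close>)
  qed
  have sets: "approx (indicator A)" if "A \<in> sets ?M" for A
    using that leb \<Omega>m by (auto simp: sets_restrict_space)
  have fm: "f \<in> borel_measurable ?M" using f by (rule L2_measurable)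
  obtain F where F: "\<And>i. simple_function ?M (F i)"
      "\<And>x. x \<in> space ?M \<Longrightarrow> (\<lambda>i. F i x) \<longlonglongrightarrow> f x"
      "\<And>i x. x \<in> space ?M \<Longrightarrow> dist (F i x) 0 \<le> 2 * dist (f x) 0"
    using borel_measurable_implies_sequence_metric[OF fm, of 0] by blast
  show ?thesis
  proof (rule approx_dominated[where f=F and G="\<lambda>x. 2 * cmod (f x)"])
    fix i
    have fin: "finite (F i ` space ?M)" using F(1) by (simp add: simple_function_def)
    have meas: "F i -` {y} \<inter> space ?M \<in> sets ?M" for y
      using F(1) by (rule simple_functionD)
    have sum: "approx (\<lambda>x. \<Sum>y\<in>Y. y * indicator (F i -` {y} \<inter> space ?M) x)" if "finite Y" for Y
      using that
    proof (induction Y)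
      case (insert y Y)
      show ?case unfolding sum.insert[OF insert(1,2)]
        by (rule approx_add[OF approx_scale[OF sets[OF meas]] insert(3)])
    qed (simp add: approx_member[OF zero])
    have "F i x = (\<Sum>y\<in>F i ` space ?M. y * indicator (F i -` {y} \<inter> space ?M) x)" if "x \<in> space ?M" for x
    proof -
      have "(\<Sum>y\<in>F i ` space ?M. y * indicator (F i -` {y} \<inter> space ?M) x) = (\<Sum>y\<in>{F i x}. y * indicator (F i -` {y} \<inter> space ?M) x)"
        by (rule sum.mono_neutral_right[OF fin]) (use that in \<open>auto simp: indicator_def\<close>)
      then show ?thesis using that by (simp add: indicator_def)
    qed
    then have "AE x in ?M. (\<Sum>y\<in>F i ` space ?M. y * indicator (F i -` {y} \<inter> space ?M) x) = F i x"
      by (intro AE_I2) (rule sym)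
    then show "approx (F i)"
      by (rule approx_cong_AE[OF sum[OF fin]]) (rule borel_measurable_simple_function[OF F(1)])
  next
    show "integrable ?M (\<lambda>x. (2 * cmod (f x))\<^sup>2)"
      using L2_square_integrable[OF f] by (simp add: power_mult_distrib)
  qed (use F fm sp in auto)
qed

end

text \<open>The squared norm of \<open>f\<close> is its pairing with \<open>cnj f\<close>, and
  replacing \<open>cnj f\<close> by an element of \<open>S\<close> changes the pairing by at most
  the norm of \<open>f\<close> times the approximation error. The pairing is bilinear, hence the
  conjugate in the density hypothesis.\<close>

lemma L2_orthogonal_dense_imp_zero:
  assumes f: "f \<in> L2 \<Omega>" and dense: "L2_approximable \<Omega> S (\<lambda>x. cnj (f x))" and S: "S \<subseteq> L2 \<Omega>"
    and orth: "\<And>s. s \<in> S \<Longrightarrow> (LINT x|lebesgue_on \<Omega>. f x * s x) = 0"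
  shows "AE x in lebesgue_on \<Omega>. f x = 0"
proof -
  have "(L2_norm \<Omega> f)\<^sup>2 \<le> 0 + e" if "e > 0" for e
  proof -
    obtain s where s: "s \<in> S" "L2_norm \<Omega> (\<lambda>x. cnj (f x) - s x) < e / (L2_norm \<Omega> f + 1)"
      using dense \<open>e > 0\<close> unfolding L2_approximable_def
      by (metis L2_norm_nonneg add_nonneg_pos divide_pos_pos zero_less_one)
    then have sL: "s \<in> L2 \<Omega>" using S by auto
    have "complex_of_real ((L2_norm \<Omega> f)\<^sup>2) = (LINT x|lebesgue_on \<Omega>. f x * cnj (f x))"
      unfolding L2_norm_square by (subst integral_complex_of_real[symmetric]) (simp add: complex_norm_square[symmetric])
    also have "\<dots> = (LINT x|lebesgue_on \<Omega>. f x * (cnj (f x) - s x))"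
      using L2_mult_integrable[OF f L2_cnj[OF f]] L2_mult_integrable[OF f sL] orth[OF s(1)]
      by (simp add: right_diff_distrib)
    finally have "cmod (complex_of_real ((L2_norm \<Omega> f)\<^sup>2)) \<le> L2_norm \<Omega> f * L2_norm \<Omega> (\<lambda>x. cnj (f x) - s x)"
      using L2_Cauchy_Schwarz[OF f L2_diff[OF L2_cnj[OF f] sL]] by simp
    then have "(L2_norm \<Omega> f)\<^sup>2 \<le> L2_norm \<Omega> f * L2_norm \<Omega> (\<lambda>x. cnj (f x) - s x)"
      by (simp only: norm_of_real)
    also have "\<dots> \<le> (L2_norm \<Omega> f + 1) * L2_norm \<Omega> (\<lambda>x. cnj (f x) - s x)"
      by (intro mult_right_mono) auto
    also have "\<dots> \<le> e"
      using s(2) by (simp add: pos_less_divide_eq mult.commute add_nonneg_pos less_imp_le)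
    finally show ?thesis by simp
  qed
  then have "(L2_norm \<Omega> f)\<^sup>2 \<le> 0" by (rule field_le_epsilon)
  then show ?thesis using L2_norm_zero_iff[OF f] by simp
qed

section \<open>Smooth functions, bump functions and the density of test functions\<close>

section \<open>Smooth functions and test functions\<close>

text \<open>Smoothness as a greatest fixed point: it is enough to exhibit a class closed under
  partial derivatives, so no higher derivative ever has to be computed.\<close>

lemma smooth_coinduct [consumes 1, case_names differentiable derivative]:
  fixes f :: "'a::euclidean_space \<Rightarrow> complex"
  assumes "P f" and "\<And>f x. P f \<Longrightarrow> f differentiable (at x)"
    and "\<And>f e. P f \<Longrightarrow> e \<in> Basis \<Longrightarrow> P (\<lambda>x. frechet_derivative f (at x) e)"
  shows "smooth f"
proof -
  have "Ck n f" if "P f" for n f using that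
  proof (induction n arbitrary: f)
    case 0
    then have "continuous (at x) f" for x
      using assms(2) differentiable_imp_continuous_within by blast
    then show ?case by (simp add: continuous_at_imp_continuous_on)
  qed (use assms(2,3) in auto)
  with assms(1) show ?thesis by (simp add: smooth_def)
qed

lemma smooth_differentiable: "smooth f \<Longrightarrow> f differentiable (at x)"
  unfolding smooth_def by (metis Ck.simps(2))

lemma smooth_frechet_derivative:
  "smooth f \<Longrightarrow> e \<in> Basis \<Longrightarrow> smooth (\<lambda>x. frechet_derivative f (at x) e)"
  unfolding smooth_def by (metis Ck.simps(2))

lemma smooth_has_derivative: "smooth f \<Longrightarrow> (f has_derivative frechet_derivative f (at x)) (at x)"
  using smooth_differentiable frechet_derivative_works by blast

lemma smooth_continuous: "smooth f \<Longrightarrow> continuous_on S f"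
  unfolding smooth_def by (metis Ck.simps(1) continuous_on_subset subset_UNIV)

text \<open>Needed for the Leibniz rule, which pairs a derivative with an undifferentiated factor
  that has one order to spare.\<close>

lemma Ck_Suc_imp: "Ck (Suc n) f \<Longrightarrow> Ck n f"
proof (induction n arbitrary: f)
  case 0
  then have "continuous (at x) f" for x
    using differentiable_imp_continuous_within by force
  then show ?case by (simp add: continuous_at_imp_continuous_on)
qed (metis Ck.simps(2))

lemma frechet_derivative_add_at:
  "f differentiable (at x) \<Longrightarrow> g differentiable (at x) \<Longrightarrow>
    frechet_derivative (\<lambda>x. f x + g x) (at x) e = frechet_derivative f (at x) e + frechet_derivative g (at x) e"
  using frechet_derivative_at[OF has_derivative_add[of f "frechet_derivative f (at x)" "at x" g "frechet_derivative g (at x)"]]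
  by (simp add: frechet_derivative_works fun_eq_iff)

lemma frechet_derivative_mult_at:
  fixes f g :: "'a::euclidean_space \<Rightarrow> complex"
  shows "f differentiable (at x) \<Longrightarrow> g differentiable (at x) \<Longrightarrow>
    frechet_derivative (\<lambda>x. f x * g x) (at x) e = f x * frechet_derivative g (at x) e + frechet_derivative f (at x) e * g x"
  using frechet_derivative_at[OF has_derivative_mult[of f "frechet_derivative f (at x)" x UNIV g "frechet_derivative g (at x)"]]
  by (simp add: frechet_derivative_works fun_eq_iff)

lemma smooth_const [simp]: "smooth (\<lambda>_. c)"
  by (rule smooth_coinduct[where P="\<lambda>f. \<exists>c. f = (\<lambda>_. c)"]) auto

lemma Ck_add: "Ck n f \<Longrightarrow> Ck n g \<Longrightarrow> Ck n (\<lambda>x. f x + g x)"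
  by (induction n arbitrary: f g) (auto simp: frechet_derivative_add_at intro: continuous_on_add)

lemma smooth_add: "smooth f \<Longrightarrow> smooth g \<Longrightarrow> smooth (\<lambda>x. f x + g x)"
  by (simp add: smooth_def Ck_add)

lemma Ck_mult: "Ck n f \<Longrightarrow> Ck n g \<Longrightarrow> Ck n (\<lambda>x. f x * g x)"
proof (induction n arbitrary: f g)
  case (Suc n)
  then have "Ck n f" "Ck n g" using Ck_Suc_imp by blast+
  with Suc show ?case by (auto simp: frechet_derivative_mult_at intro!: Ck_add)
qed (auto intro: continuous_on_mult)

lemma smooth_mult: "smooth f \<Longrightarrow> smooth g \<Longrightarrow> smooth (\<lambda>x. f x * g x)"
  by (simp add: smooth_def Ck_mult)

lemma smooth_uminus: "smooth f \<Longrightarrow> smooth (\<lambda>x. - f x)"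
  using smooth_mult[of "\<lambda>_. -1" f] by simp

lemma smooth_diff: "smooth f \<Longrightarrow> smooth g \<Longrightarrow> smooth (\<lambda>x. f x - g x)"
  using smooth_add[of f "\<lambda>x. - g x"] smooth_uminus[of g] by simp

lemma smooth_power: "smooth f \<Longrightarrow> smooth (\<lambda>x. f x ^ n)"
  by (induction n) (auto intro: smooth_mult)

lemma frechet_derivative_cnj_at:
  fixes f :: "'a::euclidean_space \<Rightarrow> complex"
  assumes "f differentiable (at x)"
  shows "((\<lambda>x. cnj (f x)) has_derivative (\<lambda>h. cnj (frechet_derivative f (at x) h))) (at x)"
    and "frechet_derivative (\<lambda>x. cnj (f x)) (at x) e = cnj (frechet_derivative f (at x) e)"
proof -
  show *: "((\<lambda>x. cnj (f x)) has_derivative (\<lambda>h. cnj (frechet_derivative f (at x) h))) (at x)"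
    using assms frechet_derivative_works by (intro has_derivative_cnj) blast
  show "frechet_derivative (\<lambda>x. cnj (f x)) (at x) e = cnj (frechet_derivative f (at x) e)"
    using frechet_derivative_at[OF *] by (simp add: fun_eq_iff)
qed

lemma smooth_cnj:
  assumes "smooth f" shows "smooth (\<lambda>x. cnj (f x))"
proof (rule smooth_coinduct[where P="\<lambda>h. \<exists>g. h = (\<lambda>x. cnj (g x)) \<and> smooth g"])
  show "\<exists>g. (\<lambda>x. cnj (f x)) = (\<lambda>x. cnj (g x)) \<and> smooth g" using assms by auto
next
  fix f :: "'a \<Rightarrow> complex" and x assume "\<exists>g. f = (\<lambda>x. cnj (g x)) \<and> smooth g"
  then show "f differentiable at x"
    using frechet_derivative_cnj_at(1) smooth_differentiable by (metis differentiableI)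
next
  fix f :: "'a \<Rightarrow> complex" and e :: 'a assume "\<exists>g. f = (\<lambda>x. cnj (g x)) \<and> smooth g" "e \<in> Basis"
  then obtain g where "f = (\<lambda>x. cnj (g x))" "smooth g" by blast
  then show "\<exists>g. (\<lambda>x. frechet_derivative f (at x) e) = (\<lambda>x. cnj (g x)) \<and> smooth g"
    using smooth_frechet_derivative[OF _ \<open>e \<in> Basis\<close>, of g]
    by (intro exI[of _ "\<lambda>x. frechet_derivative g (at x) e"])
      (auto simp: frechet_derivative_cnj_at smooth_differentiable)
qed

lemma has_derivative_affine_compose:
  fixes v :: "'a::euclidean_space" and g :: "real \<Rightarrow> complex"
  assumes "(g has_vector_derivative g') (at (v \<bullet> x + b))"
  shows "((\<lambda>x. g (v \<bullet> x + b)) has_derivative (\<lambda>h. of_real (v \<bullet> h) * g')) (at x)"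
proof -
  have "((\<lambda>x. v \<bullet> x + b) has_derivative (\<lambda>h. v \<bullet> h)) (at x)"
    by (auto intro!: derivative_eq_intros)
  from has_derivative_compose[OF this, of g "\<lambda>h. h *\<^sub>R g'"] assms
  show ?thesis by (simp add: has_vector_derivative_def scaleR_conv_of_real)
qed

text \<open>Coinduction over the multiples of g (v . x + b) with g in \<open>G\<close>. A partial
  derivative replaces g by g' and multiplies by a component of \<open>v\<close>, which is why the
  class admits a constant factor.\<close>

lemma smooth_affine_compose:
  fixes v :: "'a::euclidean_space"
  assumes "g \<in> G" and G: "\<And>g. g \<in> G \<Longrightarrow> \<exists>g'\<in>G. \<forall>t. (g has_vector_derivative g' t) (at t)"
  shows "smooth (\<lambda>x. g (v \<bullet> x + b))"
proof -
  define P where "P f \<longleftrightarrow> (\<exists>c. \<exists>g\<in>G. f = (\<lambda>x. c * g (v \<bullet> x + b)))" for f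
  have P: "\<exists>c. \<exists>g'\<in>G. \<forall>x. (f has_derivative (\<lambda>h. c * (of_real (v \<bullet> h) * g' (v \<bullet> x + b)))) (at x)"
    if f: "P f" for f
  proof -
    obtain c g where g: "g \<in> G" and f: "f = (\<lambda>x. c * g (v \<bullet> x + b))" using f unfolding P_def by blast
    obtain g' where g': "g' \<in> G" "\<And>t. (g has_vector_derivative g' t) (at t)" using G[OF g] by blast
    show ?thesis
      unfolding f by (intro exI[of _ c] bexI[OF _ g'(1)] allI
          has_derivative_mult_right[OF has_derivative_affine_compose[OF g'(2)]])
  qed
  show ?thesis
  proof (rule smooth_coinduct[where P=P])
    show "P (\<lambda>x. g (v \<bullet> x + b))"
      unfolding P_def by (intro exI[of _ 1] bexI[OF _ assms(1)]) simp
  next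
    fix f x assume "P f"
    then show "f differentiable at x" using P[of f] by (auto intro: differentiableI)
  next
    fix f and e :: 'a assume "P f"
    then obtain c g' where g: "g' \<in> G" "\<And>x. (f has_derivative (\<lambda>h. c * (of_real (v \<bullet> h) * g' (v \<bullet> x + b)))) (at x)"
      using P[of f] by blast
    have "frechet_derivative f (at x) e = (c * of_real (v \<bullet> e)) * g' (v \<bullet> x + b)" for x
      using fun_cong[OF frechet_derivative_at[OF g(2)[of x]], of e] by (simp only: mult.assoc)
    then show "P (\<lambda>x. frechet_derivative f (at x) e)"
      unfolding P_def by (intro exI[of _ "c * of_real (v \<bullet> e)"] bexI[OF _ g(1)] ext)
  qed
qed

lemma smooth_exp_affine:
  fixes v :: "'a::euclidean_space"
  shows "smooth (\<lambda>x. exp ((w::complex) * of_real (v \<bullet> x)))"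
proof -
  have "smooth (\<lambda>x. (\<lambda>t. exp (w * of_real t)) (v \<bullet> x + 0))"
  proof (rule smooth_affine_compose[where G="range (\<lambda>c t. c * exp (w * of_real t))"])
    show "(\<lambda>t. exp (w * of_real t)) \<in> range (\<lambda>c t. c * exp (w * of_real t))"
      by (rule range_eqI[of _ _ 1]) simp
    fix g assume "g \<in> range (\<lambda>c t. c * exp (w * of_real t))"
    then obtain c where g: "g = (\<lambda>t. c * exp (w * of_real t))" by auto
    have "(g has_vector_derivative (c * w) * exp (w * of_real t)) (at t)" for t
      unfolding g
      by (rule has_vector_derivative_real_field) (auto intro!: derivative_eq_intros)
    then show "\<exists>g'\<in>range (\<lambda>c t. c * exp (w * of_real t)). \<forall>t. (g has_vector_derivative g' t) (at t)"
      by auto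
  qed
  then show ?thesis by simp
qed

lemma frechet_derivative_exp_affine:
  fixes v :: "'a::euclidean_space"
  shows "frechet_derivative (\<lambda>x. exp (w * of_real (v \<bullet> x))) (at x) e = (w::complex) * of_real (v \<bullet> e) * exp (w * of_real (v \<bullet> x))"
proof -
  have "((\<lambda>t. exp (w * of_real t)) has_vector_derivative w * exp (w * of_real (v \<bullet> x + 0))) (at (v \<bullet> x + 0))"
    by (rule has_vector_derivative_real_field[where f="\<lambda>z. exp (w * z)"]) (auto intro!: derivative_eq_intros)
  from fun_cong[OF frechet_derivative_at[OF has_derivative_affine_compose[OF this]], of e]
  show ?thesis by (simp add: mult_ac)
qed

lemma has_derivative_affine:
  fixes v :: "'a::euclidean_space"
  shows "((\<lambda>x. complex_of_real (v \<bullet> x + b)) has_derivative (\<lambda>h. of_real (v \<bullet> h))) (at x)"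
proof -
  have "((\<lambda>x. v \<bullet> x + b) has_derivative (\<lambda>h. v \<bullet> h)) (at x)"
    by (auto intro!: derivative_eq_intros)
  then show ?thesis by (rule bounded_linear.has_derivative[OF bounded_linear_of_real])
qed

lemma frechet_derivative_affine:
  fixes v :: "'a::euclidean_space"
  shows "frechet_derivative (\<lambda>x. complex_of_real (v \<bullet> x + b)) (at x) e = of_real (v \<bullet> e)"
  using fun_cong[OF frechet_derivative_at[OF has_derivative_affine[of v b x]], of e] by (rule sym)

lemma smooth_affine:
  fixes v :: "'a::euclidean_space"
  shows "smooth (\<lambda>x. complex_of_real (v \<bullet> x + b))"
proof -
  have "Ck n (\<lambda>x. complex_of_real (v \<bullet> x + b))" for n
  proof (cases n)
    case (Suc m)
    have "Ck m (\<lambda>x. frechet_derivative (\<lambda>x. complex_of_real (v \<bullet> x + b)) (at x) e)" for e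
      unfolding frechet_derivative_affine using smooth_const[unfolded smooth_def] by blast
    then show ?thesis
      using differentiableI[OF has_derivative_affine[of v b]] unfolding Suc Ck.simps by blast
  qed (auto intro!: continuous_intros)
  then show ?thesis unfolding smooth_def by blast
qed

subsection \<open>Bump functions\<close>

text \<open>For \<open>p = 1\<close> this is the classical flat function exp (-1/t). The polynomial
  factor makes the family closed under differentiation.\<close>

definition bump :: "real poly \<Rightarrow> real \<Rightarrow> real" where
  "bump p t = (if t > 0 then poly p (1/t) * exp (- (1/t)) else 0)"

lemma poly_div_exp_tendsto_0: "((\<lambda>x. poly p x / exp x) \<longlongrightarrow> (0::real)) at_top"
proof -
  have "((\<lambda>x. \<Sum>i\<le>degree p. coeff p i * (x ^ i / exp x)) \<longlongrightarrow> (\<Sum>i\<le>degree p. coeff p i * (0::real))) at_top"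
    by (intro tendsto_intros tendsto_power_div_exp_0)
  then show ?thesis by (simp add: poly_altdef sum_divide_distrib)
qed

text \<open>Since 1/t has derivative -(1/t)^2, the chain rule turns p into x^2 (p - p'). At 0 the
  point is that exp outgrows every polynomial.\<close>

lemma bump_has_derivative:
  "(bump p has_field_derivative bump ([:0,0,1:] * (p - pderiv p)) t) (at t)"
proof (cases t "0::real" rule: linorder_cases)
  case less
  have "(bump p has_field_derivative 0) (at t)"
    by (rule has_field_derivative_transform_within_open[where f="\<lambda>_. 0" and S="{..<0}"])
      (use less in \<open>auto simp: bump_def\<close>)
  then show ?thesis using less by (simp add: bump_def)
next
  case greater
  have "((\<lambda>t. poly p (1/t) * exp (- (1/t))) has_field_derivative
      poly ([:0,0,1:] * (p - pderiv p)) (1/t) * exp (- (1/t))) (at t)"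
  proof -
    have inv: "((\<lambda>t. 1/t) has_field_derivative - ((1/t) * (1/t))) (at t)"
      using greater by (auto intro!: derivative_eq_intros simp: divide_simps)
    have 1: "((\<lambda>t. poly p (1/t)) has_field_derivative poly (pderiv p) (1/t) * (- ((1/t) * (1/t)))) (at t)"
      by (rule DERIV_chain2[OF poly_DERIV inv])
    have 2: "((\<lambda>t. exp (- (1/t))) has_field_derivative exp (- (1/t)) * (- (- ((1/t) * (1/t))))) (at t)"
      by (rule DERIV_chain2[OF DERIV_exp DERIV_minus[OF inv]])
    have eq: "poly ([:0,0,1:] * (p - pderiv p)) y = y * y * (poly p y - poly (pderiv p) y)" for y
      by simp
    have "a * - (y * y) * E + E * - (- (y * y)) * b = y * y * (b - a) * E" for a b y E :: real
      by (simp add: algebra_simps)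
    then show ?thesis
      unfolding eq by (intro DERIV_cong[OF DERIV_mult[OF 1 2]])
  qed
  then have "(bump p has_field_derivative poly ([:0,0,1:] * (p - pderiv p)) (1/t) * exp (- (1/t))) (at t)"
    by (rule has_field_derivative_transform_within_open[where S="{0<..}"])
      (use greater in \<open>auto simp: bump_def\<close>)
  then show ?thesis using greater by (simp add: bump_def)
next
  case equal
  have "((\<lambda>h. (bump p (0 + h) - bump p 0) / h) \<longlongrightarrow> 0) (at_right 0)"
  proof (rule Lim_transform_eventually)
    \<comment> \<open>Dividing by \<open>h\<close> multiplies by 1/h, which replaces p by x
      p.\<close>
    show "((\<lambda>h. poly (pCons 0 p) (inverse h) / exp (inverse h)) \<longlongrightarrow> 0) (at_right (0::real))"
      by (rule filterlim_compose[OF poly_div_exp_tendsto_0 filterlim_inverse_at_top_right])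
    have "eventually (\<lambda>h. h > (0::real)) (at_right 0)" by (simp add: eventually_at_right_less)
    then show "\<forall>\<^sub>F h in at_right 0. poly (pCons 0 p) (inverse h) / exp (inverse h) = (bump p (0 + h) - bump p 0) / h"
      by eventually_elim (simp add: bump_def exp_minus field_simps)
  qed
  moreover have "((\<lambda>h. (bump p (0 + h) - bump p 0) / h) \<longlongrightarrow> 0) (at_left 0)"
  proof (rule tendsto_eventually)
    have "eventually (\<lambda>h. h < (0::real)) (at_left 0)" by (simp add: eventually_at_left_field) (rule lt_ex)
    then show "\<forall>\<^sub>F h in at_left 0. (bump p (0 + h) - bump p 0) / h = 0"
      by eventually_elim (simp add: bump_def)
  qed
  ultimately have "(bump p has_field_derivative 0) (at 0)"
    unfolding DERIV_def by (intro filterlim_split_at)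
  with equal show ?thesis by (simp add: bump_def)
qed

lemma smooth_bump:
  fixes v :: "'a::euclidean_space"
  shows "smooth (\<lambda>x. complex_of_real (bump p (v \<bullet> x + b)))"
proof (rule smooth_affine_compose[where G="range (\<lambda>p t. complex_of_real (bump p t))"])
  fix g assume "g \<in> range (\<lambda>p t. complex_of_real (bump p t))"
  then obtain p where g: "g = (\<lambda>t. complex_of_real (bump p t))" by auto
  have "(g has_vector_derivative complex_of_real (bump ([:0,0,1:] * (p - pderiv p)) t)) (at t)" for t
    unfolding g using bump_has_derivative[of p t]
    by (intro has_vector_derivative_of_real) (simp add: has_real_derivative_iff_has_vector_derivative)
  then show "\<exists>g'\<in>range (\<lambda>p t. complex_of_real (bump p t)). \<forall>t. (g has_vector_derivative g' t) (at t)"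
    by (intro bexI[of _ "\<lambda>t. complex_of_real (bump ([:0,0,1:] * (p - pderiv p)) t)"] allI rangeI)
qed (rule rangeI)

lemma bump_1: "0 \<le> bump 1 t" "bump 1 t \<le> 1" "bump 1 t > 0 \<longleftrightarrow> t > 0" "bump 1 t = 0 \<longleftrightarrow> t \<le> 0"
  by (auto simp: bump_def)

subsection \<open>Test functions on the unit square\<close>

abbreviation pderiv1 :: "(real \<times> real \<Rightarrow> complex) \<Rightarrow> real \<times> real \<Rightarrow> complex" where
  "pderiv1 f x \<equiv> frechet_derivative f (at x) (1, 0)"

abbreviation pderiv2 :: "(real \<times> real \<Rightarrow> complex) \<Rightarrow> real \<times> real \<Rightarrow> complex" where
  "pderiv2 f x \<equiv> frechet_derivative f (at x) (0, 1)"

lemma Basis_plane: "(Basis :: (real \<times> real) set) = {(1, 0), (0, 1)}"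
  by (auto simp: Basis_prod_def)

lemma test_function_support:
  assumes "smooth f" "compact K" "K \<subseteq> \<Omega>" "{x. f x \<noteq> 0} \<subseteq> K"
  shows "test_function \<Omega> f"
proof -
  have sub: "closure {x. f x \<noteq> 0} \<subseteq> K"
    using assms by (intro closure_minimal compact_imp_closed)
  then have "compact (K \<inter> closure {x. f x \<noteq> 0})"
    using assms by (intro compact_Int_closed) auto
  also have "K \<inter> closure {x. f x \<noteq> 0} = closure {x. f x \<noteq> 0}"
    using sub by blast
  finally show ?thesis
    using assms(1,3) sub unfolding test_function_def by blast
qed

lemma nonzero_subset_closure: "f x \<noteq> 0 \<Longrightarrow> x \<in> closure {x. f x \<noteq> 0}"
  using closure_subset[of "{x. f x \<noteq> 0}"] by auto

lemma test_function_mult: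
  assumes "smooth \<psi>" "test_function \<Omega> \<phi>" shows "test_function \<Omega> (\<lambda>x. \<psi> x * \<phi> x)"
proof (rule test_function_support[of _ "closure {x. \<phi> x \<noteq> 0}"])
  show "smooth (\<lambda>x. \<psi> x * \<phi> x)" using assms by (intro smooth_mult) (auto simp: test_function_def)
  show "{x. \<psi> x * \<phi> x \<noteq> 0} \<subseteq> closure {x. \<phi> x \<noteq> 0}"
    using nonzero_subset_closure[of \<phi>] by auto
qed (use assms in \<open>auto simp: test_function_def\<close>)

lemma test_function_add:
  assumes "test_function \<Omega> f" "test_function \<Omega> g" shows "test_function \<Omega> (\<lambda>x. f x + g x)"
proof (rule test_function_support[of _ "closure {x. f x \<noteq> 0} \<union> closure {x. g x \<noteq> 0}"])
  show "{x. f x + g x \<noteq> 0} \<subseteq> closure {x. f x \<noteq> 0} \<union> closure {x. g x \<noteq> 0}"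
    using nonzero_subset_closure[of f] nonzero_subset_closure[of g] by force
qed (use assms in \<open>auto simp: test_function_def intro: smooth_add compact_Un\<close>)

lemma W0_open: "open W0"
  unfolding W0_def by (intro open_Times) auto

lemma W0_sets: "W0 \<in> sets lebesgue" 
  using W0_open by (simp add: borel_open)

lemma W0_box: "W0 = box (0, 0) (1, 1)"
  by (simp add: W0_def box_prod)

lemma W0_lmeasurable: "W0 \<in> lmeasurable"
  unfolding W0_box by (rule lmeasurable_box)

lemma continuous_bounded_W0:
  fixes f :: "real \<times> real \<Rightarrow> complex"
  assumes "continuous_on UNIV f" obtains K where "K \<ge> 0" "\<And>x. x \<in> W0 \<Longrightarrow> cmod (f x) \<le> K"
proof -
  have "compact (f ` cbox (0,0) (1,1))"
    using assms by (intro compact_continuous_image compact_cbox) (auto intro: continuous_on_subset)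
  then obtain K where K: "\<And>x. x \<in> cbox (0,0) (1,1) \<Longrightarrow> cmod (f x) \<le> K"
    using compact_imp_bounded bounded_iff by (metis imageI)
  show ?thesis
  proof (rule that[of "max K 0"])
    fix x assume "x \<in> W0"
    then have "x \<in> cbox (0,0) (1,1)" using box_subset_cbox by (auto simp: W0_box)
    from K[OF this] show "cmod (f x) \<le> max K 0" by simp
  qed simp
qed

lemma continuous_measurable_W0:
  fixes f :: "real \<times> real \<Rightarrow> complex"
  shows "continuous_on UNIV f \<Longrightarrow> f \<in> borel_measurable (lebesgue_on W0)"
  by (intro continuous_imp_measurable_on_sets_lebesgue W0_sets) (auto intro: continuous_on_subset)

lemma continuous_L2_W0:
  fixes f :: "real \<times> real \<Rightarrow> complex"
  assumes "continuous_on UNIV f" shows "f \<in> L2 W0"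
proof -
  obtain K where "K \<ge> 0" "\<And>x. x \<in> W0 \<Longrightarrow> cmod (f x) \<le> K"
    using continuous_bounded_W0[OF assms] by blast
  with assms show ?thesis by (intro L2_bounded[of _ _ K] continuous_measurable_W0 W0_lmeasurable)
qed

lemma smooth_L2_W0: "smooth f \<Longrightarrow> f \<in> L2 W0"
  by (intro continuous_L2_W0 smooth_continuous)

lemma mem_box_plane: "x \<in> box a b \<longleftrightarrow> fst a < fst x \<and> fst x < fst b \<and> snd a < snd x \<and> snd x < snd (b :: real \<times> real)"
  by (auto simp: box_prod mem_Times_iff)

interpretation test_functions: L2_subspace W0 "{\<phi>. test_function W0 \<phi>}"
proof
  show "{\<phi>. test_function W0 \<phi>} \<subseteq> L2 W0"
    by (auto simp: test_function_def intro: smooth_L2_W0)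
  show "(\<lambda>_. 0) \<in> {\<phi>. test_function W0 \<phi>}"
    by (simp add: test_function_def)
  show "W0 \<in> lmeasurable" by (rule W0_lmeasurable)
  show "(\<lambda>x. c * f x) \<in> {\<phi>. test_function W0 \<phi>}" if "f \<in> {\<phi>. test_function W0 \<phi>}" for f c
    using that test_function_mult[of "\<lambda>_. c" W0 f] by simp
qed (auto intro: test_function_add)

text \<open>With a product \<open>\<beta>\<close> of shifted bumps, positive exactly on the box, \<open>1 - (1 - \<beta>) ^ n\<close> increases to the
  indicator of the box.\<close>

lemma test_functions_dense:
  assumes "f \<in> L2 W0" shows "L2_approximable W0 {\<phi>. test_function W0 \<phi>} f"
proof (rule test_functions.dense_if_boxes[OF _ assms])
  have inner: "test_functions.approx (indicator (box a b))" if sub: "cbox a b \<subseteq> W0" for a b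
  proof -
    define \<beta> where "\<beta> x = bump 1 ((1,0) \<bullet> x + (- fst a)) * bump 1 ((-1,0) \<bullet> x + fst b)
        * bump 1 ((0,1) \<bullet> x + (- snd a)) * bump 1 ((0,-1) \<bullet> x + snd b)" for x :: "real \<times> real"
    have b01: "0 \<le> \<beta> x" "\<beta> x \<le> 1" for x
      unfolding \<beta>_def by (auto intro!: mult_nonneg_nonneg mult_le_one bump_1)
    have b0: "\<beta> x \<noteq> 0 \<longleftrightarrow> x \<in> box a b" for x
      unfolding \<beta>_def by (cases x) (auto simp: bump_1 mem_box_plane)
    have sm: "smooth (\<lambda>x. complex_of_real (\<beta> x))"
      unfolding \<beta>_def of_real_mult by (intro smooth_mult smooth_bump)
    define f where "f n x = 1 - (1 - complex_of_real (\<beta> x)) ^ n" for n x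
    have fr: "f n x = of_real (1 - (1 - \<beta> x) ^ n)" for n x by (simp add: f_def)
    have "test_function W0 (f n)" for n
    proof (rule test_function_support[OF _ compact_cbox sub])
      show "smooth (f n)" unfolding f_def by (intro smooth_diff smooth_power smooth_const sm)
      have "x \<in> box a b" if "f n x \<noteq> 0" for x
        using that b0[of x] by (auto simp: f_def)
      then show "{x. f n x \<noteq> 0} \<subseteq> cbox a b" using box_subset_cbox by blast
    qed
    then have "test_functions.approx (f n)" for n by (intro test_functions.approx_member) auto
    then show ?thesis
    proof (rule test_functions.approx_bounded_limit[where K=1])
      fix x
      have "(\<lambda>n. (1 - \<beta> x) ^ n) \<longlonglongrightarrow> (if x \<in> box a b then 0 else 1)"
      proof (cases "x \<in> box a b")
        case True
        then have "\<beta> x > 0" using b0[of x] b01(1)[of x] by auto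
        with True b01(2)[of x] show ?thesis by (simp add: LIMSEQ_power_zero)
      qed (use b0[of x] in auto)
      then have "(\<lambda>n. complex_of_real (1 - (1 - \<beta> x) ^ n)) \<longlonglongrightarrow> of_real (1 - (if x \<in> box a b then 0 else 1))"
        by (intro tendsto_intros)
      then show "(\<lambda>n. f n x) \<longlonglongrightarrow> indicator (box a b) x"
        unfolding fr by (simp add: indicator_def split: if_splits)
    next
      fix n x
      have "0 \<le> (1 - \<beta> x) ^ n" "(1 - \<beta> x) ^ n \<le> 1"
        using b01[of x] by (auto intro: power_le_one)
      then show "cmod (f n x) \<le> 1" unfolding fr norm_of_real by simp
    qed
  qed
  fix a b :: "real \<times> real"
  \<comment> \<open>The margin \<open>d n\<close> keeps the closures of the shrunken boxes inside
    the open square. Once it is below the distance of a given point to the boundary, the shrunken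
    box and the original one agree about that point.\<close>
  define d where "d n = 1 / (real n + 2)" for n
  have d: "0 < d n" for n by (simp add: d_def)
  have dlim: "d \<longlonglongrightarrow> 0" unfolding d_def by real_asymp
  define a' where "a' n = (max (fst a) (d n), max (snd a) (d n))" for n
  define b' where "b' n = (min (fst b) (1 - d n), min (snd b) (1 - d n))" for n
  have "cbox (a' n) (b' n) \<subseteq> W0" for n
    using d[of n] by (auto simp: cbox_prod W0_def a'_def b'_def)
  then have "test_functions.approx (indicator (box (a' n) (b' n)))" for n by (rule inner)
  then show "test_functions.approx (indicator (box a b))"
  proof (rule test_functions.approx_bounded_limit[where K=1])
    fix x assume x: "x \<in> W0"
    then have "0 < Min {fst x, 1 - fst x, snd x, 1 - snd x}" by (auto simp: W0_def)
    from order_tendstoD(2)[OF dlim this]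
    have "\<forall>\<^sub>F n in sequentially. x \<in> box (a' n) (b' n) \<longleftrightarrow> x \<in> box a b"
      by eventually_elim (auto simp: mem_box_plane a'_def b'_def)
    then show "(\<lambda>n. indicator (box (a' n) (b' n)) x) \<longlonglongrightarrow> (indicator (box a b) x :: complex)"
      by (intro tendsto_eventually) (rule eventually_mono, auto simp: indicator_def)
  qed (simp add: indicator_def)
qed

section \<open>Sobolev functions: weak derivatives, the norm, completeness, Green's formula\<close>

section \<open>The space \<open>H1\<close> on the unit square\<close>

subsection \<open>Weak derivatives\<close>

lemma has_weak_derivD:
  assumes "has_weak_deriv \<Omega> e u a" "test_function \<Omega> \<phi>"
  shows "(LINT x|lebesgue_on \<Omega>. u x * frechet_derivative \<phi> (at x) e) = - (LINT x|lebesgue_on \<Omega>. a x * \<phi> x)"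
  using assms by (simp add: has_weak_deriv_def)

text \<open>The difference of two candidates pairs to zero with all test functions, and these are
  dense.\<close>

lemma has_weak_deriv_unique:
  assumes "has_weak_deriv W0 e u a" "has_weak_deriv W0 e u b" and a: "a \<in> L2 W0" and b: "b \<in> L2 W0"
  shows "AE x in lebesgue_on W0. a x = b x"
proof -
  have "AE x in lebesgue_on W0. a x - b x = 0"
  proof (rule L2_orthogonal_dense_imp_zero[OF L2_diff[OF a b]
        test_functions_dense[OF L2_cnj[OF L2_diff[OF a b]]] test_functions.sub])
    fix \<phi> assume "\<phi> \<in> {\<phi>. test_function W0 \<phi>}"
    then have \<phi>: "test_function W0 \<phi>" "\<phi> \<in> L2 W0" by (auto simp: test_function_def intro: smooth_L2_W0)
    have "(LINT x|lebesgue_on W0. a x * \<phi> x) = (LINT x|lebesgue_on W0. b x * \<phi> x)"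
      using has_weak_derivD[OF assms(1) \<phi>(1)] has_weak_derivD[OF assms(2) \<phi>(1)] by simp
    then show "(LINT x|lebesgue_on W0. (a x - b x) * \<phi> x) = 0"
      using L2_mult_integrable[OF a \<phi>(2)] L2_mult_integrable[OF b \<phi>(2)]
      by (simp add: left_diff_distrib)
  qed
  then show ?thesis by simp
qed

text \<open>The value of \<open>weak_deriv\<close> is a choice. Exhibiting any weak derivative
  \<open>a\<close> makes the choice meaningful and fixes it almost everywhere; this is how weak
  derivatives are computed later.\<close>

lemma weak_deriv_props:
  assumes "a \<in> L2 W0" "has_weak_deriv W0 e u a"
  shows weak_deriv_L2: "weak_deriv W0 e u \<in> L2 W0"
    and weak_deriv_has_weak_deriv: "has_weak_deriv W0 e u (weak_deriv W0 e u)"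
    and weak_deriv_AE: "AE x in lebesgue_on W0. weak_deriv W0 e u x = a x"
proof -
  have *: "weak_deriv W0 e u \<in> L2 W0 \<and> has_weak_deriv W0 e u (weak_deriv W0 e u)"
    unfolding weak_deriv_def by (rule someI[of _ a]) (use assms in simp)
  then show "weak_deriv W0 e u \<in> L2 W0" "has_weak_deriv W0 e u (weak_deriv W0 e u)" by auto
  show "AE x in lebesgue_on W0. weak_deriv W0 e u x = a x"
    using * assms by (intro has_weak_deriv_unique[of e u]) auto
qed

lemma weak_deriv_norm:
  assumes "a \<in> L2 W0" "has_weak_deriv W0 e u a"
  shows "L2_norm W0 (weak_deriv W0 e u) = L2_norm W0 a"
  by (intro L2_norm_cong_AE weak_deriv_AE[OF assms] L2_measurable weak_deriv_L2[OF assms] assms)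

lemma H1_D:
  assumes "u \<in> H1 W0"
  shows H1_L2: "u \<in> L2 W0"
    and H1_weak_deriv_L2: "e \<in> Basis \<Longrightarrow> weak_deriv W0 e u \<in> L2 W0"
    and H1_has_weak_deriv: "e \<in> Basis \<Longrightarrow> has_weak_deriv W0 e u (weak_deriv W0 e u)"
  using assms unfolding H1_def by (auto dest!: bspec intro: weak_deriv_L2 weak_deriv_has_weak_deriv)

lemma H1_I:
  assumes "u \<in> L2 W0" "\<And>e. e \<in> Basis \<Longrightarrow> a e \<in> L2 W0" "\<And>e. e \<in> Basis \<Longrightarrow> has_weak_deriv W0 e u (a e)"
  shows "u \<in> H1 W0"
  unfolding H1_def by (intro CollectI conjI ballI assms(1)) (auto intro!: bexI[where x="a _"] assms(2,3))

lemma has_weak_deriv_add: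
  assumes "has_weak_deriv W0 e u a" "has_weak_deriv W0 e v b" "e \<in> Basis"
    "u \<in> L2 W0" "v \<in> L2 W0" "a \<in> L2 W0" "b \<in> L2 W0"
  shows "has_weak_deriv W0 e (\<lambda>x. u x + v x) (\<lambda>x. a x + b x)"
  unfolding has_weak_deriv_def
proof (intro allI impI)
  fix \<phi> assume \<phi>: "test_function W0 \<phi>"
  then have L: "\<phi> \<in> L2 W0" "(\<lambda>x. frechet_derivative \<phi> (at x) e) \<in> L2 W0"
    using assms(3) by (auto simp: test_function_def intro: smooth_L2_W0 smooth_frechet_derivative)
  show "(LINT x|lebesgue_on W0. (u x + v x) * frechet_derivative \<phi> (at x) e) = - (LINT x|lebesgue_on W0. (a x + b x) * \<phi> x)"
    using L assms has_weak_derivD[OF assms(1) \<phi>] has_weak_derivD[OF assms(2) \<phi>]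
    by (simp add: distrib_right L2_mult_integrable)
qed

lemma has_weak_deriv_cmult:
  assumes "has_weak_deriv W0 e u a"
  shows "has_weak_deriv W0 e (\<lambda>x. c * u x) (\<lambda>x. c * a x)"
  using assms unfolding has_weak_deriv_def by (simp add: mult.assoc)

text \<open>The product \<psi> \<phi> is again a test function; testing \<open>u\<close> with it and
  expanding the derivative of the product gives the Leibniz rule.\<close>

lemma has_weak_deriv_mult:
  assumes \<psi>: "smooth \<psi>" and e: "e \<in> Basis" and u: "u \<in> L2 W0" "a \<in> L2 W0" "has_weak_deriv W0 e u a"
  shows "has_weak_deriv W0 e (\<lambda>x. \<psi> x * u x) (\<lambda>x. \<psi> x * a x + frechet_derivative \<psi> (at x) e * u x)"
  unfolding has_weak_deriv_def
proof (intro allI impI)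
  fix \<phi> assume \<phi>: "test_function W0 \<phi>"
  then have s: "smooth \<phi>" by (simp add: test_function_def)
  let ?d = "\<lambda>f x. frechet_derivative f (at x) e"
  have L: "(\<lambda>x. ?d \<psi> x * \<phi> x) \<in> L2 W0" "(\<lambda>x. \<psi> x * \<phi> x) \<in> L2 W0" "(\<lambda>x. \<psi> x * ?d \<phi> x) \<in> L2 W0"
    using \<psi> s e by (auto intro!: smooth_L2_W0 smooth_mult smooth_frechet_derivative)
  have d: "?d (\<lambda>x. \<psi> x * \<phi> x) x = \<psi> x * ?d \<phi> x + ?d \<psi> x * \<phi> x" for x
    by (rule frechet_derivative_mult_at) (use \<psi> s smooth_differentiable in auto)
  have "(LINT x|lebesgue_on W0. u x * ?d (\<lambda>x. \<psi> x * \<phi> x) x) = - (LINT x|lebesgue_on W0. a x * (\<psi> x * \<phi> x))"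
    by (rule has_weak_derivD[OF u(3) test_function_mult[OF \<psi> \<phi>]])
  then have "(LINT x|lebesgue_on W0. u x * (\<psi> x * ?d \<phi> x)) + (LINT x|lebesgue_on W0. u x * (?d \<psi> x * \<phi> x))
      = - (LINT x|lebesgue_on W0. a x * (\<psi> x * \<phi> x))"
    unfolding d distrib_left using L u by (subst (asm) Bochner_Integration.integral_add) (auto intro: L2_mult_integrable)
  moreover have "(LINT x|lebesgue_on W0. (\<psi> x * a x + ?d \<psi> x * u x) * \<phi> x)
      = (LINT x|lebesgue_on W0. a x * (\<psi> x * \<phi> x)) + (LINT x|lebesgue_on W0. u x * (?d \<psi> x * \<phi> x))"
    by (subst Bochner_Integration.integral_add[symmetric, OF L2_mult_integrable[OF u(2) L(2)] L2_mult_integrable[OF u(1) L(1)]])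
      (simp add: algebra_simps)
  moreover have "(LINT x|lebesgue_on W0. \<psi> x * u x * ?d \<phi> x) = (LINT x|lebesgue_on W0. u x * (\<psi> x * ?d \<phi> x))"
    by (simp add: mult_ac)
  ultimately show "(LINT x|lebesgue_on W0. \<psi> x * u x * ?d \<phi> x) =
      - (LINT x|lebesgue_on W0. (\<psi> x * a x + ?d \<psi> x * u x) * \<phi> x)"
    by (simp add: algebra_simps add_eq_0_iff)
qed

text \<open>For a fixed test function both sides of the defining identity are continuous in
  L2.\<close>

lemma has_weak_deriv_limit:
  assumes "\<And>n. has_weak_deriv W0 e (u n) (a n)" "e \<in> Basis"
    and "\<And>n. u n \<in> L2 W0" "u' \<in> L2 W0" "(\<lambda>n. L2_norm W0 (\<lambda>x. u n x - u' x)) \<longlonglongrightarrow> 0"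
    and "\<And>n. a n \<in> L2 W0" "a' \<in> L2 W0" "(\<lambda>n. L2_norm W0 (\<lambda>x. a n x - a' x)) \<longlonglongrightarrow> 0"
  shows "has_weak_deriv W0 e u' a'"
  unfolding has_weak_deriv_def
proof (intro allI impI)
  fix \<phi> assume \<phi>: "test_function W0 \<phi>"
  then have L: "\<phi> \<in> L2 W0" "(\<lambda>x. frechet_derivative \<phi> (at x) e) \<in> L2 W0"
    using assms(2) by (auto simp: test_function_def intro: smooth_L2_W0 smooth_frechet_derivative)
  have "(\<lambda>n. LINT x|lebesgue_on W0. u n x * frechet_derivative \<phi> (at x) e)
      \<longlonglongrightarrow> (LINT x|lebesgue_on W0. u' x * frechet_derivative \<phi> (at x) e)"
    by (rule L2_pairing_tendsto[OF assms(3-5) L(2)])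
  moreover have "(\<lambda>n. - (LINT x|lebesgue_on W0. a n x * \<phi> x)) \<longlonglongrightarrow> - (LINT x|lebesgue_on W0. a' x * \<phi> x)"
    by (intro tendsto_minus L2_pairing_tendsto[OF assms(6-8) L(1)])
  moreover have "(LINT x|lebesgue_on W0. u n x * frechet_derivative \<phi> (at x) e) = - (LINT x|lebesgue_on W0. a n x * \<phi> x)" for n
    by (rule has_weak_derivD[OF assms(1) \<phi>])
  ultimately show "(LINT x|lebesgue_on W0. u' x * frechet_derivative \<phi> (at x) e) = - (LINT x|lebesgue_on W0. a' x * \<phi> x)"
    using LIMSEQ_unique by simp
qed

subsection \<open>The norm\<close>

text \<open>Reading the norm as a Euclidean norm of three numbers lets the triangle inequality be
  inherited from there.\<close>

lemma H1_norm_plane: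
  "H1_norm W0 u = norm (L2_norm W0 u, L2_norm W0 (weak_deriv W0 (1,0) u), L2_norm W0 (weak_deriv W0 (0,1) u))"
  by (simp add: H1_norm_def Basis_plane norm_Pair)

lemma H1_norm_nonneg [simp]: "0 \<le> H1_norm W0 u"
  by (simp add: H1_norm_plane)

lemma H1_norm_square:
  "(H1_norm W0 u)\<^sup>2 = (L2_norm W0 u)\<^sup>2 + (L2_norm W0 (weak_deriv W0 (1,0) u))\<^sup>2 + (L2_norm W0 (weak_deriv W0 (0,1) u))\<^sup>2"
  by (simp add: H1_norm_def Basis_plane)

lemma L2_norm_le_H1_norm: "L2_norm W0 u \<le> H1_norm W0 u"
  by (rule power2_le_imp_le) (auto simp: H1_norm_square)

lemma L2_norm_weak_deriv_le_H1_norm: "e \<in> Basis \<Longrightarrow> L2_norm W0 (weak_deriv W0 e u) \<le> H1_norm W0 u"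
  by (rule power2_le_imp_le) (auto simp: H1_norm_square Basis_plane)

lemma H1_norm_le:
  assumes "L2_norm W0 u \<le> A" "\<And>e. e \<in> Basis \<Longrightarrow> L2_norm W0 (weak_deriv W0 e u) \<le> B e"
  shows "H1_norm W0 u \<le> A + B (1,0) + B (0,1)"
proof -
  have "norm (a, b, c) \<le> \<bar>a\<bar> + \<bar>b\<bar> + \<bar>c\<bar>" for a b c :: real
    using norm_Pair_le[of a "(b, c)"] norm_Pair_le[of b c] by simp
  then have "H1_norm W0 u \<le> L2_norm W0 u + L2_norm W0 (weak_deriv W0 (1,0) u) + L2_norm W0 (weak_deriv W0 (0,1) u)"
    unfolding H1_norm_plane
    by (rule order_trans) simp
  with assms(1) assms(2)[of "(1,0)"] assms(2)[of "(0,1)"] show ?thesis by (simp add: Basis_plane)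
qed

lemma norm_Pair3_mono:
  fixes a b c :: real
  assumes "0 \<le> a" "a \<le> a'" "0 \<le> b" "b \<le> b'" "0 \<le> c" "c \<le> c'"
  shows "norm (a, b, c) \<le> norm (a', b', c')"
proof -
  have "a\<^sup>2 \<le> a'\<^sup>2" "b\<^sup>2 \<le> b'\<^sup>2" "c\<^sup>2 \<le> c'\<^sup>2"
    using assms by (auto intro: power_mono)
  then show ?thesis by (simp add: norm_Pair)
qed

lemma weak_deriv_add_AE:
  assumes "u \<in> H1 W0" "v \<in> H1 W0" "e \<in> Basis"
  shows "AE x in lebesgue_on W0. weak_deriv W0 e (\<lambda>x. u x + v x) x = weak_deriv W0 e u x + weak_deriv W0 e v x"
  using assms by (intro weak_deriv_AE has_weak_deriv_add L2_add H1_D)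

lemma weak_deriv_cmult_AE:
  assumes "u \<in> H1 W0" "e \<in> Basis"
  shows "AE x in lebesgue_on W0. weak_deriv W0 e (\<lambda>x. c * u x) x = c * weak_deriv W0 e u x"
  using assms by (intro weak_deriv_AE has_weak_deriv_cmult L2_cmult H1_D)

lemma weak_deriv_mult_AE:
  assumes "smooth \<psi>" "u \<in> H1 W0" "e \<in> Basis"
  shows "AE x in lebesgue_on W0. weak_deriv W0 e (\<lambda>x. \<psi> x * u x) x
    = \<psi> x * weak_deriv W0 e u x + frechet_derivative \<psi> (at x) e * u x"
    and "(\<lambda>x. \<psi> x * weak_deriv W0 e u x + frechet_derivative \<psi> (at x) e * u x) \<in> L2 W0"
proof -
  have L: "(\<lambda>x. f x * g x) \<in> L2 W0" if f: "smooth f" and g: "g \<in> L2 W0" for f g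
  proof -
    have c: "continuous_on UNIV f" using f by (rule smooth_continuous)
    obtain K where "K \<ge> 0" "\<And>x. x \<in> W0 \<Longrightarrow> cmod (f x) \<le> K" using continuous_bounded_W0[OF c] by metis
    then show ?thesis
      by (intro L2_bounded_mult(1)[of _ _ _ K] g continuous_measurable_W0 c AE_I2) (auto simp: space_restrict_space)
  qed
  show *: "(\<lambda>x. \<psi> x * weak_deriv W0 e u x + frechet_derivative \<psi> (at x) e * u x) \<in> L2 W0"
    using assms by (intro L2_add L smooth_frechet_derivative H1_D)
  show "AE x in lebesgue_on W0. weak_deriv W0 e (\<lambda>x. \<psi> x * u x) x
    = \<psi> x * weak_deriv W0 e u x + frechet_derivative \<psi> (at x) e * u x"
    using assms by (intro weak_deriv_AE[OF *] has_weak_deriv_mult H1_D)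
qed

lemma H1_add: "u \<in> H1 W0 \<Longrightarrow> v \<in> H1 W0 \<Longrightarrow> (\<lambda>x. u x + v x) \<in> H1 W0"
  by (rule H1_I[where a="\<lambda>e x. weak_deriv W0 e u x + weak_deriv W0 e v x"])
    (auto intro!: L2_add has_weak_deriv_add dest: H1_D)

lemma H1_cmult: "u \<in> H1 W0 \<Longrightarrow> (\<lambda>x. c * u x) \<in> H1 W0"
  by (rule H1_I[where a="\<lambda>e x. c * weak_deriv W0 e u x"])
    (auto intro!: L2_cmult has_weak_deriv_cmult dest: H1_D)

lemma H1_uminus: "u \<in> H1 W0 \<Longrightarrow> (\<lambda>x. - u x) \<in> H1 W0"
  using H1_cmult[of u "-1"] by simp

lemma H1_diff: "u \<in> H1 W0 \<Longrightarrow> v \<in> H1 W0 \<Longrightarrow> (\<lambda>x. u x - v x) \<in> H1 W0"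
  using H1_add[of u "\<lambda>x. - v x"] H1_uminus[of v] by simp

lemma weak_deriv_diff_AE:
  assumes "u \<in> H1 W0" "v \<in> H1 W0" "e \<in> Basis"
  shows "AE x in lebesgue_on W0. weak_deriv W0 e (\<lambda>x. u x - v x) x = weak_deriv W0 e u x - weak_deriv W0 e v x"
  using weak_deriv_add_AE[OF assms(1) H1_uminus[OF assms(2)] assms(3)] weak_deriv_cmult_AE[OF assms(2,3), of "-1"]
  by auto

lemma weak_deriv_zero: "weak_deriv W0 e (\<lambda>_. 0) \<in> L2 W0" "L2_norm W0 (weak_deriv W0 e (\<lambda>_. 0)) = 0"
proof -
  have w: "has_weak_deriv W0 e (\<lambda>_. 0) (\<lambda>_. 0)" by (simp add: has_weak_deriv_def)
  show "weak_deriv W0 e (\<lambda>_. 0) \<in> L2 W0" "L2_norm W0 (weak_deriv W0 e (\<lambda>_. 0)) = 0"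
    using weak_deriv_L2[OF L2_zero w] weak_deriv_norm[OF L2_zero w] by simp_all
qed

lemma H1_zero: "(\<lambda>_. 0) \<in> H1 W0"
  by (rule H1_I[where a="\<lambda>e x. 0"]) (auto simp: has_weak_deriv_def)

lemma H1_norm_zero [simp]: "H1_norm W0 (\<lambda>_. 0) = 0"
  by (simp add: H1_norm_plane weak_deriv_zero)

lemma H1_mult:
  assumes "smooth \<psi>" "u \<in> H1 W0" shows "(\<lambda>x. \<psi> x * u x) \<in> H1 W0"
proof (rule H1_I)
  have c: "continuous_on UNIV \<psi>" using assms(1) by (rule smooth_continuous)
  obtain K where "K \<ge> 0" "\<And>x. x \<in> W0 \<Longrightarrow> cmod (\<psi> x) \<le> K" using continuous_bounded_W0[OF c] by metis
  then show "(\<lambda>x. \<psi> x * u x) \<in> L2 W0"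
    by (intro L2_bounded_mult(1)[of _ _ _ K] H1_L2 assms continuous_measurable_W0 c AE_I2) (auto simp: space_restrict_space)
  fix e :: "real \<times> real" assume e: "e \<in> Basis"
  show "(\<lambda>x. \<psi> x * weak_deriv W0 e u x + frechet_derivative \<psi> (at x) e * u x) \<in> L2 W0"
    by (rule weak_deriv_mult_AE(2)[OF assms e])
  show "has_weak_deriv W0 e (\<lambda>x. \<psi> x * u x) (\<lambda>x. \<psi> x * weak_deriv W0 e u x + frechet_derivative \<psi> (at x) e * u x)"
    using assms e by (intro has_weak_deriv_mult H1_D)
qed

lemma H1_norm_triangle:
  assumes "u \<in> H1 W0" "v \<in> H1 W0"
  shows "H1_norm W0 (\<lambda>x. u x + v x) \<le> H1_norm W0 u + H1_norm W0 v"
proof -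
  have w: "L2_norm W0 (weak_deriv W0 e (\<lambda>x. u x + v x)) \<le> L2_norm W0 (weak_deriv W0 e u) + L2_norm W0 (weak_deriv W0 e v)"
    if e: "e \<in> Basis" for e
  proof -
    have "L2_norm W0 (weak_deriv W0 e (\<lambda>x. u x + v x)) = L2_norm W0 (\<lambda>x. weak_deriv W0 e u x + weak_deriv W0 e v x)"
      using assms e by (intro L2_norm_cong_AE weak_deriv_add_AE L2_measurable L2_add H1_D H1_add)
    also have "\<dots> \<le> L2_norm W0 (weak_deriv W0 e u) + L2_norm W0 (weak_deriv W0 e v)"
      using assms e by (intro L2_norm_triangle H1_D)
    finally show ?thesis .
  qed
  have "H1_norm W0 (\<lambda>x. u x + v x) \<le>
    norm (L2_norm W0 u + L2_norm W0 v, L2_norm W0 (weak_deriv W0 (1,0) u) + L2_norm W0 (weak_deriv W0 (1,0) v),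
      L2_norm W0 (weak_deriv W0 (0,1) u) + L2_norm W0 (weak_deriv W0 (0,1) v))"
    unfolding H1_norm_plane
    using assms by (intro norm_Pair3_mono w L2_norm_triangle H1_D L2_norm_nonneg) (auto simp: Basis_plane)
  also have "\<dots> \<le> H1_norm W0 u + H1_norm W0 v"
    unfolding H1_norm_plane
    using norm_triangle_ineq[of "(L2_norm W0 u, L2_norm W0 (weak_deriv W0 (1,0) u), L2_norm W0 (weak_deriv W0 (0,1) u))"
      "(L2_norm W0 v, L2_norm W0 (weak_deriv W0 (1,0) v), L2_norm W0 (weak_deriv W0 (0,1) v))"] by simp
  finally show ?thesis .
qed

lemma H1_norm_cmult:
  assumes "u \<in> H1 W0" shows "H1_norm W0 (\<lambda>x. c * u x) = cmod c * H1_norm W0 u"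
proof -
  have w: "L2_norm W0 (weak_deriv W0 e (\<lambda>x. c * u x)) = cmod c * L2_norm W0 (weak_deriv W0 e u)"
    if "e \<in> Basis" for e
  proof -
    have "L2_norm W0 (weak_deriv W0 e (\<lambda>x. c * u x)) = L2_norm W0 (\<lambda>x. c * weak_deriv W0 e u x)"
      using assms that by (intro L2_norm_cong_AE weak_deriv_cmult_AE L2_measurable L2_cmult H1_D H1_cmult)
    then show ?thesis by (simp add: L2_norm_cmult)
  qed
  have "(H1_norm W0 (\<lambda>x. c * u x))\<^sup>2 = (cmod c * H1_norm W0 u)\<^sup>2"
    by (simp add: H1_norm_square w Basis_plane L2_norm_cmult power_mult_distrib distrib_left)
  then show ?thesis by (simp add: power2_eq_iff_nonneg)
qed

lemma H1_norm_minus_commute: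
  assumes "u \<in> H1 W0" "v \<in> H1 W0"
  shows "H1_norm W0 (\<lambda>x. u x - v x) = H1_norm W0 (\<lambda>x. v x - u x)"
  using H1_norm_cmult[OF H1_diff[OF assms], of "-1"] by simp

lemma H1_norm_triangle_via:
  assumes "u \<in> H1 W0" "v \<in> H1 W0" "w \<in> H1 W0"
  shows "H1_norm W0 (\<lambda>x. u x - w x) \<le> H1_norm W0 (\<lambda>x. u x - v x) + H1_norm W0 (\<lambda>x. v x - w x)"
  using H1_norm_triangle[OF H1_diff[OF assms(1,2)] H1_diff[OF assms(2,3)]] by simp

lemma H1_norm_triangle_sub:
  assumes "u \<in> H1 W0" "v \<in> H1 W0"
  shows "H1_norm W0 u \<le> H1_norm W0 v + H1_norm W0 (\<lambda>x. u x - v x)"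
  using H1_norm_triangle[OF assms(2) H1_diff[OF assms]] by simp

lemma L2_norm_weak_deriv_diff_le:
  assumes "u \<in> H1 W0" "v \<in> H1 W0" "e \<in> Basis"
  shows "L2_norm W0 (\<lambda>x. weak_deriv W0 e u x - weak_deriv W0 e v x) \<le> H1_norm W0 (\<lambda>x. u x - v x)"
proof -
  have "L2_norm W0 (\<lambda>x. weak_deriv W0 e u x - weak_deriv W0 e v x) = L2_norm W0 (weak_deriv W0 e (\<lambda>x. u x - v x))"
    using assms weak_deriv_diff_AE[OF assms]
    by (intro L2_norm_cong_AE L2_measurable L2_diff H1_D H1_diff) (auto simp: eq_commute)
  then show ?thesis using L2_norm_weak_deriv_le_H1_norm[OF assms(3)] by simp
qed

lemma H1_tendsto_L2:
  assumes "\<And>n. u n \<in> H1 W0" "v \<in> H1 W0" "(\<lambda>n. H1_norm W0 (\<lambda>x. u n x - v x)) \<longlonglongrightarrow> 0"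
  shows "(\<lambda>n. L2_norm W0 (\<lambda>x. u n x - v x)) \<longlonglongrightarrow> 0"
    and "e \<in> Basis \<Longrightarrow> (\<lambda>n. L2_norm W0 (\<lambda>x. weak_deriv W0 e (u n) x - weak_deriv W0 e v x)) \<longlonglongrightarrow> 0"
proof -
  show "(\<lambda>n. L2_norm W0 (\<lambda>x. u n x - v x)) \<longlonglongrightarrow> 0"
    by (rule tendsto_sandwich[OF _ _ tendsto_const assms(3)]) (auto simp: L2_norm_le_H1_norm)
  show "(\<lambda>n. L2_norm W0 (\<lambda>x. weak_deriv W0 e (u n) x - weak_deriv W0 e v x)) \<longlonglongrightarrow> 0" if e: "e \<in> Basis"
    by (rule tendsto_sandwich[OF _ _ tendsto_const assms(3)]) (auto simp: L2_norm_weak_deriv_diff_le[OF assms(1,2) e])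
qed

text \<open>Functions and weak derivatives converge separately in L2, and closedness of weak
  differentiation identifies the limits.\<close>

lemma H1_complete:
  assumes u: "\<And>n. u n \<in> H1 W0"
    and Cauchy: "\<And>e. e > 0 \<Longrightarrow> \<exists>N. \<forall>m\<ge>N. \<forall>n\<ge>N. H1_norm W0 (\<lambda>x. u m x - u n x) < e"
  obtains v where "v \<in> H1 W0" "(\<lambda>n. H1_norm W0 (\<lambda>x. u n x - v x)) \<longlonglongrightarrow> 0"
proof -
  have 0: "\<exists>N. \<forall>m\<ge>N. \<forall>n\<ge>N. L2_norm W0 (\<lambda>x. u m x - u n x) < e" if "e > 0" for e
    using Cauchy[OF that] L2_norm_le_H1_norm le_less_trans by meson
  obtain v where v: "v \<in> L2 W0" "(\<lambda>n. L2_norm W0 (\<lambda>x. u n x - v x)) \<longlonglongrightarrow> 0"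
    using L2_complete[OF W0_lmeasurable H1_L2[OF u] 0] by metis
  have "\<forall>b\<in>Basis. \<exists>a. a \<in> L2 W0 \<and> (\<lambda>n. L2_norm W0 (\<lambda>x. weak_deriv W0 b (u n) x - a x)) \<longlonglongrightarrow> 0"
  proof
    fix b :: "real \<times> real" assume b: "b \<in> Basis"
    have 1: "\<exists>N. \<forall>m\<ge>N. \<forall>n\<ge>N. L2_norm W0 (\<lambda>x. weak_deriv W0 b (u m) x - weak_deriv W0 b (u n) x) < e"
      if "e > 0" for e
      using Cauchy[OF that] L2_norm_weak_deriv_diff_le[OF u u b] le_less_trans by meson
    show "\<exists>a. a \<in> L2 W0 \<and> (\<lambda>n. L2_norm W0 (\<lambda>x. weak_deriv W0 b (u n) x - a x)) \<longlonglongrightarrow> 0"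
      using L2_complete[OF W0_lmeasurable H1_weak_deriv_L2[OF u b] 1] by metis
  qed
  from bchoice[OF this] obtain a where a: "\<And>b. b \<in> Basis \<Longrightarrow> a b \<in> L2 W0"
      "\<And>b. b \<in> Basis \<Longrightarrow> (\<lambda>n. L2_norm W0 (\<lambda>x. weak_deriv W0 b (u n) x - a b x)) \<longlonglongrightarrow> 0"
    by auto
  have w: "has_weak_deriv W0 b v (a b)" if b: "b \<in> Basis" for b
    by (rule has_weak_deriv_limit[OF H1_has_weak_deriv[OF u b] b H1_L2[OF u] v H1_weak_deriv_L2[OF u b] a[OF b]])
  have vH: "v \<in> H1 W0" by (rule H1_I[OF v(1) a(1) w])
  have n: "L2_norm W0 (weak_deriv W0 b (\<lambda>x. u n x - v x)) = L2_norm W0 (\<lambda>x. weak_deriv W0 b (u n) x - a b x)"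
    if b: "b \<in> Basis" for b n
  proof (intro L2_norm_cong_AE L2_measurable)
    show "AE x in lebesgue_on W0. weak_deriv W0 b (\<lambda>x. u n x - v x) x = weak_deriv W0 b (u n) x - a b x"
      using weak_deriv_diff_AE[OF u vH b] weak_deriv_AE[OF a(1) w, OF b b] by eventually_elim simp
  qed (intro H1_weak_deriv_L2 L2_diff H1_diff u vH b a(1)[OF b])+
  have "(\<lambda>n. H1_norm W0 (\<lambda>x. u n x - v x)) \<longlonglongrightarrow> norm (0::real, 0::real, 0::real)"
    unfolding H1_norm_plane by (intro tendsto_intros v) (use n a(2) in \<open>auto simp: Basis_plane\<close>)
  then have "(\<lambda>n. H1_norm W0 (\<lambda>x. u n x - v x)) \<longlonglongrightarrow> 0" by simp
  with vH show ?thesis by (rule that)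
qed

lemma H1_norm_mult_bound:
  assumes "smooth \<psi>"
  obtains K where "K \<ge> 0" "\<And>u. u \<in> H1 W0 \<Longrightarrow> H1_norm W0 (\<lambda>x. \<psi> x * u x) \<le> K * H1_norm W0 u"
proof -
  have c: "continuous_on UNIV \<psi>" using assms by (rule smooth_continuous)
  have cd: "continuous_on UNIV (\<lambda>x. frechet_derivative \<psi> (at x) e)" if "e \<in> Basis" for e
    using assms that by (intro smooth_continuous smooth_frechet_derivative)
  obtain K where K: "K \<ge> 0" "\<And>x. x \<in> W0 \<Longrightarrow> cmod (\<psi> x) \<le> K" using continuous_bounded_W0[OF c] by metis
  have "\<forall>e\<in>Basis. \<exists>L. L \<ge> 0 \<and> (\<forall>x\<in>W0. cmod (frechet_derivative \<psi> (at x) e) \<le> L)"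
    using continuous_bounded_W0[OF cd] by (intro ballI) metis
  from bchoice[OF this] obtain L where L: "\<And>e. e \<in> Basis \<Longrightarrow> L e \<ge> 0"
      "\<And>e x. e \<in> Basis \<Longrightarrow> x \<in> W0 \<Longrightarrow> cmod (frechet_derivative \<psi> (at x) e) \<le> L e" by auto
  have "H1_norm W0 (\<lambda>x. \<psi> x * u x) \<le> (K + (K + L (1,0)) + (K + L (0,1))) * H1_norm W0 u" if u: "u \<in> H1 W0" for u
  proof -
    have 0: "L2_norm W0 (\<lambda>x. \<psi> x * u x) \<le> K * L2_norm W0 u"
      using K by (intro L2_bounded_mult H1_L2 u continuous_measurable_W0 c AE_I2) (auto simp: space_restrict_space)
    have 1: "L2_norm W0 (weak_deriv W0 e (\<lambda>x. \<psi> x * u x)) \<le> (K + L e) * H1_norm W0 u" if e: "e \<in> Basis" for e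
    proof -
      have A: "(\<lambda>x. \<psi> x * weak_deriv W0 e u x) \<in> L2 W0"
          "L2_norm W0 (\<lambda>x. \<psi> x * weak_deriv W0 e u x) \<le> K * L2_norm W0 (weak_deriv W0 e u)"
        using K e by (auto intro!: L2_bounded_mult H1_weak_deriv_L2[OF u] continuous_measurable_W0 c AE_I2 simp: space_restrict_space)
      have B: "(\<lambda>x. frechet_derivative \<psi> (at x) e * u x) \<in> L2 W0"
          "L2_norm W0 (\<lambda>x. frechet_derivative \<psi> (at x) e * u x) \<le> L e * L2_norm W0 u"
        by (intro L2_bounded_mult[where K="L e"] H1_L2[OF u] continuous_measurable_W0 cd[OF e] AE_I2 L(1)[OF e] L(2)[OF e],
            simp add: space_restrict_space)+
      have "L2_norm W0 (weak_deriv W0 e (\<lambda>x. \<psi> x * u x))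
          = L2_norm W0 (\<lambda>x. \<psi> x * weak_deriv W0 e u x + frechet_derivative \<psi> (at x) e * u x)"
        using assms u e by (intro L2_norm_cong_AE weak_deriv_mult_AE L2_measurable H1_D H1_mult)
      also have "\<dots> \<le> K * L2_norm W0 (weak_deriv W0 e u) + L e * L2_norm W0 u"
        using L2_norm_triangle[OF A(1) B(1)] A(2) B(2) by linarith
      also have "\<dots> \<le> K * H1_norm W0 u + L e * H1_norm W0 u"
        using K L e by (intro add_mono mult_left_mono L2_norm_weak_deriv_le_H1_norm L2_norm_le_H1_norm) auto
      finally show ?thesis by (simp add: distrib_right)
    qed
    have 2: "L2_norm W0 (\<lambda>x. \<psi> x * u x) \<le> K * H1_norm W0 u"
      using 0 mult_left_mono[OF L2_norm_le_H1_norm K(1), of u] by linarith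
    show ?thesis using H1_norm_le[OF 2 1] by (simp add: distrib_right)
  qed
  moreover have "0 \<le> K + (K + L (1,0)) + (K + L (0,1))"
    using K L by (auto simp: Basis_plane)
  ultimately show ?thesis using that by metis
qed

subsection \<open>Green's formula and smooth functions\<close>

text \<open>Passes to the gauge integral over the closed square, where the order of integration can
  be exchanged and the fundamental theorem of calculus applies; the boundary is negligible.\<close>

lemma LINT_W0_continuous:
  fixes f :: "real \<times> real \<Rightarrow> complex"
  assumes "continuous_on UNIV f"
  shows "(LINT x|lebesgue_on W0. f x) = integral (cbox (0,0) (1,1)) f"
  using lebesgue_integral_eq_integral[OF L2_integrable[OF continuous_L2_W0[OF assms] W0_lmeasurable] W0_sets]
  by (simp add: W0_box integral_open_interval)

lemma continuous_L2_interval: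
  fixes f :: "real \<Rightarrow> complex"
  assumes "continuous_on UNIV f" shows "f \<in> L2 {0<..<1}"
proof -
  have "compact (f ` {0..1})"
    using assms by (intro compact_continuous_image compact_Icc) (auto intro: continuous_on_subset)
  then obtain K where K: "\<And>x. x \<in> {0..1} \<Longrightarrow> cmod (f x) \<le> K"
    using compact_imp_bounded bounded_iff by (metis imageI)
  show ?thesis
    by (rule L2_bounded[of _ _ K])
      (use assms K in \<open>auto intro!: continuous_imp_measurable_on_sets_lebesgue intro: continuous_on_subset\<close>)
qed

lemma LINT_interval_continuous:
  fixes f :: "real \<Rightarrow> complex"
  assumes "continuous_on UNIV f"
  shows "(LINT t|lebesgue_on {0<..<1}. f t) = integral {0..1} f"
  using lebesgue_integral_eq_integral[OF L2_integrable[OF continuous_L2_interval[OF assms]]]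
  by (simp add: integral_open_interval_real)

lemma smooth_vector_derivative_slice:
  fixes F :: "real \<times> real \<Rightarrow> complex"
  assumes "smooth F"
  shows "((\<lambda>s. F (s, t)) has_vector_derivative pderiv1 F (s, t)) (at s)"
    and "((\<lambda>s. F (t, s)) has_vector_derivative pderiv2 F (t, s)) (at s)"
proof -
  note lin = linear_scale[OF has_derivative_linear[OF smooth_has_derivative[OF assms]]]
  have a: "((\<lambda>s. (s, t)) has_derivative (\<lambda>h. (h, 0))) (at s)"
    by (auto intro!: derivative_eq_intros)
  have "((\<lambda>s. F (s, t)) has_derivative (\<lambda>h. frechet_derivative F (at (s, t)) (h, 0))) (at s)"
    by (rule has_derivative_compose[OF a smooth_has_derivative[OF assms]])
  moreover have "(\<lambda>h. frechet_derivative F (at (s, t)) (h, 0)) = (\<lambda>h. h *\<^sub>R pderiv1 F (s, t))"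
  proof
    show "frechet_derivative F (at (s, t)) (h, 0) = h *\<^sub>R pderiv1 F (s, t)" for h
      using lin[of "(s,t)" h "(1,0)"] by simp
  qed
  ultimately show "((\<lambda>s. F (s, t)) has_vector_derivative pderiv1 F (s, t)) (at s)"
    by (simp only: has_vector_derivative_def)
  have b: "((\<lambda>s. (t, s)) has_derivative (\<lambda>h. (0, h))) (at s)"
    by (auto intro!: derivative_eq_intros)
  have "((\<lambda>s. F (t, s)) has_derivative (\<lambda>h. frechet_derivative F (at (t, s)) (0, h))) (at s)"
    by (rule has_derivative_compose[OF b smooth_has_derivative[OF assms]])
  moreover have "(\<lambda>h. frechet_derivative F (at (t, s)) (0, h)) = (\<lambda>h. h *\<^sub>R pderiv2 F (t, s))"
  proof
    show "frechet_derivative F (at (t, s)) (0, h) = h *\<^sub>R pderiv2 F (t, s)" for h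
      using lin[of "(t,s)" h "(0,1)"] by simp
  qed
  ultimately show "((\<lambda>s. F (t, s)) has_vector_derivative pderiv2 F (t, s)) (at s)"
    by (simp only: has_vector_derivative_def)
qed

lemma continuous_slice:
  fixes F :: "real \<times> real \<Rightarrow> complex"
  assumes "continuous_on UNIV F"
  shows "continuous_on UNIV (\<lambda>t. F (s, t))" "continuous_on UNIV (\<lambda>t. F (t, s))"
  by (rule continuous_on_compose2[OF assms]; auto intro!: continuous_intros)+

text \<open>The fundamental theorem of calculus on horizontal lines, after exchanging the order of
  integration.\<close>

lemma Green1:
  assumes "smooth F"
  shows "(LINT x|lebesgue_on W0. pderiv1 F x) = (LINT t|lebesgue_on {0<..<1}. F (1, t) - F (0, t))"
proof -
  have c: "continuous_on UNIV F" "continuous_on UNIV (pderiv1 F)"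
    using assms by (auto intro!: smooth_continuous smooth_frechet_derivative simp: Basis_plane)
  have "integral (cbox (0,0) (1,1)) (pderiv1 F)
      = integral (cbox 0 1) (\<lambda>x. integral (cbox 0 1) (\<lambda>y. pderiv1 F (x, y)))"
    by (rule integral_prod_continuous) (use c in \<open>auto intro: continuous_on_subset\<close>)
  also have "\<dots> = integral (cbox 0 1) (\<lambda>y. integral (cbox 0 1) (\<lambda>x. pderiv1 F (x, y)))"
    by (rule integral_swap_continuous) (use c in \<open>auto intro: continuous_on_subset\<close>)
  also have "\<dots> = integral (cbox 0 1) (\<lambda>y. F (1, y) - F (0, y))"
  proof (rule integral_cong)
    fix y :: real
    have "((\<lambda>x. pderiv1 F (x, y)) has_integral F (1, y) - F (0, y)) {0..1}"
      by (rule fundamental_theorem_of_calculus)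
        (auto intro: has_vector_derivative_at_within smooth_vector_derivative_slice assms)
    then show "integral (cbox 0 1) (\<lambda>x. pderiv1 F (x, y)) = F (1, y) - F (0, y)"
      by (simp add: integral_unique)
  qed
  finally show ?thesis
    using LINT_W0_continuous[OF c(2)] LINT_interval_continuous[of "\<lambda>t. F (1, t) - F (0, t)"]
      continuous_slice[OF c(1)] by (simp add: continuous_on_diff)
qed

lemma Green2:
  assumes "smooth F"
  shows "(LINT x|lebesgue_on W0. pderiv2 F x) = (LINT t|lebesgue_on {0<..<1}. F (t, 1) - F (t, 0))"
proof -
  have c: "continuous_on UNIV F" "continuous_on UNIV (pderiv2 F)"
    using assms by (auto intro!: smooth_continuous smooth_frechet_derivative simp: Basis_plane)
  have "integral (cbox (0,0) (1,1)) (pderiv2 F)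
      = integral (cbox 0 1) (\<lambda>x. integral (cbox 0 1) (\<lambda>y. pderiv2 F (x, y)))"
    by (rule integral_prod_continuous) (use c in \<open>auto intro: continuous_on_subset\<close>)
  also have "\<dots> = integral (cbox 0 1) (\<lambda>x. F (x, 1) - F (x, 0))"
  proof (rule integral_cong)
    fix x :: real
    have "((\<lambda>y. pderiv2 F (x, y)) has_integral F (x, 1) - F (x, 0)) {0..1}"
      by (rule fundamental_theorem_of_calculus)
        (auto intro: has_vector_derivative_at_within smooth_vector_derivative_slice assms)
    then show "integral (cbox 0 1) (\<lambda>y. pderiv2 F (x, y)) = F (x, 1) - F (x, 0)"
      by (simp add: integral_unique)
  qed
  finally show ?thesis
    using LINT_W0_continuous[OF c(2)] LINT_interval_continuous[of "\<lambda>t. F (t, 1) - F (t, 0)"]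
      continuous_slice[OF c(1)] by (simp add: continuous_on_diff)
qed

text \<open>Green's formula for f \<phi>, whose boundary values vanish because the support of \<phi>
  lies in the open square.\<close>

lemma smooth_has_weak_deriv:
  assumes "smooth f" "e \<in> Basis"
  shows "has_weak_deriv W0 e f (\<lambda>x. frechet_derivative f (at x) e)"
  unfolding has_weak_deriv_def
proof (intro allI impI)
  let ?d = "\<lambda>f x. frechet_derivative f (at x) e"
  fix \<phi> assume \<phi>: "test_function W0 \<phi>"
  then have s: "smooth \<phi>" by (simp add: test_function_def)
  have out: "\<phi> x = 0" if "x \<notin> W0" for x
    using \<phi> that nonzero_subset_closure[of \<phi> x] by (auto simp: test_function_def)
  have "(LINT x|lebesgue_on W0. ?d (\<lambda>x. f x * \<phi> x) x) = 0"
    using assms(2) Green1[OF smooth_mult[OF assms(1) s]] Green2[OF smooth_mult[OF assms(1) s]]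
    by (auto simp: Basis_plane out W0_def)
  moreover have "?d (\<lambda>x. f x * \<phi> x) x = f x * ?d \<phi> x + ?d f x * \<phi> x" for x
    by (rule frechet_derivative_mult_at) (use assms s smooth_differentiable in auto)
  ultimately have "(LINT x|lebesgue_on W0. f x * ?d \<phi> x + ?d f x * \<phi> x) = 0"
    by simp
  moreover have "(LINT x|lebesgue_on W0. f x * ?d \<phi> x + ?d f x * \<phi> x)
      = (LINT x|lebesgue_on W0. f x * ?d \<phi> x) + (LINT x|lebesgue_on W0. ?d f x * \<phi> x)"
    using assms s
    by (intro Bochner_Integration.integral_add L2_mult_integrable smooth_L2_W0 smooth_frechet_derivative)
  ultimately show "(LINT x|lebesgue_on W0. f x * ?d \<phi> x) = - (LINT x|lebesgue_on W0. ?d f x * \<phi> x)"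
    by (simp add: eq_neg_iff_add_eq_0)
qed

lemma smooth_H1: "smooth f \<Longrightarrow> f \<in> H1 W0"
  by (rule H1_I[where a="\<lambda>e x. frechet_derivative f (at x) e"])
    (auto intro: smooth_L2_W0 smooth_frechet_derivative smooth_has_weak_deriv)

lemma weak_deriv_smooth_AE:
  "smooth f \<Longrightarrow> e \<in> Basis \<Longrightarrow> AE x in lebesgue_on W0. weak_deriv W0 e f x = frechet_derivative f (at x) e"
  by (intro weak_deriv_AE smooth_L2_W0 smooth_frechet_derivative smooth_has_weak_deriv)

section \<open>Boundary values, integration by parts, closedness of quasi-periodicity\<close>

section \<open>Traces\<close>

text \<open>Packages a Green formula with its pair of sides, so that integration by parts is proved
  once for both directions. The vector \<open>e\<close> points from \<open>\<gamma>0\<close> to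
  \<open>\<gamma>1\<close>, and \<open>e \<bullet> x\<close> is the coordinate between them.\<close>

definition opposite_sides :: "(real \<Rightarrow> real \<times> real) \<Rightarrow> (real \<Rightarrow> real \<times> real) \<Rightarrow> real \<times> real \<Rightarrow> bool" where
  "opposite_sides \<gamma>0 \<gamma>1 e \<longleftrightarrow> e \<in> Basis \<and> continuous_on UNIV \<gamma>0 \<and> continuous_on UNIV \<gamma>1 \<and>
     (\<forall>t. e \<bullet> \<gamma>0 t = 0 \<and> e \<bullet> \<gamma>1 t = 1) \<and>
     (\<forall>F. smooth F \<longrightarrow> (LINT x|lebesgue_on W0. frechet_derivative F (at x) e)
        = (LINT t|lebesgue_on {0<..<1}. F (\<gamma>1 t) - F (\<gamma>0 t)))"

lemma opposite_sides_W0: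
  "opposite_sides (\<lambda>t. (0, t)) (\<lambda>t. (1, t)) (1, 0)"
  "opposite_sides (\<lambda>t. (t, 0)) (\<lambda>t. (t, 1)) (0, 1)"
  by (auto simp: opposite_sides_def Basis_plane Green1 Green2 intro!: continuous_intros)

lemma smooth_curve_L2:
  fixes \<gamma> :: "real \<Rightarrow> real \<times> real"
  assumes "smooth U" "continuous_on UNIV \<gamma>" shows "(\<lambda>t. U (\<gamma> t)) \<in> L2 {0<..<1}"
  by (rule continuous_L2_interval, rule continuous_on_compose2[OF smooth_continuous[OF assms(1), of UNIV] assms(2)]) simp

lemma has_trace_L2: "has_trace \<gamma> u h \<Longrightarrow> h \<in> L2 {0<..<1}"
  by (simp add: has_trace_def)

lemma has_trace_obtain:
  assumes "has_trace \<gamma> u h"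
  obtains U where "\<And>j. smooth (U j)" "(\<lambda>j. H1_norm W0 (\<lambda>x. U j x - u x)) \<longlonglongrightarrow> 0"
    "(\<lambda>j. L2_norm {0<..<1} (\<lambda>t. U j (\<gamma> t) - h t)) \<longlonglongrightarrow> 0"
  using assms unfolding has_trace_def by auto

lemma has_trace_I:
  assumes "h \<in> L2 {0<..<1}" "\<And>j. smooth (U j)" "(\<lambda>j. H1_norm W0 (\<lambda>x. U j x - u x)) \<longlonglongrightarrow> 0"
    "(\<lambda>j. L2_norm {0<..<1} (\<lambda>t. U j (\<gamma> t) - h t)) \<longlonglongrightarrow> 0"
  shows "has_trace \<gamma> u h"
  using assms unfolding has_trace_def by auto

lemma has_trace_smooth:
  assumes "smooth U" "continuous_on UNIV \<gamma>" shows "has_trace \<gamma> U (\<lambda>t. U (\<gamma> t))"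
  by (rule has_trace_I[where U="\<lambda>_. U"]) (use assms in \<open>auto intro: smooth_curve_L2\<close>)

lemma has_trace_add:
  assumes "has_trace \<gamma> u h" "has_trace \<gamma> v k" "u \<in> H1 W0" "v \<in> H1 W0" "continuous_on UNIV \<gamma>"
  shows "has_trace \<gamma> (\<lambda>x. u x + v x) (\<lambda>t. h t + k t)"
proof -
  obtain U where U: "\<And>j. smooth (U j)" "(\<lambda>j. H1_norm W0 (\<lambda>x. U j x - u x)) \<longlonglongrightarrow> 0"
    "(\<lambda>j. L2_norm {0<..<1} (\<lambda>t. U j (\<gamma> t) - h t)) \<longlonglongrightarrow> 0" by (rule has_trace_obtain[OF assms(1)], rule that)
  obtain X where X: "\<And>j. smooth (X j)" "(\<lambda>j. H1_norm W0 (\<lambda>x. X j x - v x)) \<longlonglongrightarrow> 0"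
    "(\<lambda>j. L2_norm {0<..<1} (\<lambda>t. X j (\<gamma> t) - k t)) \<longlonglongrightarrow> 0" by (rule has_trace_obtain[OF assms(2)], rule that)
  note hk = has_trace_L2[OF assms(1)] has_trace_L2[OF assms(2)]
  show ?thesis
  proof (rule has_trace_I[where U="\<lambda>j x. U j x + X j x"])
    show "(\<lambda>t. h t + k t) \<in> L2 {0<..<1}" by (intro L2_add hk)
    show "smooth (\<lambda>x. U j x + X j x)" for j by (intro smooth_add U X)
    have "H1_norm W0 (\<lambda>x. U j x + X j x - (u x + v x)) \<le> H1_norm W0 (\<lambda>x. U j x - u x) + H1_norm W0 (\<lambda>x. X j x - v x)" for j
      using H1_norm_triangle[OF H1_diff[OF smooth_H1[OF U(1)] assms(3)] H1_diff[OF smooth_H1[OF X(1)] assms(4)], of j j]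
      by (simp add: algebra_simps)
    then show "(\<lambda>j. H1_norm W0 (\<lambda>x. U j x + X j x - (u x + v x))) \<longlonglongrightarrow> 0"
      by (intro tendsto_sandwich[OF _ _ tendsto_const tendsto_add_zero[OF U(2) X(2)]]) auto
    have "L2_norm {0<..<1} (\<lambda>t. U j (\<gamma> t) + X j (\<gamma> t) - (h t + k t))
        \<le> L2_norm {0<..<1} (\<lambda>t. U j (\<gamma> t) - h t) + L2_norm {0<..<1} (\<lambda>t. X j (\<gamma> t) - k t)" for j
      using L2_norm_triangle[OF L2_diff[OF smooth_curve_L2[OF U(1) assms(5)] hk(1)] L2_diff[OF smooth_curve_L2[OF X(1) assms(5)] hk(2)], of j j]
      by (simp add: algebra_simps)
    then show "(\<lambda>j. L2_norm {0<..<1} (\<lambda>t. U j (\<gamma> t) + X j (\<gamma> t) - (h t + k t))) \<longlonglongrightarrow> 0"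
      by (intro tendsto_sandwich[OF _ _ tendsto_const tendsto_add_zero[OF U(3) X(3)]]) auto
  qed
qed

lemma has_trace_mult:
  assumes "has_trace \<gamma> u h" "u \<in> H1 W0" "smooth \<psi>" "continuous_on UNIV \<gamma>"
  shows "has_trace \<gamma> (\<lambda>x. \<psi> x * u x) (\<lambda>t. \<psi> (\<gamma> t) * h t)"
proof -
  obtain U where U: "\<And>j. smooth (U j)" "(\<lambda>j. H1_norm W0 (\<lambda>x. U j x - u x)) \<longlonglongrightarrow> 0"
    "(\<lambda>j. L2_norm {0<..<1} (\<lambda>t. U j (\<gamma> t) - h t)) \<longlonglongrightarrow> 0" by (rule has_trace_obtain[OF assms(1)], rule that)
  note h = has_trace_L2[OF assms(1)]
  obtain K where K: "K \<ge> 0" "\<And>u. u \<in> H1 W0 \<Longrightarrow> H1_norm W0 (\<lambda>x. \<psi> x * u x) \<le> K * H1_norm W0 u"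
    using H1_norm_mult_bound[OF assms(3)] by metis
  have c: "continuous_on UNIV (\<lambda>t. \<psi> (\<gamma> t))"
    by (rule continuous_on_compose2[OF smooth_continuous[OF assms(3), of UNIV] assms(4)]) simp
  have "compact ((\<lambda>t. \<psi> (\<gamma> t)) ` {0..1})"
    using c by (intro compact_continuous_image compact_Icc) (auto intro: continuous_on_subset)
  then obtain L where L0: "\<forall>y\<in>(\<lambda>t. \<psi> (\<gamma> t)) ` {0..1}. cmod y \<le> L"
    using compact_imp_bounded bounded_iff by metis
  have L: "cmod (\<psi> (\<gamma> t)) \<le> max L 0" if "t \<in> {0<..<1}" for t
    using bspec[OF L0, of "\<psi> (\<gamma> t)"] that by (simp add: le_max_iff_disj)
  have cm: "(\<lambda>t. \<psi> (\<gamma> t)) \<in> borel_measurable (lebesgue_on {0<..<1})"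
    using c by (intro continuous_imp_measurable_on_sets_lebesgue) (auto intro: continuous_on_subset)
  have ae: "AE t in lebesgue_on {0<..<1}. cmod (\<psi> (\<gamma> t)) \<le> max L 0"
    by (rule AE_I2) (simp only: space_lebesgue_on L)
  have b: "(\<lambda>t. \<psi> (\<gamma> t) * f t) \<in> L2 {0<..<1}"
    "L2_norm {0<..<1} (\<lambda>t. \<psi> (\<gamma> t) * f t) \<le> max L 0 * L2_norm {0<..<1} f" if f: "f \<in> L2 {0<..<1}" for f
    by (rule L2_bounded_mult[OF f cm _ ae], simp)+
  show ?thesis
  proof (rule has_trace_I[where U="\<lambda>j x. \<psi> x * U j x"])
    show "(\<lambda>t. \<psi> (\<gamma> t) * h t) \<in> L2 {0<..<1}" by (rule b[OF h])
    show "smooth (\<lambda>x. \<psi> x * U j x)" for j by (intro smooth_mult U assms)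
    have "H1_norm W0 (\<lambda>x. \<psi> x * U j x - \<psi> x * u x) \<le> K * H1_norm W0 (\<lambda>x. U j x - u x)" for j
      using K(2)[OF H1_diff[OF smooth_H1[OF U(1)] assms(2)], of j] by (simp add: right_diff_distrib)
    then show "(\<lambda>j. H1_norm W0 (\<lambda>x. \<psi> x * U j x - \<psi> x * u x)) \<longlonglongrightarrow> 0"
      by (intro tendsto_sandwich[OF _ _ tendsto_const tendsto_mult_right_zero[OF U(2), of K]]) auto
    have "L2_norm {0<..<1} (\<lambda>t. \<psi> (\<gamma> t) * U j (\<gamma> t) - \<psi> (\<gamma> t) * h t) \<le> max L 0 * L2_norm {0<..<1} (\<lambda>t. U j (\<gamma> t) - h t)" for j
      using b(2)[OF L2_diff[OF smooth_curve_L2[OF U(1) assms(4)] h], of j] by (simp add: right_diff_distrib)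
    then show "(\<lambda>j. L2_norm {0<..<1} (\<lambda>t. \<psi> (\<gamma> t) * U j (\<gamma> t) - \<psi> (\<gamma> t) * h t)) \<longlonglongrightarrow> 0"
      by (intro tendsto_sandwich[OF _ _ tendsto_const tendsto_mult_right_zero[OF U(3), of "max L 0"]]) auto
  qed
qed

lemma has_trace_cmult:
  assumes "has_trace \<gamma> u h" "u \<in> H1 W0" "continuous_on UNIV \<gamma>"
  shows "has_trace \<gamma> (\<lambda>x. c * u x) (\<lambda>t. c * h t)"
  by (rule has_trace_mult[OF assms(1,2) smooth_const assms(3)])

text \<open>A diagonal argument: for each \<open>u n\<close> one smooth function is picked that is
  within 1 / (n + 1) both in H1 and on the boundary.\<close>

lemma has_trace_closed:
  assumes tr: "\<And>n. has_trace \<gamma> (u n) (h n)" and u: "\<And>n. u n \<in> H1 W0" and v: "v \<in> H1 W0"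
    and k: "k \<in> L2 {0<..<1}" and \<gamma>: "continuous_on UNIV \<gamma>"
    and lim: "(\<lambda>n. H1_norm W0 (\<lambda>x. u n x - v x)) \<longlonglongrightarrow> 0" "(\<lambda>n. L2_norm {0<..<1} (\<lambda>t. h n t - k t)) \<longlonglongrightarrow> 0"
  shows "has_trace \<gamma> v k"
proof -
  have "\<forall>n. \<exists>X. smooth X \<and> H1_norm W0 (\<lambda>x. X x - u n x) < 1 / (real n + 1) \<and>
      L2_norm {0<..<1} (\<lambda>t. X (\<gamma> t) - h n t) < 1 / (real n + 1)"
  proof
    fix n
    obtain U where U: "\<And>j. smooth (U j)" "(\<lambda>j. H1_norm W0 (\<lambda>x. U j x - u n x)) \<longlonglongrightarrow> 0"
      "(\<lambda>j. L2_norm {0<..<1} (\<lambda>t. U j (\<gamma> t) - h n t)) \<longlonglongrightarrow> 0" by (rule has_trace_obtain[OF tr], rule that)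
    have "0 < 1 / (real n + 1)" by simp
    from eventually_conj[OF order_tendstoD(2)[OF U(2) this] order_tendstoD(2)[OF U(3) this]]
    obtain j where "H1_norm W0 (\<lambda>x. U j x - u n x) < 1 / (real n + 1)" "L2_norm {0<..<1} (\<lambda>t. U j (\<gamma> t) - h n t) < 1 / (real n + 1)"
      by (auto simp: eventually_sequentially)
    then show "\<exists>X. smooth X \<and> H1_norm W0 (\<lambda>x. X x - u n x) < 1 / (real n + 1) \<and>
      L2_norm {0<..<1} (\<lambda>t. X (\<gamma> t) - h n t) < 1 / (real n + 1)"
      using U(1)[of j] by (intro exI[of _ "U j"]) simp
  qed
  from choice[OF this] obtain X where X: "\<And>n. smooth (X n)" "\<And>n. H1_norm W0 (\<lambda>x. X n x - u n x) < 1 / (real n + 1)"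
      "\<And>n. L2_norm {0<..<1} (\<lambda>t. X n (\<gamma> t) - h n t) < 1 / (real n + 1)"
    by auto
  have z: "(\<lambda>n. 1 / (real n + 1)) \<longlonglongrightarrow> 0"
    using LIMSEQ_inverse_real_of_nat by (simp add: inverse_eq_divide add.commute)
  show ?thesis
  proof (rule has_trace_I[where U=X, OF k X(1)])
    have "H1_norm W0 (\<lambda>x. X n x - v x) \<le> 1 / (real n + 1) + H1_norm W0 (\<lambda>x. u n x - v x)" for n
      using H1_norm_triangle_via[OF smooth_H1[OF X(1)[of n]] u[of n] v] X(2)[of n] by linarith
    then show "(\<lambda>n. H1_norm W0 (\<lambda>x. X n x - v x)) \<longlonglongrightarrow> 0"
      by (intro tendsto_sandwich[OF _ _ tendsto_const tendsto_add_zero[OF z lim(1)]]) auto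
    have "L2_norm {0<..<1} (\<lambda>t. X n (\<gamma> t) - k t) \<le> 1 / (real n + 1) + L2_norm {0<..<1} (\<lambda>t. h n t - k t)" for n
      using L2_norm_triangle_via[OF smooth_curve_L2[OF X(1)[of n] \<gamma>] has_trace_L2[OF tr[of n]] k] X(3)[of n] by linarith
    then show "(\<lambda>n. L2_norm {0<..<1} (\<lambda>t. X n (\<gamma> t) - k t)) \<longlonglongrightarrow> 0"
      by (intro tendsto_sandwich[OF _ _ tendsto_const tendsto_add_zero[OF z lim(2)]]) auto
  qed
qed

subsection \<open>Integration by parts\<close>

lemma frechet_derivative_mult_smooth:
  "smooth f \<Longrightarrow> smooth g \<Longrightarrow>
    frechet_derivative (\<lambda>x. f x * g x) (at x) e = f x * frechet_derivative g (at x) e + frechet_derivative f (at x) e * g x"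
  by (intro frechet_derivative_mult_at smooth_differentiable)

text \<open>The weight \<Psi> is meant to vanish on the opposite side, so that Green's formula for U
  \<Psi> has a single boundary term, with sign \<open>s\<close>. All terms are then continuous along
  the sequence that defines this one trace.\<close>

lemma has_trace_pairing:
  assumes tr: "has_trace \<gamma> u h" and u: "u \<in> H1 W0" and e: "e \<in> Basis" and \<gamma>: "continuous_on UNIV \<gamma>" and \<Psi>: "smooth \<Psi>"
    and Green: "\<And>U. smooth U \<Longrightarrow> (LINT x|lebesgue_on W0. frechet_derivative (\<lambda>x. U x * \<Psi> x) (at x) e)
        = s * (LINT t|lebesgue_on {0<..<1}. U (\<gamma> t) * \<Psi> (\<gamma> t))"
  shows "(LINT x|lebesgue_on W0. weak_deriv W0 e u x * \<Psi> x) + (LINT x|lebesgue_on W0. u x * frechet_derivative \<Psi> (at x) e)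
    = s * (LINT t|lebesgue_on {0<..<1}. h t * \<Psi> (\<gamma> t))"
proof -
  obtain U where U: "\<And>j. smooth (U j)" "(\<lambda>j. H1_norm W0 (\<lambda>x. U j x - u x)) \<longlonglongrightarrow> 0"
    "(\<lambda>j. L2_norm {0<..<1} (\<lambda>t. U j (\<gamma> t) - h t)) \<longlonglongrightarrow> 0" by (rule has_trace_obtain[OF tr], rule that)
  note UH = smooth_H1[OF U(1)]
  have L: "\<Psi> \<in> L2 W0" "(\<lambda>x. frechet_derivative \<Psi> (at x) e) \<in> L2 W0"
    by (intro smooth_L2_W0 smooth_frechet_derivative \<Psi> e)+
  have eq: "(LINT x|lebesgue_on W0. weak_deriv W0 e (U j) x * \<Psi> x) + (LINT x|lebesgue_on W0. U j x * frechet_derivative \<Psi> (at x) e)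
      = s * (LINT t|lebesgue_on {0<..<1}. U j (\<gamma> t) * \<Psi> (\<gamma> t))" for j
  proof -
    have "(LINT x|lebesgue_on W0. weak_deriv W0 e (U j) x * \<Psi> x) + (LINT x|lebesgue_on W0. U j x * frechet_derivative \<Psi> (at x) e)
      = (LINT x|lebesgue_on W0. weak_deriv W0 e (U j) x * \<Psi> x + U j x * frechet_derivative \<Psi> (at x) e)"
      by (intro Bochner_Integration.integral_add[symmetric] L2_mult_integrable L H1_L2 H1_weak_deriv_L2 UH e)
    also have "\<dots> = (LINT x|lebesgue_on W0. frechet_derivative (\<lambda>x. U j x * \<Psi> x) (at x) e)"
    proof (rule integral_cong_AE)
      show "AE x in lebesgue_on W0. weak_deriv W0 e (U j) x * \<Psi> x + U j x * frechet_derivative \<Psi> (at x) e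
          = frechet_derivative (\<lambda>x. U j x * \<Psi> x) (at x) e"
        using weak_deriv_smooth_AE[OF U(1)[of j] e]
        by eventually_elim (simp add: frechet_derivative_mult_smooth[OF U(1) \<Psi>])
      show "(\<lambda>x. weak_deriv W0 e (U j) x * \<Psi> x + U j x * frechet_derivative \<Psi> (at x) e) \<in> borel_measurable (lebesgue_on W0)"
        by (intro borel_measurable_add borel_measurable_times L2_measurable L H1_L2 H1_weak_deriv_L2 UH e)
      show "(\<lambda>x. frechet_derivative (\<lambda>x. U j x * \<Psi> x) (at x) e) \<in> borel_measurable (lebesgue_on W0)"
        by (intro L2_measurable smooth_L2_W0 smooth_frechet_derivative smooth_mult U \<Psi> e)
    qed
    also have "\<dots> = s * (LINT t|lebesgue_on {0<..<1}. U j (\<gamma> t) * \<Psi> (\<gamma> t))"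
      by (rule Green[OF U(1)])
    finally show ?thesis .
  qed
  have "(\<lambda>j. (LINT x|lebesgue_on W0. weak_deriv W0 e (U j) x * \<Psi> x) + (LINT x|lebesgue_on W0. U j x * frechet_derivative \<Psi> (at x) e))
      \<longlonglongrightarrow> (LINT x|lebesgue_on W0. weak_deriv W0 e u x * \<Psi> x) + (LINT x|lebesgue_on W0. u x * frechet_derivative \<Psi> (at x) e)"
    by (intro tendsto_add L2_pairing_tendsto L H1_L2 H1_weak_deriv_L2 UH u e H1_tendsto_L2[OF UH u U(2)])
  moreover have "(\<lambda>j. s * (LINT t|lebesgue_on {0<..<1}. U j (\<gamma> t) * \<Psi> (\<gamma> t))) \<longlonglongrightarrow> s * (LINT t|lebesgue_on {0<..<1}. h t * \<Psi> (\<gamma> t))"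
    by (intro tendsto_mult tendsto_const L2_pairing_tendsto smooth_curve_L2 U \<Psi> \<gamma> has_trace_L2[OF tr])
  ultimately show ?thesis unfolding eq by (rule LIMSEQ_unique)
qed

text \<open>The two traces come with unrelated approximating sequences. The weights \<open>e \<bullet> x\<close> and \<open>1 - e \<bullet> x\<close>
  localise to one side at a time.\<close>

lemma integration_by_parts:
  assumes sides: "opposite_sides \<gamma>0 \<gamma>1 e" and u: "u \<in> H1 W0"
    and tr: "has_trace \<gamma>0 u h0" "has_trace \<gamma>1 u h1" and \<psi>: "smooth \<psi>"
  shows "(LINT x|lebesgue_on W0. weak_deriv W0 e u x * \<psi> x) + (LINT x|lebesgue_on W0. u x * frechet_derivative \<psi> (at x) e)
    = (LINT t|lebesgue_on {0<..<1}. h1 t * \<psi> (\<gamma>1 t)) - (LINT t|lebesgue_on {0<..<1}. h0 t * \<psi> (\<gamma>0 t))"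
proof -
  note s = sides[unfolded opposite_sides_def]
  have e: "e \<in> Basis" and \<gamma>: "continuous_on UNIV \<gamma>0" "continuous_on UNIV \<gamma>1"
    and e\<gamma>: "\<And>t. e \<bullet> \<gamma>0 t = 0" "\<And>t. e \<bullet> \<gamma>1 t = 1" using s by auto
  have Green: "(LINT x|lebesgue_on W0. frechet_derivative F (at x) e) = (LINT t|lebesgue_on {0<..<1}. F (\<gamma>1 t) - F (\<gamma>0 t))"
    if "smooth F" for F using s that by blast
  define \<omega>1 where "\<omega>1 x = complex_of_real (e \<bullet> x + 0)" for x
  define \<omega>0 where "\<omega>0 x = complex_of_real (- e \<bullet> x + 1)" for x
  have \<omega>: "smooth \<omega>1" "smooth \<omega>0"
    unfolding \<omega>1_def[abs_def] \<omega>0_def[abs_def] by (rule smooth_affine)+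
  have ee: "e \<bullet> e = 1" using e by (simp add: inner_Basis)
  have d\<omega>: "frechet_derivative \<omega>1 (at x) e = 1" "frechet_derivative \<omega>0 (at x) e = -1" for x
    unfolding \<omega>1_def[abs_def] \<omega>0_def[abs_def] frechet_derivative_affine by (simp_all add: ee)
  have \<omega>\<gamma>: "\<omega>1 (\<gamma>1 t) = 1" "\<omega>1 (\<gamma>0 t) = 0" "\<omega>0 (\<gamma>1 t) = 0" "\<omega>0 (\<gamma>0 t) = 1" for t
    unfolding \<omega>1_def \<omega>0_def by (simp_all add: e\<gamma>)
  have sum1: "\<omega>1 x * y + \<omega>0 x * y = y" for x y
    unfolding \<omega>1_def \<omega>0_def by (simp add: algebra_simps)
  have \<Psi>: "smooth (\<lambda>x. \<omega>1 x * \<psi> x)" "smooth (\<lambda>x. \<omega>0 x * \<psi> x)" by (intro smooth_mult \<omega> \<psi>)+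
  have 1: "(LINT x|lebesgue_on W0. weak_deriv W0 e u x * (\<omega>1 x * \<psi> x)) + (LINT x|lebesgue_on W0. u x * frechet_derivative (\<lambda>x. \<omega>1 x * \<psi> x) (at x) e)
    = 1 * (LINT t|lebesgue_on {0<..<1}. h1 t * (\<omega>1 (\<gamma>1 t) * \<psi> (\<gamma>1 t)))"
  proof (rule has_trace_pairing[OF tr(2) u e \<gamma>(2) \<Psi>(1)])
    fix U :: "real \<times> real \<Rightarrow> complex" assume U: "smooth U"
    show "(LINT x|lebesgue_on W0. frechet_derivative (\<lambda>x. U x * (\<omega>1 x * \<psi> x)) (at x) e)
        = 1 * (LINT t|lebesgue_on {0<..<1}. U (\<gamma>1 t) * (\<omega>1 (\<gamma>1 t) * \<psi> (\<gamma>1 t)))"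
      by (subst Green[OF smooth_mult[OF U \<Psi>(1)]]) (simp add: \<omega>\<gamma>)
  qed
  have 0: "(LINT x|lebesgue_on W0. weak_deriv W0 e u x * (\<omega>0 x * \<psi> x)) + (LINT x|lebesgue_on W0. u x * frechet_derivative (\<lambda>x. \<omega>0 x * \<psi> x) (at x) e)
    = - 1 * (LINT t|lebesgue_on {0<..<1}. h0 t * (\<omega>0 (\<gamma>0 t) * \<psi> (\<gamma>0 t)))"
  proof (rule has_trace_pairing[OF tr(1) u e \<gamma>(1) \<Psi>(2)])
    fix U :: "real \<times> real \<Rightarrow> complex" assume U: "smooth U"
    show "(LINT x|lebesgue_on W0. frechet_derivative (\<lambda>x. U x * (\<omega>0 x * \<psi> x)) (at x) e)
        = - 1 * (LINT t|lebesgue_on {0<..<1}. U (\<gamma>0 t) * (\<omega>0 (\<gamma>0 t) * \<psi> (\<gamma>0 t)))"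
      by (subst Green[OF smooth_mult[OF U \<Psi>(2)]]) (simp add: \<omega>\<gamma>)
  qed
  have L: "(\<lambda>x. \<omega>1 x * \<psi> x) \<in> L2 W0" "(\<lambda>x. \<omega>0 x * \<psi> x) \<in> L2 W0"
    "(\<lambda>x. frechet_derivative (\<lambda>x. \<omega>1 x * \<psi> x) (at x) e) \<in> L2 W0"
    "(\<lambda>x. frechet_derivative (\<lambda>x. \<omega>0 x * \<psi> x) (at x) e) \<in> L2 W0"
    by (intro smooth_L2_W0 smooth_frechet_derivative \<Psi> e)+
  \<comment> \<open>The derivatives 1 and -1 of the two weights cancel in the sum.\<close>
  have d: "frechet_derivative (\<lambda>x. \<omega>1 x * \<psi> x) (at x) e + frechet_derivative (\<lambda>x. \<omega>0 x * \<psi> x) (at x) e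
      = frechet_derivative \<psi> (at x) e" for x
    using sum1[of x "frechet_derivative \<psi> (at x) e"]
    by (simp add: frechet_derivative_mult_smooth \<omega> \<psi> d\<omega>)
  have "(LINT x|lebesgue_on W0. weak_deriv W0 e u x * (\<omega>1 x * \<psi> x)) + (LINT x|lebesgue_on W0. weak_deriv W0 e u x * (\<omega>0 x * \<psi> x))
      = (LINT x|lebesgue_on W0. weak_deriv W0 e u x * (\<omega>1 x * \<psi> x) + weak_deriv W0 e u x * (\<omega>0 x * \<psi> x))"
    by (intro Bochner_Integration.integral_add[symmetric] L2_mult_integrable H1_weak_deriv_L2 u e L)
  also have "\<dots> = (LINT x|lebesgue_on W0. weak_deriv W0 e u x * \<psi> x)"
    by (simp only: distrib_left[symmetric] sum1)
  finally have A: "(LINT x|lebesgue_on W0. weak_deriv W0 e u x * (\<omega>1 x * \<psi> x)) + (LINT x|lebesgue_on W0. weak_deriv W0 e u x * (\<omega>0 x * \<psi> x))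
      = (LINT x|lebesgue_on W0. weak_deriv W0 e u x * \<psi> x)" .
  have "(LINT x|lebesgue_on W0. u x * frechet_derivative (\<lambda>x. \<omega>1 x * \<psi> x) (at x) e) + (LINT x|lebesgue_on W0. u x * frechet_derivative (\<lambda>x. \<omega>0 x * \<psi> x) (at x) e)
      = (LINT x|lebesgue_on W0. u x * frechet_derivative (\<lambda>x. \<omega>1 x * \<psi> x) (at x) e + u x * frechet_derivative (\<lambda>x. \<omega>0 x * \<psi> x) (at x) e)"
    by (intro Bochner_Integration.integral_add[symmetric] L2_mult_integrable H1_L2 u e L)
  also have "\<dots> = (LINT x|lebesgue_on W0. u x * frechet_derivative \<psi> (at x) e)"
    by (simp only: distrib_left[symmetric] d)
  finally have B: "(LINT x|lebesgue_on W0. u x * frechet_derivative (\<lambda>x. \<omega>1 x * \<psi> x) (at x) e) + (LINT x|lebesgue_on W0. u x * frechet_derivative (\<lambda>x. \<omega>0 x * \<psi> x) (at x) e)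
      = (LINT x|lebesgue_on W0. u x * frechet_derivative \<psi> (at x) e)" .
  have "x + y = r1 - r0" if "x1 + y1 = 1 * r1" "x0 + y0 = - 1 * r0" "x1 + x0 = x" "y1 + y0 = y"
    for x y x0 x1 y0 y1 r0 r1 :: complex
  proof -
    have "x + y = (x1 + y1) + (x0 + y0)"
      unfolding that(3,4)[symmetric] by (simp add: algebra_simps)
    then show ?thesis unfolding that(1,2) by simp
  qed
  from this[OF 1 0 A B] show ?thesis by (simp add: \<omega>\<gamma>)
qed

text \<open>Green's formula for (1 - x1) |U|^2, which has no contribution from the right side. Each
  of the three resulting volume integrals is at most the squared H1 norm.\<close>

lemma trace_bound_smooth:
  assumes U: "smooth U"
  shows "L2_norm {0<..<1} (\<lambda>t. U (0, t)) \<le> 2 * H1_norm W0 U"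
proof -
  define \<omega> where "\<omega> x = complex_of_real ((-1, 0) \<bullet> x + 1)" for x :: "real \<times> real"
  have \<omega>: "smooth \<omega>" unfolding \<omega>_def[abs_def] by (rule smooth_affine)
  have d\<omega>: "pderiv1 \<omega> x = -1" for x
    unfolding \<omega>_def[abs_def] frechet_derivative_affine by simp
  have \<omega>b: "cmod (\<omega> x) \<le> 1" if "x \<in> W0" for x
    using that unfolding \<omega>_def norm_of_real by (auto simp: W0_def)
  have Uc: "smooth (\<lambda>x. cnj (U x))" by (rule smooth_cnj[OF U])
  define F where "F x = \<omega> x * (U x * cnj (U x))" for x
  have F: "smooth F" unfolding F_def[abs_def] by (intro smooth_mult \<omega> U Uc)
  let ?D = "pderiv1 U"
  have D: "?D \<in> L2 W0" by (intro smooth_L2_W0 smooth_frechet_derivative U) (simp add: Basis_plane)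
  have UL: "U \<in> L2 W0" by (rule smooth_L2_W0[OF U])
  have dF: "pderiv1 F x = \<omega> x * (U x * cnj (?D x) + ?D x * cnj (U x)) - U x * cnj (U x)" for x
    unfolding F_def[abs_def]
    by (subst frechet_derivative_mult_smooth[OF \<omega> smooth_mult[OF U Uc]])
      (simp add: d\<omega> frechet_derivative_mult_smooth[OF U Uc] frechet_derivative_cnj_at(2)[OF smooth_differentiable[OF U]])
  have \<omega>m: "\<omega> \<in> borel_measurable (lebesgue_on W0)"
    by (intro continuous_measurable_W0 smooth_continuous \<omega>)
  have \<omega>ae: "AE x in lebesgue_on W0. cmod (\<omega> x) \<le> 1"
    by (rule AE_I2) (simp only: space_lebesgue_on \<omega>b)
  have \<omega>L: "(\<lambda>x. \<omega> x * f x) \<in> L2 W0 \<and> L2_norm W0 (\<lambda>x. \<omega> x * f x) \<le> 1 * L2_norm W0 f" if "f \<in> L2 W0" for f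
    using L2_bounded_mult[OF that \<omega>m _ \<omega>ae] by simp
  let ?I1 = "LINT x|lebesgue_on W0. (\<omega> x * U x) * cnj (?D x)"
  let ?I2 = "LINT x|lebesgue_on W0. (\<omega> x * ?D x) * cnj (U x)"
  let ?I3 = "LINT x|lebesgue_on W0. U x * cnj (U x)"
  have i: "integrable (lebesgue_on W0) (\<lambda>x. (\<omega> x * U x) * cnj (?D x))" "integrable (lebesgue_on W0) (\<lambda>x. (\<omega> x * ?D x) * cnj (U x))"
      "integrable (lebesgue_on W0) (\<lambda>x. U x * cnj (U x))"
    using \<omega>L D UL by (auto intro!: L2_mult_integrable L2_cnj)
  have "(LINT t|lebesgue_on {0<..<1}. F (1, t) - F (0, t)) = (LINT x|lebesgue_on W0. pderiv1 F x)"
    by (rule Green1[OF F, symmetric])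
  also have "\<dots> = (LINT x|lebesgue_on W0. (\<omega> x * U x) * cnj (?D x) + (\<omega> x * ?D x) * cnj (U x) - U x * cnj (U x))"
    unfolding dF by (simp add: algebra_simps)
  also have "\<dots> = ?I1 + ?I2 - ?I3"
    using i by simp
  finally have eq: "(LINT t|lebesgue_on {0<..<1}. F (1, t) - F (0, t)) = ?I1 + ?I2 - ?I3" .
  have F1: "F (1, t) - F (0, t) = - complex_of_real ((cmod (U (0, t)))\<^sup>2)" for t
    unfolding F_def complex_norm_square by (simp add: \<omega>_def)
  have "complex_of_real ((L2_norm {0<..<1} (\<lambda>t. U (0, t)))\<^sup>2) = ?I3 - ?I1 - ?I2"
    using eq unfolding F1 L2_norm_square integral_minus integral_complex_of_real by (simp add: algebra_simps)
  then have "(L2_norm {0<..<1} (\<lambda>t. U (0, t)))\<^sup>2 = cmod (?I3 - ?I1 - ?I2)"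
    by (metis abs_of_nonneg norm_of_real zero_le_power2)
  also have "\<dots> \<le> cmod ?I3 + cmod ?I1 + cmod ?I2"
    using norm_triangle_ineq4[of "?I3 - ?I1" ?I2] norm_triangle_ineq4[of ?I3 ?I1] by linarith
  also have "\<dots> \<le> H1_norm W0 U * H1_norm W0 U + H1_norm W0 U * H1_norm W0 U + H1_norm W0 U * H1_norm W0 U"
  proof -
    have n: "L2_norm W0 U \<le> H1_norm W0 U" "L2_norm W0 ?D \<le> H1_norm W0 U"
    proof -
      show "L2_norm W0 U \<le> H1_norm W0 U" by (rule L2_norm_le_H1_norm)
      have "L2_norm W0 ?D = L2_norm W0 (weak_deriv W0 (1,0) U)"
        by (rule weak_deriv_norm[symmetric, OF D smooth_has_weak_deriv[OF U]]) (simp add: Basis_plane)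
      then show "L2_norm W0 ?D \<le> H1_norm W0 U"
        using L2_norm_weak_deriv_le_H1_norm[of "(1,0)" U] by (simp add: Basis_plane)
    qed
    have \<omega>1: "L2_norm W0 (\<lambda>x. \<omega> x * U x) \<le> H1_norm W0 U" "L2_norm W0 (\<lambda>x. \<omega> x * ?D x) \<le> H1_norm W0 U"
      using \<omega>L[OF UL] \<omega>L[OF D] n by auto
    have "cmod ?I3 \<le> H1_norm W0 U * H1_norm W0 U"
      by (rule order_trans[OF L2_Cauchy_Schwarz[OF UL L2_cnj[OF UL]]]) (auto intro!: mult_mono n simp: L2_norm_cnj)
    moreover have "cmod ?I1 \<le> H1_norm W0 U * H1_norm W0 U"
      by (rule order_trans[OF L2_Cauchy_Schwarz[OF conjunct1[OF \<omega>L[OF UL]] L2_cnj[OF D]]]) (auto intro!: mult_mono n \<omega>1 simp: L2_norm_cnj)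
    moreover have "cmod ?I2 \<le> H1_norm W0 U * H1_norm W0 U"
      by (rule order_trans[OF L2_Cauchy_Schwarz[OF conjunct1[OF \<omega>L[OF D]] L2_cnj[OF UL]]]) (auto intro!: mult_mono n \<omega>1 simp: L2_norm_cnj)
    ultimately show ?thesis by linarith
  qed
  \<comment> \<open>The factor 3 is rounded up to the square 4.\<close>
  also have "\<dots> \<le> (2 * H1_norm W0 U)\<^sup>2"
    by (simp add: power2_eq_square)
  finally show ?thesis by (rule power2_le_imp_le) simp
qed

text \<open>Extends the smooth case along the sequence defining the trace. Its use is to make traces
  of an H1-convergent sequence converge.\<close>

lemma trace_bound:
  assumes "has_trace (\<lambda>t. (0, t)) u h" "u \<in> H1 W0"
  shows "L2_norm {0<..<1} h \<le> 2 * H1_norm W0 u"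
proof -
  have \<gamma>: "continuous_on UNIV (\<lambda>t::real. (0::real, t))" by (intro continuous_intros)
  obtain U where U: "\<And>j. smooth (U j)" "(\<lambda>j. H1_norm W0 (\<lambda>x. U j x - u x)) \<longlonglongrightarrow> 0"
    "(\<lambda>j. L2_norm {0<..<1} (\<lambda>t. U j (0, t) - h t)) \<longlonglongrightarrow> 0" by (rule has_trace_obtain[OF assms(1)], rule that)
  have 1: "(\<lambda>j. L2_norm {0<..<1} (\<lambda>t. U j (0, t))) \<longlonglongrightarrow> L2_norm {0<..<1} h"
    by (rule L2_norm_tendsto[OF smooth_curve_L2[OF U(1) \<gamma>] has_trace_L2[OF assms(1)] U(3)])
  have 2: "(\<lambda>j. 2 * (H1_norm W0 u + H1_norm W0 (\<lambda>x. U j x - u x))) \<longlonglongrightarrow> 2 * (H1_norm W0 u + 0)"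
    by (intro tendsto_intros U(2))
  have "L2_norm {0<..<1} (\<lambda>t. U j (0, t)) \<le> 2 * (H1_norm W0 u + H1_norm W0 (\<lambda>x. U j x - u x))" for j
    by (rule order_trans[OF trace_bound_smooth[OF U(1)[of j]] mult_left_mono[OF H1_norm_triangle_sub[OF smooth_H1[OF U(1)[of j]] assms(2)]]]) simp
  with LIMSEQ_le[OF 1 2] show ?thesis by simp
qed

subsection \<open>Quasi-periodic functions\<close>

lemma sides_continuous:
  "continuous_on UNIV (\<lambda>t::real. (0::real, t))" "continuous_on UNIV (\<lambda>t::real. (1::real, t))"
  "continuous_on UNIV (\<lambda>t::real. (t, 0::real))" "continuous_on UNIV (\<lambda>t::real. (t, 1::real))"
  by (intro continuous_intros)+

lemma Vqp_H1: "u \<in> Vqp z \<Longrightarrow> u \<in> H1 W0"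
  by (simp add: Vqp_def V_def)

lemma Vqp_iff:
  "u \<in> Vqp z \<longleftrightarrow> u \<in> H1 W0 \<and> has_trace (\<lambda>t. (t, 0)) u (\<lambda>_. 0) \<and> has_trace (\<lambda>t. (t, 1)) u (\<lambda>_. 0) \<and>
    (\<exists>h. has_trace (\<lambda>t. (0, t)) u h \<and> has_trace (\<lambda>t. (1, t)) u (\<lambda>t. z * h t))"
  by (simp add: Vqp_def V_def)

lemma Vqp_add:
  assumes "u \<in> Vqp z" "v \<in> Vqp z" shows "(\<lambda>x. u x + v x) \<in> Vqp z"
proof -
  obtain h k where h: "has_trace (\<lambda>t. (0, t)) u h" "has_trace (\<lambda>t. (1, t)) u (\<lambda>t. z * h t)"
    and k: "has_trace (\<lambda>t. (0, t)) v k" "has_trace (\<lambda>t. (1, t)) v (\<lambda>t. z * k t)"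
    and u: "u \<in> H1 W0" "has_trace (\<lambda>t. (t, 0)) u (\<lambda>_. 0)" "has_trace (\<lambda>t. (t, 1)) u (\<lambda>_. 0)"
    and v: "v \<in> H1 W0" "has_trace (\<lambda>t. (t, 0)) v (\<lambda>_. 0)" "has_trace (\<lambda>t. (t, 1)) v (\<lambda>_. 0)"
    using assms unfolding Vqp_iff by auto
  show ?thesis
    unfolding Vqp_iff
    using H1_add[OF u(1) v(1)] has_trace_add[OF u(2) v(2) u(1) v(1) sides_continuous(3)]
      has_trace_add[OF u(3) v(3) u(1) v(1) sides_continuous(4)]
      has_trace_add[OF h(1) k(1) u(1) v(1) sides_continuous(1)]
      has_trace_add[OF h(2) k(2) u(1) v(1) sides_continuous(2)]
    by (auto intro!: exI[of _ "\<lambda>t. h t + k t"] simp: distrib_left)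
qed

text \<open>Intended for exponentials in x1: these carry one quasi-periodicity into another.\<close>

lemma Vqp_mult:
  assumes "u \<in> Vqp z" "smooth \<psi>" "\<And>t. \<psi> (1, t) = w * \<psi> (0, t)"
  shows "(\<lambda>x. \<psi> x * u x) \<in> Vqp (w * z)"
proof -
  obtain h where h: "has_trace (\<lambda>t. (0, t)) u h" "has_trace (\<lambda>t. (1, t)) u (\<lambda>t. z * h t)"
    and u: "u \<in> H1 W0" "has_trace (\<lambda>t. (t, 0)) u (\<lambda>_. 0)" "has_trace (\<lambda>t. (t, 1)) u (\<lambda>_. 0)"
    using assms unfolding Vqp_iff by auto
  show ?thesis
    unfolding Vqp_iff
    using H1_mult[OF assms(2) u(1)] has_trace_mult[OF u(2,1) assms(2) sides_continuous(3)]
      has_trace_mult[OF u(3,1) assms(2) sides_continuous(4)]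
      has_trace_mult[OF h(1) u(1) assms(2) sides_continuous(1)]
      has_trace_mult[OF h(2) u(1) assms(2) sides_continuous(2)]
    by (auto intro!: exI[of _ "\<lambda>t. \<psi> (0, t) * h t"] simp: assms(3) mult_ac)
qed

lemma Vqp_cmult: "u \<in> Vqp z \<Longrightarrow> (\<lambda>x. c * u x) \<in> Vqp z"
  using Vqp_mult[of u z "\<lambda>_. c" 1] by simp

lemma Vqp_diff: "u \<in> Vqp z \<Longrightarrow> v \<in> Vqp z \<Longrightarrow> (\<lambda>x. u x - v x) \<in> Vqp z"
  using Vqp_add[of u z "\<lambda>x. -1 * v x"] Vqp_cmult[of v z "-1"] by simp

lemma Vqp_smooth:
  assumes "smooth f" "\<And>t. f (t, 0) = 0" "\<And>t. f (t, 1) = 0" "\<And>t. f (1, t) = z * f (0, t)"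
  shows "f \<in> Vqp z"
  unfolding Vqp_iff
  using smooth_H1[OF assms(1)] has_trace_smooth[OF assms(1) sides_continuous(1)] has_trace_smooth[OF assms(1) sides_continuous(2)]
    has_trace_smooth[OF assms(1) sides_continuous(3)] has_trace_smooth[OF assms(1) sides_continuous(4)]
  by (auto simp: assms)

text \<open>The left trace of a member is only known to exist, so convergence of traces has to be
  proved. The trace bound makes the left traces a Cauchy sequence; their limit \<open>k\<close> is
  the left trace of \<open>v\<close>, and \<open>z * k\<close> is the right one.\<close>

lemma Vqp_closed:
  assumes u: "\<And>n. u n \<in> Vqp z" and v: "v \<in> H1 W0" and lim: "(\<lambda>n. H1_norm W0 (\<lambda>x. u n x - v x)) \<longlonglongrightarrow> 0"
  shows "v \<in> Vqp z"
proof -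
  have uH: "u n \<in> H1 W0" for n by (rule Vqp_H1[OF u])
  have "\<forall>n. \<exists>h. has_trace (\<lambda>t. (0, t)) (u n) h \<and> has_trace (\<lambda>t. (1, t)) (u n) (\<lambda>t. z * h t)"
    using u unfolding Vqp_iff by auto
  from choice[OF this] obtain h where h: "\<And>n. has_trace (\<lambda>t. (0, t)) (u n) (h n)"
      "\<And>n. has_trace (\<lambda>t. (1, t)) (u n) (\<lambda>t. z * h n t)" by auto
  note hL = has_trace_L2[OF h(1)]
  have hd: "L2_norm {0<..<1} (\<lambda>t. h m t - h n t) \<le> 2 * H1_norm W0 (\<lambda>x. u m x - u n x)" for m n
    using trace_bound[OF has_trace_add[OF h(1) has_trace_cmult[OF h(1) uH sides_continuous(1), where c="-1"] uH
        H1_cmult[OF uH] sides_continuous(1)] H1_add[OF uH H1_cmult[OF uH]], of m n]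
    by simp
  have "\<exists>N. \<forall>m\<ge>N. \<forall>n\<ge>N. L2_norm {0<..<1} (\<lambda>t. h m t - h n t) < e" if "e > 0" for e
  proof -
    from order_tendstoD(2)[OF lim, of "e/4"] \<open>e > 0\<close>
    obtain N where N: "\<And>n. n \<ge> N \<Longrightarrow> H1_norm W0 (\<lambda>x. u n x - v x) < e/4"
      by (auto simp: eventually_sequentially)
    have "L2_norm {0<..<1} (\<lambda>t. h m t - h n t) < e" if "m \<ge> N" "n \<ge> N" for m n
      using hd[of m n] H1_norm_triangle_via[OF uH[of m] v uH[of n]] H1_norm_minus_commute[OF uH[of n] v]
        N[OF that(1)] N[OF that(2)] by linarith
    then show ?thesis by auto
  qed
  from L2_complete[OF _ hL this] obtain k where k: "k \<in> L2 {0<..<1}" "(\<lambda>n. L2_norm {0<..<1} (\<lambda>t. h n t - k t)) \<longlonglongrightarrow> 0"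
    by auto
  have zk: "(\<lambda>n. L2_norm {0<..<1} (\<lambda>t. z * h n t - z * k t)) \<longlonglongrightarrow> 0"
    using tendsto_mult_right_zero[OF k(2), of "cmod z"] L2_norm_cmult[of "{0<..<1}" z "\<lambda>t. h _ t - k t"]
    by (simp add: right_diff_distrib)
  have "has_trace (\<lambda>t. (0, t)) v k"
    by (rule has_trace_closed[OF h(1) uH v k(1) sides_continuous(1) lim k(2)])
  moreover have "has_trace (\<lambda>t. (1, t)) v (\<lambda>t. z * k t)"
    by (rule has_trace_closed[OF h(2) uH v L2_cmult[OF k(1)] sides_continuous(2) lim zk])
  moreover have "has_trace (\<lambda>t. (t, 0)) v (\<lambda>_. 0)"
    by (rule has_trace_closed[where u=u and h="\<lambda>_ _. 0", OF _ uH v L2_zero sides_continuous(3) lim]) (use u in \<open>auto simp: Vqp_iff\<close>)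
  moreover have "has_trace (\<lambda>t. (t, 1)) v (\<lambda>_. 0)"
    by (rule has_trace_closed[where u=u and h="\<lambda>_ _. 0", OF _ uH v L2_zero sides_continuous(4) lim]) (use u in \<open>auto simp: Vqp_iff\<close>)
  ultimately show ?thesis using v unfolding Vqp_iff by auto
qed

text \<open>In the first direction the two boundary terms cancel by periodicity of \<open>u\<close>
  and \<psi>. In the second \<open>u\<close> has zero traces, so \<psi> may be a cosine that does
  not vanish on the boundary.\<close>

lemma Vqp_integration_by_parts:
  assumes u: "u \<in> Vqp 1" and \<psi>: "smooth \<psi>"
  shows "(\<And>t. \<psi> (1, t) = \<psi> (0, t)) \<Longrightarrow>
      (LINT x|lebesgue_on W0. weak_deriv W0 (1, 0) u x * \<psi> x) = - (LINT x|lebesgue_on W0. u x * pderiv1 \<psi> x)"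
    and "(LINT x|lebesgue_on W0. weak_deriv W0 (0, 1) u x * \<psi> x) = - (LINT x|lebesgue_on W0. u x * pderiv2 \<psi> x)"
proof -
  obtain h where h: "has_trace (\<lambda>t. (0, t)) u h" "has_trace (\<lambda>t. (1, t)) u (\<lambda>t. 1 * h t)"
    and uH: "u \<in> H1 W0" and 0: "has_trace (\<lambda>t. (t, 0)) u (\<lambda>_. 0)" "has_trace (\<lambda>t. (t, 1)) u (\<lambda>_. 0)"
    using u unfolding Vqp_iff by auto
  show "(LINT x|lebesgue_on W0. weak_deriv W0 (1, 0) u x * \<psi> x) = - (LINT x|lebesgue_on W0. u x * pderiv1 \<psi> x)"
    if "\<And>t. \<psi> (1, t) = \<psi> (0, t)"
    using integration_by_parts[OF opposite_sides_W0(1) uH h \<psi>] that by (simp add: eq_neg_iff_add_eq_0)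
  show "(LINT x|lebesgue_on W0. weak_deriv W0 (0, 1) u x * \<psi> x) = - (LINT x|lebesgue_on W0. u x * pderiv2 \<psi> x)"
    using integration_by_parts[OF opposite_sides_W0(2) uH 0 \<psi>] by (simp add: eq_neg_iff_add_eq_0)
qed

section \<open>Orthogonality and density of the waves\<close>

section \<open>Trigonometric functions in \<open>Vqp 1\<close>\<close>

definition trig_wave :: "complex \<Rightarrow> real \<times> real \<Rightarrow> real \<times> real \<Rightarrow> complex" where
  "trig_wave w v x = exp (w * of_real (v \<bullet> x))"

text \<open>The wave exp (2 pi i j x1) sin (pi l x2), written with exponentials so that smoothness
  and derivatives come from those of the exponential of a linear function.\<close>

definition trig_sin :: "int \<Rightarrow> nat \<Rightarrow> real \<times> real \<Rightarrow> complex" where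
  "trig_sin j l x = trig_wave (2 * pi * j * \<i>) (1, 0) x *
     ((1 / (2 * \<i>)) * (trig_wave (\<i> * (pi * l)) (0, 1) x - trig_wave (- (\<i> * (pi * l))) (0, 1) x))"

definition trig_cos :: "int \<Rightarrow> nat \<Rightarrow> real \<times> real \<Rightarrow> complex" where
  "trig_cos j l x = trig_wave (2 * pi * j * \<i>) (1, 0) x *
     ((1 / 2) * (trig_wave (\<i> * (pi * l)) (0, 1) x + trig_wave (- (\<i> * (pi * l))) (0, 1) x))"

lemma inner_unit: "(1, 0) \<bullet> x = fst x" "(0, 1) \<bullet> x = snd (x :: real \<times> real)"
  by (cases x; simp)+

lemma trig_sin_eq: "trig_sin j l x = exp (2 * pi * j * \<i> * complex_of_real (fst x)) * complex_of_real (sin (pi * l * snd x))"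
proof -
  have "complex_of_real (sin (pi * l * snd x)) = (1 / (2 * \<i>)) * (exp (\<i> * (pi * l) * snd x) - exp (- (\<i> * (pi * l)) * snd x))"
    unfolding sin_of_real[symmetric] sin_exp_eq' by (simp add: field_simps)
  then show ?thesis by (simp only: trig_sin_def trig_wave_def inner_unit)
qed

lemma trig_cos_eq: "trig_cos j l x = exp (2 * pi * j * \<i> * complex_of_real (fst x)) * complex_of_real (cos (pi * l * snd x))"
proof -
  have "complex_of_real (cos (pi * l * snd x)) = (1 / 2) * (exp (\<i> * (pi * l) * snd x) + exp (- (\<i> * (pi * l)) * snd x))"
    unfolding cos_of_real[symmetric] cos_exp_eq by (simp add: field_simps)
  then show ?thesis by (simp only: trig_cos_def trig_wave_def inner_unit)
qed

lemma smooth_trig_wave: "smooth (trig_wave w v)"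
  unfolding trig_wave_def[abs_def] by (rule smooth_exp_affine)

lemma smooth_trig: "smooth (trig_sin j l)" "smooth (trig_cos j l)"
  unfolding trig_sin_def[abs_def] trig_cos_def[abs_def]
  by (intro smooth_mult smooth_trig_wave smooth_diff smooth_add smooth_const)+

lemma trig_wave_has_derivative:
  "(trig_wave w v has_derivative (\<lambda>h. w * of_real (v \<bullet> h) * trig_wave w v x)) (at x)"
  using smooth_has_derivative[OF smooth_trig_wave[of w v], of x]
  unfolding trig_wave_def[abs_def] frechet_derivative_exp_affine[abs_def] .

lemma frechet_derivative_trig:
  "pderiv1 (trig_sin j l) x = 2 * pi * j * \<i> * trig_sin j l x"
  "pderiv2 (trig_sin j l) x = pi * l * trig_cos j l x"
  "pderiv2 (trig_cos j l) x = - (pi * l) * trig_sin j l x"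
proof -
  have s: "(trig_sin j l has_derivative (\<lambda>h. trig_wave (2 * pi * j * \<i>) (1, 0) x *
     ((1 / (2 * \<i>)) * ((\<i> * (pi * l)) * of_real ((0, 1) \<bullet> h) * trig_wave (\<i> * (pi * l)) (0, 1) x
       - (- (\<i> * (pi * l))) * of_real ((0, 1) \<bullet> h) * trig_wave (- (\<i> * (pi * l))) (0, 1) x))
     + (2 * pi * j * \<i>) * of_real ((1, 0) \<bullet> h) * trig_wave (2 * pi * j * \<i>) (1, 0) x *
     ((1 / (2 * \<i>)) * (trig_wave (\<i> * (pi * l)) (0, 1) x - trig_wave (- (\<i> * (pi * l))) (0, 1) x)))) (at x)"
    unfolding trig_sin_def[abs_def]
    by (intro has_derivative_mult has_derivative_mult_right has_derivative_diff trig_wave_has_derivative)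
  have c: "(trig_cos j l has_derivative (\<lambda>h. trig_wave (2 * pi * j * \<i>) (1, 0) x *
     ((1 / 2) * ((\<i> * (pi * l)) * of_real ((0, 1) \<bullet> h) * trig_wave (\<i> * (pi * l)) (0, 1) x
       + (- (\<i> * (pi * l))) * of_real ((0, 1) \<bullet> h) * trig_wave (- (\<i> * (pi * l))) (0, 1) x))
     + (2 * pi * j * \<i>) * of_real ((1, 0) \<bullet> h) * trig_wave (2 * pi * j * \<i>) (1, 0) x *
     ((1 / 2) * (trig_wave (\<i> * (pi * l)) (0, 1) x + trig_wave (- (\<i> * (pi * l))) (0, 1) x)))) (at x)"
    unfolding trig_cos_def[abs_def]
    by (intro has_derivative_mult has_derivative_mult_right has_derivative_add trig_wave_has_derivative)
  note fs = fun_cong[OF frechet_derivative_at[OF s], symmetric]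
  note fc = fun_cong[OF frechet_derivative_at[OF c], symmetric]
  show "pderiv1 (trig_sin j l) x = 2 * pi * j * \<i> * trig_sin j l x"
    unfolding fs by (simp add: trig_sin_def)
  show "pderiv2 (trig_sin j l) x = pi * l * trig_cos j l x"
    unfolding fs by (simp add: trig_cos_def field_simps)
  show "pderiv2 (trig_cos j l) x = - (pi * l) * trig_sin j l x"
    unfolding fc by (simp add: trig_sin_def field_simps)
qed

lemma cnj_trig_sin: "cnj (trig_sin j l x) = trig_sin (- j) l x"
  by (simp add: trig_sin_eq exp_cnj)

lemma sin_pi_nat [simp]: "sin (pi * real l) = 0"
  by (metis mult.commute sin_npi)

lemma exp_periodic_unit: "exp (2 * pi * of_int j * \<i> * 1) = (1::complex)"
  using exp_integer_2pi[of "of_int j"] by (simp add: mult_ac)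

lemma trig_sin_periodic: "trig_sin j l (1, t) = trig_sin j l (0, t)"
  using exp_periodic_unit[of j] by (simp add: trig_sin_eq)

lemma trig_sin_Vqp: "trig_sin j l \<in> Vqp 1"
  by (rule Vqp_smooth[OF smooth_trig(1)]) (simp_all add: trig_sin_periodic, simp_all add: trig_sin_eq)

lemma trig_L2: "trig_sin j l \<in> L2 W0" "trig_cos j l \<in> L2 W0"
  by (intro smooth_L2_W0 smooth_trig)+

text \<open>Not normalised: the waves with l >= 1 have squared norm 1/2, so these are half the
  Fourier coefficients.\<close>

definition coeff_sin :: "(real \<times> real \<Rightarrow> complex) \<Rightarrow> int \<Rightarrow> nat \<Rightarrow> complex" where
  "coeff_sin u j l = (LINT x|lebesgue_on W0. u x * cnj (trig_sin j l x))"

lemma LINT_mult_scalar: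
  fixes u g :: "'a \<Rightarrow> complex"
  shows "(LINT x|M. u x * (c * g x)) = c * (LINT x|M. u x * g x)"
  by (simp add: mult.left_commute[of _ c])

text \<open>Integration by parts against the conjugate wave, conjugation being the change from j to
  - j. In x2 one starts from the cosine, because its derivative is a multiple of the sine.\<close>

lemma coeff_weak_deriv:
  assumes u: "u \<in> Vqp 1"
  shows "coeff_sin (weak_deriv W0 (1, 0) u) j l = 2 * pi * j * \<i> * coeff_sin u j l"
    and "(LINT x|lebesgue_on W0. weak_deriv W0 (0, 1) u x * trig_cos (- j) l x) = pi * l * coeff_sin u j l"
proof -
  show "coeff_sin (weak_deriv W0 (1, 0) u) j l = 2 * pi * j * \<i> * coeff_sin u j l"
    using Vqp_integration_by_parts(1)[OF u smooth_trig(1), of "- j" l]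
    unfolding coeff_sin_def cnj_trig_sin frechet_derivative_trig LINT_mult_scalar
    by (simp add: trig_sin_periodic)
  show "(LINT x|lebesgue_on W0. weak_deriv W0 (0, 1) u x * trig_cos (- j) l x) = pi * l * coeff_sin u j l"
    using Vqp_integration_by_parts(2)[OF u smooth_trig(2), of "- j" l]
    unfolding coeff_sin_def cnj_trig_sin frechet_derivative_trig LINT_mult_scalar
    by simp
qed

subsection \<open>Orthogonality\<close>

lemma measure_W0: "measure (lebesgue_on W0) (space (lebesgue_on W0)) = 1"
  by (simp add: measure_restrict_space W0_sets W0_box measure_lborel_box_eq Basis_plane)

lemma LINT_weak_deriv_smooth:
  assumes f: "smooth f" and e: "e \<in> Basis" and g: "g \<in> L2 W0"
  shows "(LINT x|lebesgue_on W0. weak_deriv W0 e f x * g x) = (LINT x|lebesgue_on W0. frechet_derivative f (at x) e * g x)"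
proof (rule integral_cong_AE)
  show "(\<lambda>x. weak_deriv W0 e f x * g x) \<in> borel_measurable (lebesgue_on W0)"
    by (intro borel_measurable_times L2_measurable g H1_weak_deriv_L2 smooth_H1 f e)
  show "(\<lambda>x. frechet_derivative f (at x) e * g x) \<in> borel_measurable (lebesgue_on W0)"
    by (intro borel_measurable_times L2_measurable g smooth_L2_W0 smooth_frechet_derivative f e)
  show "AE x in lebesgue_on W0. weak_deriv W0 e f x * g x = frechet_derivative f (at x) e * g x"
    using weak_deriv_smooth_AE[OF f e] by eventually_elim simp
qed

text \<open>Weak and classical derivatives of a wave agree, so every such pairing can be evaluated
  in two ways. The relations obtained replace explicit integrals in the proof of
  orthogonality.\<close>

lemma coeff_smooth_deriv:
  "coeff_sin (trig_sin j l) j' l' * j = coeff_sin (trig_sin j l) j' l' * j'"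
  "(LINT x|lebesgue_on W0. pderiv2 (trig_sin j l) x * trig_cos (- j') l' x) = pi * l' * coeff_sin (trig_sin j l) j' l'"
proof -
  have "coeff_sin (weak_deriv W0 (1, 0) (trig_sin j l)) j' l' = (LINT x|lebesgue_on W0. pderiv1 (trig_sin j l) x * cnj (trig_sin j' l' x))"
    unfolding coeff_sin_def cnj_trig_sin
    by (rule LINT_weak_deriv_smooth[OF smooth_trig(1) _ trig_L2(1)]) (simp add: Basis_plane)
  also have "\<dots> = 2 * pi * j * \<i> * coeff_sin (trig_sin j l) j' l'"
    by (simp add: frechet_derivative_trig coeff_sin_def mult.assoc)
  finally show "coeff_sin (trig_sin j l) j' l' * j = coeff_sin (trig_sin j l) j' l' * j'"
    using coeff_weak_deriv(1)[OF trig_sin_Vqp[of j l], of j' l'] by auto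
  have "(LINT x|lebesgue_on W0. weak_deriv W0 (0, 1) (trig_sin j l) x * trig_cos (- j') l' x)
     = (LINT x|lebesgue_on W0. pderiv2 (trig_sin j l) x * trig_cos (- j') l' x)"
    by (rule LINT_weak_deriv_smooth[OF smooth_trig(1) _ trig_L2(2)]) (simp add: Basis_plane)
  then show "(LINT x|lebesgue_on W0. pderiv2 (trig_sin j l) x * trig_cos (- j') l' x) = pi * l' * coeff_sin (trig_sin j l) j' l'"
    using coeff_weak_deriv(2)[OF trig_sin_Vqp[of j l], of j' l'] by simp
qed

text \<open>The usual argument for eigenfunctions: comparing eigenvalues settles distinct indices.
  For equal ones the sine and the cosine wave have the same norm and their squares add up to 1,
  whence 1/2.\<close>

lemma coeff_sin_trig_sin:
  assumes "l \<ge> 1" "l' \<ge> 1"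
  shows "coeff_sin (trig_sin j l) j' l' = (if j = j' \<and> l = l' then 1/2 else 0)"
proof (cases "j = j'")
  case False
  then show ?thesis using coeff_smooth_deriv(1)[of j l j' l'] by auto
next
  case j: True
  define C where "C l l' = (LINT x|lebesgue_on W0. trig_cos j l x * trig_cos (- j) l' x)" for l l'
  have CC: "C l l' = C l' l" for l l'
    unfolding C_def trig_cos_eq by (simp add: mult_ac exp_add[symmetric])
  have SS: "coeff_sin (trig_sin j l) j l' = coeff_sin (trig_sin j l') j l" for l l'
    unfolding coeff_sin_def cnj_trig_sin trig_sin_eq by (simp add: mult_ac exp_add[symmetric])
  \<comment> \<open>Used with \<open>l\<close> and \<open>l'\<close> in both orders, this shows that
    (l^2 - l'^2) C l l' vanishes.\<close>
  have LC: "l * C l l' = l' * coeff_sin (trig_sin j l) j l'" for l l'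
    using coeff_smooth_deriv(2)[of j l j l']
    by (simp add: frechet_derivative_trig C_def mult.assoc)
  show ?thesis
  proof (cases "l = l'")
    case False
    have "complex_of_nat l * (l * C l l') = complex_of_nat l' * (l' * C l' l)"
      unfolding LC SS[of l' l] by (simp add: mult_ac)
    then have "(complex_of_nat l * l - complex_of_nat l' * l') * C l l' = 0"
      unfolding CC[of l' l] by (simp add: algebra_simps)
    moreover have "complex_of_nat l * l - complex_of_nat l' * l' \<noteq> 0"
    proof -
      have "l * l \<noteq> l' * l'"
        using False power2_eq_iff_nonneg[of l l'] by (simp add: power2_eq_square)
      then have "complex_of_nat (l * l) \<noteq> complex_of_nat (l' * l')" by (metis of_nat_eq_iff)
      then show ?thesis by simp
    qed
    ultimately have "C l l' = 0" by simp
    with LC[of l l'] False assms j show ?thesis by simp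
  next
    case True
    have "C l l = coeff_sin (trig_sin j l) j l" using LC[of l l] assms by simp
    moreover have "C l l + coeff_sin (trig_sin j l) j l = 1"
    proof -
      have unit: "trig_cos j l x * trig_cos (- j) l x + trig_sin j l x * trig_sin (- j) l x = 1" for x
      proof -
        have alg: "(E * of_real c) * (E' * of_real c) + (E * of_real s) * (E' * of_real s) = (E * E') * of_real (c\<^sup>2 + s\<^sup>2)"
          for E E' :: complex and c s :: real
          by (simp add: algebra_simps power2_eq_square)
        have "exp (2 * pi * of_int j * \<i> * complex_of_real (fst x)) * exp (2 * pi * of_int (- j) * \<i> * complex_of_real (fst x)) = 1"
          by (simp add: exp_add[symmetric])
        then show ?thesis unfolding trig_cos_eq trig_sin_eq alg by simp
      qed
      have "C l l + coeff_sin (trig_sin j l) j l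
          = (LINT x|lebesgue_on W0. trig_cos j l x * trig_cos (- j) l x + trig_sin j l x * trig_sin (- j) l x)"
        unfolding C_def coeff_sin_def cnj_trig_sin
        by (intro Bochner_Integration.integral_add[symmetric] L2_mult_integrable trig_L2)
      also have "\<dots> = (LINT x|lebesgue_on W0. 1)" unfolding unit ..
      finally show ?thesis using measure_W0 by simp
    qed
    ultimately have "2 * coeff_sin (trig_sin j l) j l = 1" by simp
    then have "(2 * coeff_sin (trig_sin j l) j l) / 2 = 1 / 2" by (rule arg_cong)
    then show ?thesis using True j by simp
  qed
qed

subsection \<open>Trigonometric sums and their density\<close>

definition trig_sum :: "(int \<times> nat) set \<Rightarrow> (int \<times> nat \<Rightarrow> complex) \<Rightarrow> real \<times> real \<Rightarrow> complex" where
  "trig_sum F a x = (\<Sum>(j, l)\<in>F. a (j, l) * trig_sin j l x)"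

text \<open>Modes with l = 0 are the zero function; leaving them out makes distinct index pairs
  correspond to orthogonal nonzero functions.\<close>

definition trig_sums :: "(real \<times> real \<Rightarrow> complex) set" where
  "trig_sums = {trig_sum F a |F a. finite F \<and> (\<forall>(j, l)\<in>F. l \<ge> 1)}"

lemma trig_sum_L2: "finite F \<Longrightarrow> trig_sum F a \<in> L2 W0"
  unfolding trig_sum_def[abs_def] case_prod_beta by (intro L2_sum L2_cmult trig_L2)

lemma trig_sums_cases:
  assumes "s \<in> trig_sums"
  obtains F a where "finite F" "\<And>j l. (j, l) \<in> F \<Longrightarrow> l \<ge> 1" "s = trig_sum F a"
proof -
  from assms obtain F a where F: "s = trig_sum F a" "finite F" "\<forall>(j, l)\<in>F. l \<ge> 1"
    unfolding trig_sums_def by blast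
  show ?thesis by (rule that[OF F(2) _ F(1)]) (use F(3) in auto)
qed

lemma trig_sums_zero: "(\<lambda>_. 0) \<in> trig_sums"
  unfolding trig_sums_def by (intro CollectI exI[of _ "{}"] exI[of _ "\<lambda>_. 0"]) (simp add: trig_sum_def fun_eq_iff)

lemma trig_sums_add:
  assumes "s \<in> trig_sums" "t \<in> trig_sums" shows "(\<lambda>x. s x + t x) \<in> trig_sums"
proof -
  obtain F a where F: "finite F" "\<And>j l. (j, l) \<in> F \<Longrightarrow> l \<ge> 1" "s = trig_sum F a"
    by (rule trig_sums_cases[OF assms(1)], rule that)
  obtain G b where G: "finite G" "\<And>j l. (j, l) \<in> G \<Longrightarrow> l \<ge> 1" "t = trig_sum G b"
    by (rule trig_sums_cases[OF assms(2)], rule that)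
  define c where "c p = (if p \<in> F then a p else 0) + (if p \<in> G then b p else 0)" for p
  have eF: "(\<Sum>p\<in>F \<union> G. (if p \<in> F then a p else 0) * h p) = (\<Sum>p\<in>F. a p * h p)" for h :: "_ \<Rightarrow> complex"
    using F(1) G(1) by (intro sum.mono_neutral_cong_right) auto
  have eG: "(\<Sum>p\<in>F \<union> G. (if p \<in> G then b p else 0) * h p) = (\<Sum>p\<in>G. b p * h p)" for h :: "_ \<Rightarrow> complex"
    using F(1) G(1) by (intro sum.mono_neutral_cong_right) auto
  have "trig_sum (F \<union> G) c x = s x + t x" for x
    unfolding trig_sum_def F(3) G(3) case_prod_beta prod.collapse c_def distrib_right sum.distrib eF eG ..
  then have "(\<lambda>x. s x + t x) = trig_sum (F \<union> G) c" by (simp add: fun_eq_iff)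
  moreover have "finite (F \<union> G)" "\<forall>(j, l)\<in>F \<union> G. l \<ge> 1" using F(1,2) G(1,2) by auto
  ultimately show ?thesis unfolding trig_sums_def by blast
qed

lemma trig_sums_trig_sin: "(\<lambda>x. c * trig_sin j l x) \<in> trig_sums"
proof (cases "l = 0")
  case True
  then have "(\<lambda>x. c * trig_sin j l x) = (\<lambda>_. 0)" by (simp add: trig_sin_eq fun_eq_iff)
  then show ?thesis using trig_sums_zero by simp
next
  case False
  have "(\<lambda>x. c * trig_sin j l x) = trig_sum {(j, l)} (\<lambda>_. c)" by (simp add: trig_sum_def fun_eq_iff)
  moreover have "finite {(j, l)}" "\<forall>(j, l)\<in>{(j, l)}. l \<ge> 1" using False by auto
  ultimately show ?thesis unfolding trig_sums_def by blast
qed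

lemma trig_sums_sum: "finite I \<Longrightarrow> (\<And>i. i \<in> I \<Longrightarrow> f i \<in> trig_sums) \<Longrightarrow> (\<lambda>x. \<Sum>i\<in>I. f i x) \<in> trig_sums"
  by (induction I rule: finite_induct) (simp_all add: trig_sums_zero trig_sums_add)

lemma trig_sums_map:
  assumes "s \<in> trig_sums" and m: "\<And>c j l. (\<lambda>x. m x * (c * trig_sin j l x)) \<in> trig_sums"
  shows "(\<lambda>x. m x * s x) \<in> trig_sums"
proof -
  obtain F a where F: "finite F" "s = trig_sum F a"
    by (rule trig_sums_cases[OF assms(1)], rule that)
  have "(\<lambda>x. m x * s x) = (\<lambda>x. \<Sum>p\<in>F. m x * (a p * trig_sin (fst p) (snd p) x))"
    by (simp add: F(2) trig_sum_def sum_distrib_left case_prod_beta fun_eq_iff)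
  also have "\<dots> \<in> trig_sums" by (intro trig_sums_sum F(1) m)
  finally show ?thesis .
qed

lemma trig_sums_scale: "s \<in> trig_sums \<Longrightarrow> (\<lambda>x. c * s x) \<in> trig_sums"
  by (rule trig_sums_map) (use trig_sums_trig_sin in \<open>simp_all add: mult.assoc[symmetric]\<close>)

interpretation trig_sums: L2_subspace W0 trig_sums
proof
  show "trig_sums \<subseteq> L2 W0" by (auto simp: trig_sums_def intro: trig_sum_L2)
qed (auto intro: W0_lmeasurable trig_sums_zero trig_sums_add trig_sums_scale)

text \<open>The cosine shifts \<open>j\<close> by one in both directions; the centre
  \<open>m\<close> enters through phases of the coefficients.\<close>

lemma trig_sums_cos1:
  assumes "s \<in> trig_sums" shows "(\<lambda>x. complex_of_real (cos (2 * pi * (fst x - m))) * s x) \<in> trig_sums"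
proof (rule trig_sums_map[OF assms])
  fix c j l
  have "complex_of_real (cos (2 * pi * (fst x - m))) * (c * trig_sin j l x)
     = (c * exp (- (2 * pi * m * \<i>)) / 2) * trig_sin (j + 1) l x + (c * exp (2 * pi * m * \<i>) / 2) * trig_sin (j - 1) l x" for x
  proof -
    have "complex_of_real (cos (2 * pi * (fst x - m))) =
        (exp (2 * pi * \<i> * complex_of_real (fst x)) * exp (- (2 * pi * m * \<i>)) + exp (- (2 * pi * \<i> * complex_of_real (fst x))) * exp (2 * pi * m * \<i>)) / 2"
      unfolding cos_of_real[symmetric] cos_exp_eq exp_add[symmetric] by (simp add: algebra_simps)
    moreover have "trig_sin (j + 1) l x = exp (2 * pi * \<i> * complex_of_real (fst x)) * trig_sin j l x"
      "trig_sin (j - 1) l x = exp (- (2 * pi * \<i> * complex_of_real (fst x))) * trig_sin j l x"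
      unfolding trig_sin_eq mult.assoc[symmetric] exp_add[symmetric] by (simp_all add: algebra_simps)
    moreover have "((e1 * f1 + e2 * f2) / 2) * (c * t) = (c * f1 / 2) * (e1 * t) + (c * f2 / 2) * (e2 * t)"
      for e1 e2 f1 f2 t :: complex by (simp add: field_simps)
    ultimately show ?thesis by (simp only:)
  qed
  then show "(\<lambda>x. complex_of_real (cos (2 * pi * (fst x - m))) * (c * trig_sin j l x)) \<in> trig_sums"
    by (simp only:) (intro trig_sums_add trig_sums_trig_sin)
qed

text \<open>The product formula shifts \<open>l\<close> by one in both directions. For l = 1 the
  lower term has index 0 and vanishes, so the space is preserved.\<close>

lemma trig_sums_cos2:
  assumes "s \<in> trig_sums" shows "(\<lambda>x. complex_of_real (cos (pi * snd x)) * s x) \<in> trig_sums"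
proof -
  obtain F a where F: "finite F" "\<And>j l. (j, l) \<in> F \<Longrightarrow> l \<ge> 1" "s = trig_sum F a"
    by (rule trig_sums_cases[OF assms(1)], rule that)
  have eq: "complex_of_real (cos (pi * snd x)) * trig_sin j l x
     = (1/2) * trig_sin j (l + 1) x + (1/2) * trig_sin j (l - 1) x" if "l \<ge> 1" for j l x
  proof -
    have "cos (pi * snd x) * sin (pi * l * snd x) = (sin (pi * (real l + 1) * snd x) + sin (pi * (real l - 1) * snd x)) / 2"
      unfolding sin_times_cos mult.commute[of "cos _"] by (simp add: algebra_simps)
    then have "complex_of_real (cos (pi * snd x) * sin (pi * l * snd x)) = of_real ((sin (pi * (real l + 1) * snd x) + sin (pi * (real l - 1) * snd x)) / 2)"
      by (rule arg_cong)
    then have cs: "complex_of_real (cos (pi * snd x)) * of_real (sin (pi * l * snd x))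
        = (of_real (sin (pi * (real l + 1) * snd x)) + of_real (sin (pi * (real l - 1) * snd x))) / 2"
      by simp
    have l1: "real (l - 1) = real l - 1" "real (l + 1) = real l + 1" using that by (simp_all add: of_nat_diff)
    have "C * (E * S) = (1/2) * (E * A) + (1/2) * (E * B)" if "C * S = (A + B) / 2" for C E S A B :: complex
    proof -
      have "C * (E * S) = E * (C * S)" by simp
      then show ?thesis unfolding that by (simp add: field_simps)
    qed
    from this[OF cs] show ?thesis unfolding trig_sin_eq l1 .
  qed
  have "(\<lambda>x. complex_of_real (cos (pi * snd x)) * s x)
      = (\<lambda>x. \<Sum>p\<in>F. (a p * (1/2)) * trig_sin (fst p) (snd p + 1) x + (a p * (1/2)) * trig_sin (fst p) (snd p - 1) x)"
    unfolding F(3) trig_sum_def sum_distrib_left case_prod_beta prod.collapse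
  proof (intro ext sum.cong refl)
    fix x p assume "p \<in> F"
    then have "snd p \<ge> 1" using F(2)[of "fst p" "snd p"] by simp
    from eq[OF this, of x "fst p"]
    show "complex_of_real (cos (pi * snd x)) * (a p * trig_sin (fst p) (snd p) x)
      = (a p * (1/2)) * trig_sin (fst p) (snd p + 1) x + (a p * (1/2)) * trig_sin (fst p) (snd p - 1) x"
      unfolding mult.left_commute[of _ "a p"] by (simp add: distrib_left mult.assoc)
  qed
  also have "\<dots> \<in> trig_sums"
    by (intro trig_sums_sum F(1) trig_sums_add trig_sums_trig_sin)
  finally show ?thesis .
qed

lemma approx_polynomial:
  assumes y: "\<And>s. trig_sums.approx s \<Longrightarrow> trig_sums.approx (\<lambda>x. complex_of_real (y x) * s x)"
    and Q: "real_polynomial_function (Q :: real \<Rightarrow> real)" and s: "trig_sums.approx s"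
  shows "trig_sums.approx (\<lambda>x. complex_of_real (Q (y x)) * s x)"
  using Q s
proof (induction Q arbitrary: s rule: real_polynomial_function.induct)
  case (linear f)
  have "f t = f 1 * t" for t
    using linear_scale[OF bounded_linear.linear[OF linear(1)], of t 1] by (simp add: mult.commute)
  then have "(\<lambda>x. complex_of_real (f (y x)) * s x) = (\<lambda>x. of_real (f 1) * (of_real (y x) * s x))"
    by (metis (no_types, opaque_lifting) mult.assoc of_real_mult)
  then show ?case using trig_sums.approx_scale[OF y[OF linear(2)]] by simp
next
  case (const c)
  show ?case by (rule trig_sums.approx_scale[OF const])
next
  case (add f g)
  show ?case using trig_sums.approx_add[OF add.IH(1)[OF add.prems] add.IH(2)[OF add.prems]]
    by (simp add: distrib_right)
next
  case (mult f g)
  show ?case using mult.IH(1)[OF mult.IH(2)[OF mult.prems]] by (simp add: mult.assoc)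
qed

lemma approx_bounded_mult:
  assumes "trig_sums.approx s" and m: "\<And>t. t \<in> trig_sums \<Longrightarrow> (\<lambda>x. complex_of_real (y x) * t x) \<in> trig_sums"
    and ym: "(\<lambda>x. complex_of_real (y x)) \<in> borel_measurable (lebesgue_on W0)" and yb: "\<And>x. \<bar>y x\<bar> \<le> 1"
  shows "trig_sums.approx (\<lambda>x. complex_of_real (y x) * s x)"
proof (rule trig_sums.approx_close)
  have b: "(\<lambda>x. complex_of_real (y x) * f x) \<in> L2 W0" "L2_norm W0 (\<lambda>x. complex_of_real (y x) * f x) \<le> 1 * L2_norm W0 f"
    if "f \<in> L2 W0" for f
    using L2_bounded_mult[OF that ym, of 1] yb by simp_all
  have s: "s \<in> L2 W0" using assms(1) by (simp add: L2_approximable_def)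
  show "(\<lambda>x. complex_of_real (y x) * s x) \<in> L2 W0" by (rule b(1)[OF s])
  fix e :: real assume "e > 0"
  then obtain t where t: "t \<in> trig_sums" "L2_norm W0 (\<lambda>x. s x - t x) < e"
    using assms(1) unfolding L2_approximable_def by auto
  then have tL: "t \<in> L2 W0" using trig_sums.sub by auto
  have "L2_norm W0 (\<lambda>x. complex_of_real (y x) * s x - complex_of_real (y x) * t x) < e"
    using b(2)[OF L2_diff[OF s tL]] t(2) by (simp add: right_diff_distrib)
  then show "\<exists>g. trig_sums.approx g \<and> L2_norm W0 (\<lambda>x. complex_of_real (y x) * s x - g x) < e"
    using trig_sums.approx_member[OF m[OF t(1)]] by (intro exI conjI)
qed

text \<open>Weierstrass approximation: invariance of the closure under multiplication by
  \<open>y\<close> extends to polynomials in \<open>y\<close>, and by uniform approximation on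
  [-1, 1], where \<open>y\<close> takes its values, to continuous functions of
  \<open>y\<close>.\<close>

lemma approx_continuous_compose:
  assumes y: "\<And>s. trig_sums.approx s \<Longrightarrow> trig_sums.approx (\<lambda>x. complex_of_real (y x) * s x)"
    and s: "trig_sums.approx s" and yb: "\<And>x. \<bar>y x\<bar> \<le> 1" and sb: "\<And>x. x \<in> W0 \<Longrightarrow> cmod (s x) \<le> K"
    and D: "continuous_on {-1..1::real} D"
  shows "trig_sums.approx (\<lambda>x. complex_of_real (D (y x)) * s x)"
proof -
  have "\<forall>n. \<exists>Q. real_polynomial_function Q \<and> (\<forall>t\<in>{-1..1}. \<bar>D t - Q t\<bar> < 1 / (real n + 1))"
  proof
    fix n
    obtain Q where "real_polynomial_function Q" "\<And>t. t \<in> {-1..1} \<Longrightarrow> \<bar>D t - Q t\<bar> < 1 / (real n + 1)"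
      by (rule Stone_Weierstrass_real_polynomial_function[OF compact_Icc D, of "1 / (real n + 1)"], simp, rule that)
    then show "\<exists>Q. real_polynomial_function Q \<and> (\<forall>t\<in>{-1..1}. \<bar>D t - Q t\<bar> < 1 / (real n + 1))" by auto
  qed
  from choice[OF this] obtain Q where
    Q0: "\<forall>n. real_polynomial_function (Q n) \<and> (\<forall>t\<in>{-1..1}. \<bar>D t - Q n t\<bar> < 1 / (real n + 1))" ..
  have Q: "real_polynomial_function (Q n)" "t \<in> {-1..1} \<Longrightarrow> \<bar>D t - Q n t\<bar> < 1 / (real n + 1)" for n t
    using Q0 by auto
  have yI: "y x \<in> {-1..1}" for x using yb[of x] by auto
  have "compact (D ` {-1..1})" by (intro compact_continuous_image D compact_Icc)
  then obtain B where B: "\<forall>z\<in>D ` {-1..1}. norm z \<le> B" using compact_imp_bounded bounded_iff by metis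
  have DB: "\<bar>D (y x)\<bar> \<le> B" for x using bspec[OF B imageI[OF yI[of x]]] by simp
  have z: "(\<lambda>n. 1 / (real n + 1)) \<longlonglongrightarrow> 0"
    using LIMSEQ_inverse_real_of_nat by (simp add: inverse_eq_divide add.commute)
  show ?thesis
  proof (rule trig_sums.approx_bounded_limit[where K="(B + 1) * K"])
    show "trig_sums.approx (\<lambda>x. complex_of_real (Q n (y x)) * s x)" for n
      by (rule approx_polynomial[OF y Q(1) s])
    show "(\<lambda>n. complex_of_real (Q n (y x)) * s x) \<longlonglongrightarrow> complex_of_real (D (y x)) * s x" for x
    proof (intro tendsto_intros)
      have "(\<lambda>n. Q n (y x) - D (y x)) \<longlonglongrightarrow> 0"
      proof (rule Lim_null_comparison[OF _ z], rule always_eventually, rule allI)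
        show "norm (Q n (y x) - D (y x)) \<le> 1 / (real n + 1)" for n
          using Q(2)[OF yI[of x], of n] by (simp add: abs_minus_commute)
      qed
      then show "(\<lambda>n. Q n (y x)) \<longlonglongrightarrow> D (y x)" by (simp add: LIM_zero_iff)
    qed
    fix n x assume x: "x \<in> W0"
    have "1 / (real n + 1) \<le> 1" by simp
    then have "\<bar>Q n (y x)\<bar> \<le> B + 1" using Q(2)[OF yI[of x], of n] DB[of x] by linarith
    then show "cmod (complex_of_real (Q n (y x)) * s x) \<le> (B + 1) * K"
      unfolding norm_mult norm_of_real using sb[OF x] by (intro mult_mono) auto
  qed
qed

text \<open>Continuous ramps approximate the indicator of t > c. At t = c every ramp is 0, in
  agreement with the strict inequalities of open boxes.\<close>

lemma ramp_tendsto: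
  "(\<lambda>n. min 1 (max 0 (real n * (t - c)))) \<longlonglongrightarrow> (if c < t then 1 else 0 :: real)"
proof (cases "c < t")
  case True
  then obtain n where n: "1 < real n * (t - c)" using reals_Archimedean3[of "t - c"] by auto
  have "min 1 (max 0 (real m * (t - c))) = 1" if "m \<ge> n" for m
  proof -
    have "real n * (t - c) \<le> real m * (t - c)" using True that by (intro mult_right_mono) auto
    with n show ?thesis by simp
  qed
  then show ?thesis using True by (intro tendsto_eventually) (auto simp: eventually_sequentially)
next
  case False
  then have "min 1 (max 0 (real m * (t - c))) = 0" for m by (simp add: mult_nonneg_nonpos)
  with False show ?thesis by simp
qed

text \<open>Intervals are superlevel sets of cosines: this is what makes indicators of boxes accessible to
  the Weierstrass theorem.\<close>

lemma interval_iff_cos1: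
  assumes "0 \<le> a" "a \<le> b" "b \<le> 1" "0 < t" "t < 1"
  shows "cos (pi * (b - a)) < cos (2 * pi * (t - (a + b) / 2)) \<longleftrightarrow> a < t \<and> t < b"
proof -
  define \<theta> where "\<theta> = \<bar>2 * pi * (t - (a + b) / 2)\<bar>"
  define h where "h = pi * (b - a)"
  have h: "0 \<le> h" "h \<le> pi" unfolding h_def using assms by (auto intro: mult_nonneg_nonneg mult_left_le)
  have c: "cos (2 * pi * (t - (a + b) / 2)) = cos \<theta>" unfolding \<theta>_def by simp
  have \<theta>2: "\<theta> = pi * \<bar>2 * t - (a + b)\<bar>" 
  proof -
    have "2 * pi * (t - (a + b) / 2) = pi * (2 * t - (a + b))" by (simp add: field_simps)
    then show ?thesis unfolding \<theta>_def by (simp only: abs_mult abs_of_pos[OF pi_gt_zero])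
  qed
  have 1: "\<theta> < h \<longleftrightarrow> a < t \<and> t < b"
    unfolding \<theta>2 h_def by (auto simp: abs_less_iff)
  \<comment> \<open>The angle may exceed pi, where the cosine increases again; this bound keeps the
    reflected angle 2 pi - \<theta> above h.\<close>
  have "\<bar>2 * t - (a + b)\<bar> < 2 - (b - a)" using assms by (auto simp: abs_less_iff)
  then have 2: "\<theta> < 2 * pi - h" unfolding \<theta>2 h_def
    using mult_strict_left_mono[of "\<bar>2 * t - (a + b)\<bar>" "2 - (b - a)" pi] by (simp add: algebra_simps)
  have "cos h < cos \<theta> \<longleftrightarrow> \<theta> < h"
  proof (cases "\<theta> \<le> pi")
    case True
    have "0 \<le> \<theta>" by (simp add: \<theta>_def)
    with True h show ?thesis by (intro cos_mono_less_eq) auto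
  next
    case False
    have "cos \<theta> = cos (2 * pi - \<theta>)" by (simp add: cos_diff)
    moreover have "\<not> cos h < cos (2 * pi - \<theta>)"
      using False 2 h by (subst cos_mono_less_eq) auto
    ultimately show ?thesis using False h by auto
  qed
  then show ?thesis unfolding c h_def[symmetric] 1 by simp
qed

lemma interval_iff_cos2:
  assumes "0 \<le> a" "a \<le> 1" "0 \<le> b" "b \<le> 1" "0 < t" "t < 1"
  shows "cos (pi * b) < cos (pi * t) \<longleftrightarrow> t < b" "- cos (pi * a) < - cos (pi * t) \<longleftrightarrow> a < t"
proof -
  have r: "0 \<le> pi * y" "pi * y \<le> pi" if "0 \<le> y" "y \<le> 1" for y :: real
    using that by (auto intro: mult_left_le)
  show "cos (pi * b) < cos (pi * t) \<longleftrightarrow> t < b"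
    using assms r[of b] r[of t] by (subst cos_mono_less_eq) auto
  show "- cos (pi * a) < - cos (pi * t) \<longleftrightarrow> a < t"
    using assms r[of a] r[of t] by (simp add: cos_mono_less_eq)
qed

text \<open>Every sum carries a sine in x2, so the indicator of a box is out of direct reach.
  Starting from sin (pi x2) and multiplying by continuous functions of the two cosines, one has to
  divide the sine out again.\<close>

theorem trig_sums_dense:
  assumes "f \<in> L2 W0" shows "trig_sums.approx f"
proof (rule trig_sums.dense_if_boxes[OF _ assms])
  have c1: "trig_sums.approx (\<lambda>x. complex_of_real (cos (2 * pi * (fst x - m))) * s x)" if "trig_sums.approx s" for s m
    by (rule approx_bounded_mult[OF that trig_sums_cos1])
      (auto intro!: continuous_measurable_W0 continuous_intros simp: split_beta)
  have c2: "trig_sums.approx (\<lambda>x. complex_of_real (cos (pi * snd x)) * s x)" if "trig_sums.approx s" for s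
    by (rule approx_bounded_mult[OF that trig_sums_cos2])
      (auto intro!: continuous_measurable_W0 continuous_intros simp: split_beta)
  fix p r :: "real \<times> real"
  \<comment> \<open>The corners are clamped to the unit square, and the upper one to lie above the
    lower one, so that empty boxes become degenerate intervals.\<close>
  define a b a' b' where "a = max 0 (min 1 (fst p))" and "b = max a (min 1 (fst r))"
    and "a' = max 0 (min 1 (snd p))" and "b' = max a' (min 1 (snd r))"
  have ab: "0 \<le> a" "a \<le> b" "b \<le> 1" "a \<le> 1" "0 \<le> a'" "a' \<le> b'" "b' \<le> 1" "a' \<le> 1" "0 \<le> b'"
    unfolding a_def b_def a'_def b'_def by auto
  have box: "x \<in> box p r \<longleftrightarrow> (a < fst x \<and> fst x < b) \<and> a' < snd x \<and> snd x < b'" if "x \<in> W0" for x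
    using that by (auto simp: mem_box_plane W0_def a_def b_def a'_def b'_def)
  define m where "m = (a + b) / 2"
  define R where "R n t = min 1 (max 0 (real n * t))" for n :: nat and t :: real
  have R01: "0 \<le> R n t" "R n t \<le> 1" for n t by (auto simp: R_def)
  have Rc: "continuous_on S (R n)" for S n unfolding R_def by (intro continuous_intros)
  define G where "G n t = R n (t - cos (pi * (b - a)))" for n t
  \<comment> \<open>With t = cos (pi x2) the root is sin (pi x2), and cutting the denominator off at
    1 / (n + 1) keeps the quotient continuous. The cosine decreases, so the lower limit a' gives the
    ramp in cos (pi a') - t.\<close>
  define D where "D n t = R n (t - cos (pi * b')) * R n (cos (pi * a') - t) / max (1 / (real n + 1)) (sqrt (1 - t\<^sup>2))" for n t
  define S0 where "S0 x = trig_sin 0 1 x" for x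
  have S0: "trig_sums.approx S0" "\<And>x. S0 x = of_real (sin (pi * snd x))"
    using trig_sums_trig_sin[of 1 0 1] unfolding S0_def[abs_def] by (auto intro!: trig_sums.approx_member simp: trig_sin_eq)
  have S0b: "cmod (S0 x) \<le> 1" for x unfolding S0 norm_of_real by simp
  define F where "F n x = complex_of_real (G n (cos (2 * pi * (fst x - m)))) * (complex_of_real (D n (cos (pi * snd x))) * S0 x)" for n x
  have mx: "0 < max (1 / (real n + 1)) y" for n y by (simp add: less_max_iff_disj)
  have Dc: "continuous_on {-1..1} (D n)" for n
    unfolding D_def using mx[of n]
    by (intro continuous_on_divide continuous_on_mult continuous_on_compose2[OF Rc] continuous_intros) (auto simp: less_imp_neq[symmetric])
  have Gc: "continuous_on {-1..1} (G n)" for n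
    unfolding G_def by (intro continuous_on_compose2[OF Rc] continuous_intros) auto
  have sinx: "0 < sin (pi * snd x)" "sqrt (1 - (cos (pi * snd x))\<^sup>2) = sin (pi * snd x)" if "x \<in> W0" for x
  proof -
    show s: "0 < sin (pi * snd x)" using that by (intro sin_gt_zero) (auto simp: W0_def)
    have "1 - (cos (pi * snd x))\<^sup>2 = (sin (pi * snd x))\<^sup>2" by (simp add: sin_squared_eq)
    then show "sqrt (1 - (cos (pi * snd x))\<^sup>2) = sin (pi * snd x)" using s by simp
  qed
  have DS: "0 \<le> D n (cos (pi * snd x)) * sin (pi * snd x)" "D n (cos (pi * snd x)) * sin (pi * snd x) \<le> 1" if x: "x \<in> W0" for n x
  proof -
    let ?s = "sin (pi * snd x)" and ?r = "R n (cos (pi * snd x) - cos (pi * b')) * R n (cos (pi * a') - cos (pi * snd x))"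
    have eq: "D n (cos (pi * snd x)) * ?s = ?r * (?s / max (1 / (real n + 1)) ?s)"
      unfolding D_def sinx(2)[OF x] by simp
    have q: "0 \<le> ?s / max (1 / (real n + 1)) ?s" "?s / max (1 / (real n + 1)) ?s \<le> 1"
      using sinx(1)[OF x] mx[of n ?s] by (auto simp: divide_le_eq_1)
    have rr: "0 \<le> ?r" "?r \<le> 1" by (auto intro!: mult_nonneg_nonneg mult_le_one R01)
    show "0 \<le> D n (cos (pi * snd x)) * ?s" "D n (cos (pi * snd x)) * ?s \<le> 1"
      unfolding eq by (rule mult_nonneg_nonneg[OF rr(1) q(1)], rule mult_le_one[OF rr(2) q])
  qed
  show "trig_sums.approx (indicator (box p r))"
  proof (rule trig_sums.approx_bounded_limit[where K=1])
    fix n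
    have s2: "trig_sums.approx (\<lambda>x. complex_of_real (D n (cos (pi * snd x))) * S0 x)"
      by (rule approx_continuous_compose[OF c2 S0(1) _ S0b Dc]) (assumption | rule abs_cos_le_one)+
    have nb: "cmod (complex_of_real (D n (cos (pi * snd x))) * S0 x) \<le> 1" if "x \<in> W0" for x
      using DS[OF that, of n] unfolding S0(2) of_real_mult[symmetric] norm_of_real by simp
    show "trig_sums.approx (F n)"
      unfolding F_def by (rule approx_continuous_compose[OF c1 s2 _ nb Gc]) (assumption | rule abs_cos_le_one)+
    show "cmod (F n x) \<le> 1" if "x \<in> W0" for x
      unfolding F_def norm_mult[of "of_real (G _ _)"] using nb[OF that] R01 unfolding G_def
      by (intro mult_le_one) auto
  next
    fix x assume x: "x \<in> W0"
    then have x01: "0 < fst x" "fst x < 1" "0 < snd x" "snd x < 1" by (auto simp: W0_def)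
    have 1: "(\<lambda>n. G n (cos (2 * pi * (fst x - m)))) \<longlonglongrightarrow> (if a < fst x \<and> fst x < b then 1 else 0)"
      using ramp_tendsto[of "cos (2 * pi * (fst x - m))" "cos (pi * (b - a))"]
      unfolding G_def R_def m_def interval_iff_cos1[OF ab(1-3) x01(1,2)] .
    have 2: "(\<lambda>n. R n (cos (pi * snd x) - cos (pi * b'))) \<longlonglongrightarrow> (if snd x < b' then 1 else 0)"
      using ramp_tendsto[of "cos (pi * snd x)" "cos (pi * b')"]
      unfolding R_def interval_iff_cos2(1)[OF ab(5,8) ab(9,7) x01(3,4)] .
    have 3: "(\<lambda>n. R n (cos (pi * a') - cos (pi * snd x))) \<longlonglongrightarrow> (if a' < snd x then 1 else 0)"
      using ramp_tendsto[of "- cos (pi * snd x)" "- cos (pi * a')"]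
      unfolding R_def interval_iff_cos2(2)[OF ab(5,8) ab(9,7) x01(3,4)] by simp
    have z: "(\<lambda>n. 1 / (real n + 1)) \<longlonglongrightarrow> 0"
      using LIMSEQ_inverse_real_of_nat by (simp add: inverse_eq_divide add.commute)
    have "(\<lambda>n. max (1 / (real n + 1)) (sin (pi * snd x))) \<longlonglongrightarrow> max 0 (sin (pi * snd x))"
      by (intro tendsto_max z tendsto_const)
    then have 4: "(\<lambda>n. sin (pi * snd x) / max (1 / (real n + 1)) (sin (pi * snd x))) \<longlonglongrightarrow> 1"
      using tendsto_divide[OF tendsto_const[of "sin (pi * snd x)"]] sinx(1)[OF x] by fastforce
    have "(\<lambda>n. G n (cos (2 * pi * (fst x - m))) * (R n (cos (pi * snd x) - cos (pi * b')) * R n (cos (pi * a') - cos (pi * snd x))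
        * (sin (pi * snd x) / max (1 / (real n + 1)) (sin (pi * snd x)))))
        \<longlonglongrightarrow> (if a < fst x \<and> fst x < b then 1 else 0) * ((if snd x < b' then 1 else 0) * (if a' < snd x then 1 else 0) * 1)"
      by (intro tendsto_mult 1 2 3 4)
    then have "(\<lambda>n. complex_of_real (G n (cos (2 * pi * (fst x - m))) * (R n (cos (pi * snd x) - cos (pi * b')) * R n (cos (pi * a') - cos (pi * snd x))
        * (sin (pi * snd x) / max (1 / (real n + 1)) (sin (pi * snd x))))))
        \<longlonglongrightarrow> complex_of_real ((if a < fst x \<and> fst x < b then 1 else 0) * ((if snd x < b' then 1 else 0) * (if a' < snd x then 1 else 0) * 1))"
      by (rule tendsto_of_real)
    moreover have "complex_of_real (G n (cos (2 * pi * (fst x - m))) * (R n (cos (pi * snd x) - cos (pi * b')) * R n (cos (pi * a') - cos (pi * snd x))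
        * (sin (pi * snd x) / max (1 / (real n + 1)) (sin (pi * snd x))))) = F n x" for n
      unfolding F_def D_def S0(2) sinx(2)[OF x] by simp
    moreover have "complex_of_real ((if a < fst x \<and> fst x < b then 1 else 0) * ((if snd x < b' then 1 else 0) * (if a' < snd x then 1 else 0) * 1)) = indicator (box p r) x"
      using box[OF x] by (auto simp: indicator_def)
    ultimately show "(\<lambda>n. F n x) \<longlonglongrightarrow> indicator (box p r) x" by simp
  qed
qed

section \<open>Weak form of the problem, Fourier symbol and energy estimate\<close>

section \<open>The variational problem\<close>

abbreviation inner_W0 :: "(real \<times> real \<Rightarrow> complex) \<Rightarrow> (real \<times> real \<Rightarrow> complex) \<Rightarrow> complex" where
  "inner_W0 u w \<equiv> (LINT x|lebesgue_on W0. u x * cnj (w x))"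

abbreviation "wd1 \<equiv> weak_deriv W0 (1, 0)"
abbreviation "wd2 \<equiv> weak_deriv W0 (0, 1)"

lemma Basis_plane_mem: "(1, 0) \<in> (Basis :: (real \<times> real) set)" "(0, 1) \<in> (Basis :: (real \<times> real) set)"
  by (simp_all add: Basis_plane)

lemma H1_wd: "u \<in> H1 W0 \<Longrightarrow> wd1 u \<in> L2 W0" "u \<in> H1 W0 \<Longrightarrow> wd2 u \<in> L2 W0"
  by (intro H1_weak_deriv_L2 Basis_plane_mem; assumption)+

lemma inner_integrable: "u \<in> L2 W0 \<Longrightarrow> w \<in> L2 W0 \<Longrightarrow> integrable (lebesgue_on W0) (\<lambda>x. u x * cnj (w x))"
  by (intro L2_mult_integrable L2_cnj)

lemma inner_bound: "u \<in> L2 W0 \<Longrightarrow> w \<in> L2 W0 \<Longrightarrow> cmod (inner_W0 u w) \<le> L2_norm W0 u * L2_norm W0 w"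
  using L2_Cauchy_Schwarz[OF _ L2_cnj, of u W0 w] by (simp add: L2_norm_cnj)

lemma inner_diff: "u \<in> L2 W0 \<Longrightarrow> v \<in> L2 W0 \<Longrightarrow> w \<in> L2 W0 \<Longrightarrow>
    inner_W0 (\<lambda>x. u x - v x) w = inner_W0 u w - inner_W0 v w"
  by (simp add: left_diff_distrib inner_integrable)

lemma inner_cmult: "inner_W0 (\<lambda>x. c * u x) w = c * inner_W0 u w"
  by (simp add: mult.assoc)

lemma inner_self: "inner_W0 u u = complex_of_real ((L2_norm W0 u)\<^sup>2)"
  unfolding L2_norm_square
  by (subst integral_complex_of_real[symmetric]) (simp add: complex_norm_square[symmetric])

lemma inner_cong_AE:
  assumes "AE x in lebesgue_on W0. u x = u' x" "u \<in> L2 W0" "u' \<in> L2 W0" "w \<in> L2 W0"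
  shows "inner_W0 u w = inner_W0 u' w"
proof (rule integral_cong_AE)
  show "AE x in lebesgue_on W0. u x * cnj (w x) = u' x * cnj (w x)"
    using assms(1) by eventually_elim simp
qed (intro borel_measurable_times L2_measurable L2_cnj assms)+

lemma inner_weak_deriv_smooth:
  assumes "smooth \<phi>" "e \<in> Basis" "u \<in> L2 W0"
  shows "inner_W0 u (weak_deriv W0 e \<phi>) = (LINT x|lebesgue_on W0. u x * cnj (frechet_derivative \<phi> (at x) e))"
proof (rule integral_cong_AE)
  show "AE x in lebesgue_on W0. u x * cnj (weak_deriv W0 e \<phi> x) = u x * cnj (frechet_derivative \<phi> (at x) e)"
    using weak_deriv_smooth_AE[OF assms(1,2)] by eventually_elim simp
  show "(\<lambda>x. u x * cnj (weak_deriv W0 e \<phi> x)) \<in> borel_measurable (lebesgue_on W0)"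
    by (intro borel_measurable_times L2_measurable L2_cnj H1_weak_deriv_L2 smooth_H1 assms)
  show "(\<lambda>x. u x * cnj (frechet_derivative \<phi> (at x) e)) \<in> borel_measurable (lebesgue_on W0)"
    by (intro borel_measurable_times L2_measurable L2_cnj smooth_L2_W0 smooth_frechet_derivative assms)
qed

lemma inner_tendsto:
  assumes "\<And>n. u n \<in> L2 W0" "u' \<in> L2 W0" "(\<lambda>n. L2_norm W0 (\<lambda>x. u n x - u' x)) \<longlonglongrightarrow> 0" "w \<in> L2 W0"
  shows "(\<lambda>n. inner_W0 (u n) w) \<longlonglongrightarrow> inner_W0 u' w"
  by (rule L2_pairing_tendsto[OF assms(1-3) L2_cnj[OF assms(4)]])

subsection \<open>Duality with trigonometric sums\<close>

lemma inner_trig_sum_right: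
  assumes "finite F" "u \<in> L2 W0"
  shows "inner_W0 u (trig_sum F a) = (\<Sum>(j, l)\<in>F. cnj (a (j, l)) * coeff_sin u j l)"
proof -
  have "inner_W0 u (trig_sum F a) = (LINT x|lebesgue_on W0. (\<Sum>p\<in>F. cnj (a p) * (u x * cnj (trig_sin (fst p) (snd p) x))))"
    by (simp add: trig_sum_def case_prod_beta sum_distrib_left mult_ac)
  also have "\<dots> = (\<Sum>p\<in>F. LINT x|lebesgue_on W0. cnj (a p) * (u x * cnj (trig_sin (fst p) (snd p) x)))"
    by (intro Bochner_Integration.integral_sum integrable_mult_right inner_integrable assms trig_L2)
  finally show ?thesis by (simp add: coeff_sin_def case_prod_beta)
qed

lemma coeff_trig_sum:
  assumes "finite F" "\<And>j l. (j, l) \<in> F \<Longrightarrow> l \<ge> 1" "(j, l) \<in> F"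
  shows "coeff_sin (trig_sum F a) j l = a (j, l) / 2"
proof -
  have "coeff_sin (trig_sum F a) j l = (LINT x|lebesgue_on W0. (\<Sum>p\<in>F. a p * (trig_sin (fst p) (snd p) x * cnj (trig_sin j l x))))"
    unfolding coeff_sin_def by (simp only: trig_sum_def case_prod_beta prod.collapse sum_distrib_right mult.assoc)
  also have "\<dots> = (\<Sum>p\<in>F. LINT x|lebesgue_on W0. a p * (trig_sin (fst p) (snd p) x * cnj (trig_sin j l x)))"
    by (intro Bochner_Integration.integral_sum integrable_mult_right inner_integrable trig_L2)
  also have "\<dots> = (\<Sum>p\<in>F. a p * coeff_sin (trig_sin (fst p) (snd p)) j l)"
    by (simp add: coeff_sin_def)
  also have "\<dots> = (\<Sum>p\<in>F. if p = (j, l) then a p / 2 else 0)"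
  proof (rule sum.cong[OF refl])
    fix p assume "p \<in> F"
    then have "snd p \<ge> 1" using assms(2)[of "fst p" "snd p"] by simp
    from coeff_sin_trig_sin[OF this assms(2)[OF assms(3)], of "fst p" j]
    show "a p * coeff_sin (trig_sin (fst p) (snd p)) j l = (if p = (j, l) then a p / 2 else 0)"
      by (cases p) auto
  qed
  also have "\<dots> = a (j, l) / 2" using assms(1,3) by simp
  finally show ?thesis .
qed

text \<open>Parseval for finite sums; the 1/2 is the squared norm of a wave.\<close>

lemma trig_sum_norm:
  assumes "finite F" "\<And>j l. (j, l) \<in> F \<Longrightarrow> l \<ge> 1"
  shows "(L2_norm W0 (trig_sum F a))\<^sup>2 = (\<Sum>p\<in>F. (cmod (a p))\<^sup>2) / 2"
proof -
  have "complex_of_real ((L2_norm W0 (trig_sum F a))\<^sup>2) = (\<Sum>p\<in>F. cnj (a p) * (a p / 2))"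
    unfolding inner_self[symmetric] inner_trig_sum_right[OF assms(1) trig_sum_L2[OF assms(1)]]
    using coeff_trig_sum[OF assms] by (intro sum.cong) auto
  also have "\<dots> = complex_of_real ((\<Sum>p\<in>F. (cmod (a p))\<^sup>2) / 2)"
    by (simp add: sum_divide_distrib complex_norm_square mult.commute flip: of_real_power)
  finally show ?thesis by (simp only: of_real_eq_iff)
qed

text \<open>Division by the symbol is moved to the test sum: its coefficients are divided by
  \<open>cnj (\<sigma> j l)\<close>, and finite Parseval shows that its norm shrinks at least by the
  factor \<Lambda>. No series for \<open>v\<close> or \<open>h\<close> occurs.\<close>

lemma multiplier_bound:
  assumes v: "v \<in> L2 W0" and h: "h \<in> L2 W0" and F: "finite F" "\<And>j l. (j, l) \<in> F \<Longrightarrow> l \<ge> 1"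
    and \<sigma>: "\<And>j l. (j, l) \<in> F \<Longrightarrow> \<sigma> j l * coeff_sin v j l = coeff_sin h j l"
    and \<Lambda>: "\<Lambda> > 0" "\<And>j l. (j, l) \<in> F \<Longrightarrow> \<Lambda> \<le> cmod (\<sigma> j l)"
  shows "cmod (inner_W0 v (trig_sum F a)) \<le> L2_norm W0 h / \<Lambda> * L2_norm W0 (trig_sum F a)"
proof -
  define b where "b = (\<lambda>(j, l). a (j, l) / cnj (\<sigma> j l))"
  have s0: "\<sigma> j l \<noteq> 0" if "(j, l) \<in> F" for j l using \<Lambda>(2)[OF that] \<Lambda>(1) by auto
  have "inner_W0 v (trig_sum F a) = inner_W0 h (trig_sum F b)"
    unfolding inner_trig_sum_right[OF F(1) v] inner_trig_sum_right[OF F(1) h]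
  proof (rule sum.cong[OF refl], clarsimp)
    fix j l assume p: "(j, l) \<in> F"
    show "cnj (a (j, l)) * coeff_sin v j l = cnj (b (j, l)) * coeff_sin h j l"
      unfolding b_def \<sigma>[OF p, symmetric] using s0[OF p] by simp
  qed
  then have 1: "cmod (inner_W0 v (trig_sum F a)) \<le> L2_norm W0 h * L2_norm W0 (trig_sum F b)"
    using inner_bound[OF h trig_sum_L2[OF F(1)]] by simp
  have "(L2_norm W0 (trig_sum F b))\<^sup>2 = (\<Sum>p\<in>F. (cmod (b p))\<^sup>2) / 2" by (rule trig_sum_norm[OF F])
  also have "\<dots> \<le> (\<Sum>p\<in>F. (cmod (a p))\<^sup>2 / \<Lambda>\<^sup>2) / 2"
  proof (intro divide_right_mono sum_mono)
    fix p assume p: "p \<in> F"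
    obtain j l where jl: "p = (j, l)" by (cases p)
    have "cmod (b p) = cmod (a p) / cmod (\<sigma> j l)" by (simp add: b_def jl norm_divide)
    also have "\<dots> \<le> cmod (a p) / \<Lambda>"
      using \<Lambda> p jl by (intro divide_left_mono) (auto intro: mult_pos_pos less_le_trans)
    finally have "(cmod (b p))\<^sup>2 \<le> (cmod (a p) / \<Lambda>)\<^sup>2" by (rule power_mono) simp
    then show "(cmod (b p))\<^sup>2 \<le> (cmod (a p))\<^sup>2 / \<Lambda>\<^sup>2" by (simp add: power_divide)
  qed simp
  also have "\<dots> = (L2_norm W0 (trig_sum F a) / \<Lambda>)\<^sup>2"
  proof -
    have n: "(L2_norm W0 (trig_sum F a))\<^sup>2 = (\<Sum>p\<in>F. (cmod (a p))\<^sup>2) / 2" by (rule trig_sum_norm[OF F])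
    show ?thesis unfolding power_divide n by (simp add: sum_divide_distrib[symmetric] mult.commute)
  qed
  finally have "L2_norm W0 (trig_sum F b) \<le> L2_norm W0 (trig_sum F a) / \<Lambda>"
    by (rule power2_le_imp_le) (use \<Lambda>(1) in simp)
  then have "L2_norm W0 h * L2_norm W0 (trig_sum F b) \<le> L2_norm W0 h * (L2_norm W0 (trig_sum F a) / \<Lambda>)"
    by (intro mult_left_mono) simp_all
  with 1 show ?thesis by simp
qed

text \<open>If \<open>v\<close> were itself a trigonometric sum one would take s = v; density
  supplies an s close to \<open>v\<close>.\<close>

lemma L2_norm_le_dual:
  assumes v: "v \<in> L2 W0" and B: "B \<ge> 0" "\<And>s. s \<in> trig_sums \<Longrightarrow> cmod (inner_W0 v s) \<le> B * L2_norm W0 s"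
  shows "L2_norm W0 v \<le> B"
proof -
  let ?n = "L2_norm W0 v"
  have "?n\<^sup>2 \<le> B * ?n + e" if "e > 0" for e
  proof -
    \<comment> \<open>Chosen so that the error (B + ||v||) d stays below e; the added 1 keeps the
      denominator positive.\<close>
    define d where "d = e / (B + ?n + 1)"
    have p: "0 < B + ?n + 1" using B(1) L2_norm_nonneg[of W0 v] by linarith
    have "d > 0" unfolding d_def using that p by simp
    then obtain s where s: "s \<in> trig_sums" "L2_norm W0 (\<lambda>x. v x - s x) < d"
      using trig_sums_dense[OF v] unfolding L2_approximable_def by blast
    have sL: "s \<in> L2 W0" using s(1) trig_sums.sub by auto
    have "L2_norm W0 s \<le> ?n + d"
      using L2_norm_triangle_sub[OF sL v] s(2) L2_norm_minus_commute[of W0 s v] by linarith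
    then have 1: "cmod (inner_W0 v s) \<le> B * (?n + d)"
      using B(2)[OF s(1)] mult_left_mono[OF _ B(1)] by (meson order_trans)
    have 2: "cmod (inner_W0 v (\<lambda>x. v x - s x)) \<le> ?n * d"
      by (rule order_trans[OF inner_bound[OF v L2_diff[OF v sL]]]) (use s(2) in \<open>auto intro!: mult_left_mono\<close>)
    have "complex_of_real (?n\<^sup>2) = inner_W0 v s + inner_W0 v (\<lambda>x. v x - s x)"
      unfolding inner_self[symmetric]
      by (subst Bochner_Integration.integral_add[symmetric, OF inner_integrable[OF v sL] inner_integrable[OF v L2_diff[OF v sL]]])
        (simp add: algebra_simps)
    then have "cmod (complex_of_real (?n\<^sup>2)) \<le> cmod (inner_W0 v s) + cmod (inner_W0 v (\<lambda>x. v x - s x))"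
      by (simp only: norm_triangle_ineq)
    then have "?n\<^sup>2 \<le> cmod (inner_W0 v s) + cmod (inner_W0 v (\<lambda>x. v x - s x))"
      unfolding norm_of_real by (simp only: abs_power2)
    also have "\<dots> \<le> B * (?n + d) + ?n * d" using 1 2 by linarith
    also have "\<dots> = B * ?n + (B + ?n) * d" by (simp add: algebra_simps)
    also have "(B + ?n) * d \<le> e"
    proof -
      have "(B + ?n) * d \<le> (B + ?n + 1) * d" using \<open>d > 0\<close> by (intro mult_right_mono) auto
      also have "\<dots> = e" unfolding d_def using p by simp
      finally show ?thesis .
    qed
    finally show ?thesis by simp
  qed
  then have "?n\<^sup>2 \<le> B * ?n" by (rule field_le_epsilon)
  then have "?n * ?n \<le> B * ?n" by (simp add: power2_eq_square)
  then show ?thesis using B(1) L2_norm_nonneg[of W0 v]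
    by (cases "?n = 0") (auto simp: mult_le_cancel_right)
qed

subsection \<open>Solutions\<close>

locale helmholtz =
  fixes k M :: real and q :: "real \<times> real \<Rightarrow> real"
  assumes q_measurable: "q \<in> borel_measurable (lebesgue_on W0)"
    and q_bound: "AE x in lebesgue_on W0. \<bar>q x\<bar> \<le> M" and M_nonneg: "0 \<le> M"
begin

definition Q where "Q = k\<^sup>2 * M"

definition potential :: "(real \<times> real \<Rightarrow> complex) \<Rightarrow> real \<times> real \<Rightarrow> complex" where
  "potential v x = complex_of_real (k\<^sup>2 * q x) * v x"

text \<open>The variational equation split into inner products, with an arbitrary right-hand side,
  so that multiples, differences and limits of solutions stay within one notion.\<close>

definition sol :: "complex \<Rightarrow> (real \<times> real \<Rightarrow> complex) \<Rightarrow> (real \<times> real \<Rightarrow> complex) \<Rightarrow> bool" where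
  "sol \<alpha> f v \<longleftrightarrow> v \<in> Vqp 1 \<and> (\<forall>\<phi>\<in>Vqp 1.
     inner_W0 (wd1 v) (wd1 \<phi>) + inner_W0 (wd2 v) (wd2 \<phi>) - 2 * \<i> * \<alpha> * inner_W0 (wd1 v) \<phi>
       - inner_W0 (potential v) \<phi> + \<alpha>\<^sup>2 * inner_W0 v \<phi> = - inner_W0 f \<phi>)"

lemma Q_nonneg: "0 \<le> Q"
  by (simp add: Q_def M_nonneg)

lemma potential_L2:
  assumes "v \<in> L2 W0"
  shows "potential v \<in> L2 W0" "L2_norm W0 (potential v) \<le> Q * L2_norm W0 v"
proof -
  have m: "(\<lambda>x. complex_of_real (k\<^sup>2 * q x)) \<in> borel_measurable (lebesgue_on W0)"
    using q_measurable by measurable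
  have b: "AE x in lebesgue_on W0. cmod (complex_of_real (k\<^sup>2 * q x)) \<le> Q"
    using q_bound
  proof eventually_elim
    case (elim x)
    then show ?case unfolding Q_def norm_of_real abs_mult by (simp add: mult_left_mono)
  qed
  show "potential v \<in> L2 W0" "L2_norm W0 (potential v) \<le> Q * L2_norm W0 v"
    unfolding potential_def[abs_def] using L2_bounded_mult[OF assms m Q_nonneg b] by simp_all
qed

lemma variational_form:
  assumes "v \<in> H1 W0" "\<phi> \<in> H1 W0"
  shows "(LINT x|lebesgue_on W0.
          (\<Sum>e\<in>Basis. weak_deriv W0 e v x * cnj (weak_deriv W0 e \<phi> x))
          - 2 * \<i> * \<alpha> * weak_deriv W0 (1, 0) v x * cnj (\<phi> x)
          - (complex_of_real (k\<^sup>2 * q x) - \<alpha>\<^sup>2) * v x * cnj (\<phi> x))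
    = inner_W0 (wd1 v) (wd1 \<phi>) + inner_W0 (wd2 v) (wd2 \<phi>) - 2 * \<i> * \<alpha> * inner_W0 (wd1 v) \<phi>
       - inner_W0 (potential v) \<phi> + \<alpha>\<^sup>2 * inner_W0 v \<phi>"
proof -
  note L = H1_L2[OF assms(1)] H1_L2[OF assms(2)] H1_wd[OF assms(1)] H1_wd[OF assms(2)]
  note i = inner_integrable[OF L(3) L(5)] inner_integrable[OF L(4) L(6)] inner_integrable[OF L(3) L(2)]
    inner_integrable[OF potential_L2(1)[OF L(1)] L(2)] inner_integrable[OF L(1) L(2)]
  have "(LINT x|lebesgue_on W0.
          (\<Sum>e\<in>Basis. weak_deriv W0 e v x * cnj (weak_deriv W0 e \<phi> x))
          - 2 * \<i> * \<alpha> * weak_deriv W0 (1, 0) v x * cnj (\<phi> x)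
          - (complex_of_real (k\<^sup>2 * q x) - \<alpha>\<^sup>2) * v x * cnj (\<phi> x))
     = (LINT x|lebesgue_on W0. wd1 v x * cnj (wd1 \<phi> x) + wd2 v x * cnj (wd2 \<phi> x)
         - (2 * \<i> * \<alpha>) * (wd1 v x * cnj (\<phi> x)) - potential v x * cnj (\<phi> x) + \<alpha>\<^sup>2 * (v x * cnj (\<phi> x)))"
    by (rule arg_cong[of _ _ "integral\<^sup>L (lebesgue_on W0)"])
      (simp add: Basis_plane potential_def fun_eq_iff algebra_simps)
  also have "\<dots> = inner_W0 (wd1 v) (wd1 \<phi>) + inner_W0 (wd2 v) (wd2 \<phi>) - 2 * \<i> * \<alpha> * inner_W0 (wd1 v) \<phi>
       - inner_W0 (potential v) \<phi> + \<alpha>\<^sup>2 * inner_W0 v \<phi>"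
    using i by simp
  finally show ?thesis .
qed

lemma variational_solution_iff_sol:
  "variational_solution k q g \<alpha> v \<longleftrightarrow> sol \<alpha> (\<lambda>x. exp (- \<i> * \<alpha> * complex_of_real (fst x)) * g x) v"
proof (cases "v \<in> Vqp 1")
  case True
  then show ?thesis
    unfolding variational_solution_def sol_def
    by (simp only: variational_form[OF Vqp_H1[OF True] Vqp_H1] cong: ball_cong)
qed (simp add: variational_solution_def sol_def)

lemma solD:
  assumes "sol \<alpha> f v"
  shows sol_Vqp: "v \<in> Vqp 1" and sol_H1: "v \<in> H1 W0" and sol_L2: "v \<in> L2 W0"
    and sol_eq: "\<phi> \<in> Vqp 1 \<Longrightarrow>
     inner_W0 (wd1 v) (wd1 \<phi>) + inner_W0 (wd2 v) (wd2 \<phi>) - 2 * \<i> * \<alpha> * inner_W0 (wd1 v) \<phi>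
       - inner_W0 (potential v) \<phi> + \<alpha>\<^sup>2 * inner_W0 v \<phi> = - inner_W0 f \<phi>"
  using assms Vqp_H1 H1_L2 by (auto simp: sol_def)

lemma sol_cmult:
  assumes "sol \<alpha> f v" shows "sol \<alpha> (\<lambda>x. c * f x) (\<lambda>x. c * v x)"
  unfolding sol_def
proof (intro conjI ballI)
  show "(\<lambda>x. c * v x) \<in> Vqp 1" by (rule Vqp_cmult[OF sol_Vqp[OF assms]])
  fix \<phi> assume \<phi>: "\<phi> \<in> Vqp 1"
  have \<phi>H: "\<phi> \<in> H1 W0" by (rule Vqp_H1[OF \<phi>])
  have w: "inner_W0 (weak_deriv W0 e (\<lambda>x. c * v x)) w = c * inner_W0 (weak_deriv W0 e v) w"
    if "e \<in> Basis" "w \<in> L2 W0" for e w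
    unfolding inner_cmult[symmetric]
    by (intro inner_cong_AE weak_deriv_cmult_AE H1_weak_deriv_L2 H1_cmult L2_cmult sol_H1[OF assms] that)
  have "c * (inner_W0 (wd1 v) (wd1 \<phi>) + inner_W0 (wd2 v) (wd2 \<phi>) - 2 * \<i> * \<alpha> * inner_W0 (wd1 v) \<phi>
       - inner_W0 (potential v) \<phi> + \<alpha>\<^sup>2 * inner_W0 v \<phi>) = c * (- inner_W0 f \<phi>)"
    unfolding sol_eq[OF assms \<phi>] ..
  moreover have "potential (\<lambda>x. c * v x) = (\<lambda>x. c * potential v x)" by (simp add: potential_def fun_eq_iff)
  ultimately show "inner_W0 (wd1 (\<lambda>x. c * v x)) (wd1 \<phi>) + inner_W0 (wd2 (\<lambda>x. c * v x)) (wd2 \<phi>)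
     - 2 * \<i> * \<alpha> * inner_W0 (wd1 (\<lambda>x. c * v x)) \<phi>
       - inner_W0 (potential (\<lambda>x. c * v x)) \<phi> + \<alpha>\<^sup>2 * inner_W0 (\<lambda>x. c * v x) \<phi> = - inner_W0 (\<lambda>x. c * f x) \<phi>"
    unfolding w[OF Basis_plane_mem(1) H1_wd(1)[OF \<phi>H]] w[OF Basis_plane_mem(2) H1_wd(2)[OF \<phi>H]]
      w[OF Basis_plane_mem(1) H1_L2[OF \<phi>H]]
    by (simp only: inner_cmult) (simp add: algebra_simps)
qed

text \<open>Solutions for different exponents are compared by moving the difference of the forms to the right-hand side.\<close>

lemma sol_diff:
  assumes v: "sol \<alpha> f v" and u: "sol \<beta> g u" and f: "f \<in> L2 W0" and g: "g \<in> L2 W0"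
  shows "sol \<alpha> (\<lambda>x. (f x - g x) - (2 * \<i> * (\<alpha> - \<beta>) * wd1 u x - (\<alpha>\<^sup>2 - \<beta>\<^sup>2) * u x)) (\<lambda>x. v x - u x)"
  unfolding sol_def
proof (intro conjI ballI)
  note vH = sol_H1[OF v] and uH = sol_H1[OF u]
  note L = H1_L2[OF vH] H1_L2[OF uH] H1_wd[OF vH] H1_wd[OF uH]
  show "(\<lambda>x. v x - u x) \<in> Vqp 1" by (rule Vqp_diff[OF sol_Vqp[OF v] sol_Vqp[OF u]])
  fix \<phi> assume \<phi>: "\<phi> \<in> Vqp 1"
  have \<phi>H: "\<phi> \<in> H1 W0" by (rule Vqp_H1[OF \<phi>])
  note \<phi>L = H1_L2[OF \<phi>H] H1_wd[OF \<phi>H]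
  have w: "inner_W0 (weak_deriv W0 e (\<lambda>x. v x - u x)) y = inner_W0 (weak_deriv W0 e v) y - inner_W0 (weak_deriv W0 e u) y"
    if e: "e \<in> Basis" and y: "y \<in> L2 W0" for e y
  proof -
    note D = H1_weak_deriv_L2[OF vH e] H1_weak_deriv_L2[OF uH e]
    show ?thesis
      unfolding inner_diff[OF D y, symmetric]
      by (rule inner_cong_AE[OF weak_deriv_diff_AE[OF vH uH e] H1_weak_deriv_L2[OF H1_diff[OF vH uH] e] L2_diff[OF D] y])
  qed
  have p: "potential (\<lambda>x. v x - u x) = (\<lambda>x. potential v x - potential u x)"
    by (simp add: potential_def fun_eq_iff algebra_simps)
  have R: "inner_W0 (\<lambda>x. (f x - g x) - (2 * \<i> * (\<alpha> - \<beta>) * wd1 u x - (\<alpha>\<^sup>2 - \<beta>\<^sup>2) * u x)) \<phi>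
      = (inner_W0 f \<phi> - inner_W0 g \<phi>) - (2 * \<i> * (\<alpha> - \<beta>) * inner_W0 (wd1 u) \<phi> - (\<alpha>\<^sup>2 - \<beta>\<^sup>2) * inner_W0 u \<phi>)"
    using inner_diff[OF L2_diff[OF f g] L2_diff[OF L2_cmult[OF L(5), of "2 * \<i> * (\<alpha> - \<beta>)"] L2_cmult[OF L(2), of "\<alpha>\<^sup>2 - \<beta>\<^sup>2"]] \<phi>L(1)]
      inner_diff[OF f g \<phi>L(1)] inner_diff[OF L2_cmult[OF L(5), of "2 * \<i> * (\<alpha> - \<beta>)"] L2_cmult[OF L(2), of "\<alpha>\<^sup>2 - \<beta>\<^sup>2"] \<phi>L(1)]
    by (simp only: inner_cmult)
  have alg: "a1 - b1 + (a2 - b2) - 2 * \<i> * \<alpha> * (a3 - b3) - (a4 - b4) + \<alpha>\<^sup>2 * (a5 - b5)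
      = - ((F - G) - (2 * \<i> * (\<alpha> - \<beta>) * b3 - (\<alpha>\<^sup>2 - \<beta>\<^sup>2) * b5))"
    if "a1 + a2 - 2 * \<i> * \<alpha> * a3 - a4 + \<alpha>\<^sup>2 * a5 = - F" "b1 + b2 - 2 * \<i> * \<beta> * b3 - b4 + \<beta>\<^sup>2 * b5 = - G"
    for a1 a2 a3 a4 a5 b1 b2 b3 b4 b5 F G :: complex
  proof -
    have FG: "F = - (a1 + a2 - 2 * \<i> * \<alpha> * a3 - a4 + \<alpha>\<^sup>2 * a5)" "G = - (b1 + b2 - 2 * \<i> * \<beta> * b3 - b4 + \<beta>\<^sup>2 * b5)"
      unfolding that by simp_all
    show ?thesis unfolding FG by (simp add: algebra_simps)
  qed
  show "inner_W0 (wd1 (\<lambda>x. v x - u x)) (wd1 \<phi>) + inner_W0 (wd2 (\<lambda>x. v x - u x)) (wd2 \<phi>)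
     - 2 * \<i> * \<alpha> * inner_W0 (wd1 (\<lambda>x. v x - u x)) \<phi>
       - inner_W0 (potential (\<lambda>x. v x - u x)) \<phi> + \<alpha>\<^sup>2 * inner_W0 (\<lambda>x. v x - u x) \<phi>
       = - inner_W0 (\<lambda>x. (f x - g x) - (2 * \<i> * (\<alpha> - \<beta>) * wd1 u x - (\<alpha>\<^sup>2 - \<beta>\<^sup>2) * u x)) \<phi>"
    unfolding w[OF Basis_plane_mem(1) \<phi>L(2)] w[OF Basis_plane_mem(2) \<phi>L(3)] w[OF Basis_plane_mem(1) \<phi>L(1)] p R
      inner_diff[OF potential_L2(1)[OF L(1)] potential_L2(1)[OF L(2)] \<phi>L(1)] inner_diff[OF L(1,2) \<phi>L(1)]
    by (rule alg[OF sol_eq[OF v \<phi>] sol_eq[OF u \<phi>]])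
qed

text \<open>For fixed \<phi> every term of the equation is a continuous pairing, and
  \<open>Vqp 1\<close> is closed in H1, so the limit inherits the equation and the boundary
  conditions.\<close>

lemma sol_limit:
  assumes sol: "\<And>n. sol (\<alpha> n) (f n) (v n)" and f: "\<And>n. f n \<in> L2 W0"
    and lim: "\<alpha> \<longlonglongrightarrow> \<alpha>'" "(\<lambda>n. L2_norm W0 (f n)) \<longlonglongrightarrow> 0" "(\<lambda>n. H1_norm W0 (\<lambda>x. v n x - v' x)) \<longlonglongrightarrow> 0"
    and v': "v' \<in> H1 W0"
  shows "sol \<alpha>' (\<lambda>_. 0) v'"
  unfolding sol_def
proof (intro conjI ballI)
  note vH = sol_H1[OF sol]
  show "v' \<in> Vqp 1" by (rule Vqp_closed[OF sol_Vqp[OF sol] v' lim(3)])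
  fix \<phi> assume \<phi>: "\<phi> \<in> Vqp 1"
  have \<phi>H: "\<phi> \<in> H1 W0" by (rule Vqp_H1[OF \<phi>])
  note \<phi>L = H1_L2[OF \<phi>H] H1_wd[OF \<phi>H]
  note tv = H1_tendsto_L2(1)[OF vH v' lim(3)] and td = H1_tendsto_L2(2)[OF vH v' lim(3)]
  have tp: "(\<lambda>n. L2_norm W0 (\<lambda>x. potential (v n) x - potential v' x)) \<longlonglongrightarrow> 0"
  proof (rule tendsto_sandwich[OF _ _ tendsto_const tendsto_mult_right_zero[OF tv, of Q]])
    have "potential (\<lambda>x. v n x - v' x) = (\<lambda>x. potential (v n) x - potential v' x)" for n
      by (simp add: potential_def fun_eq_iff algebra_simps)
    then show "\<forall>\<^sub>F n in sequentially. L2_norm W0 (\<lambda>x. potential (v n) x - potential v' x) \<le> Q * L2_norm W0 (\<lambda>x. v n x - v' x)"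
      using potential_L2(2)[OF L2_diff[OF H1_L2[OF vH] H1_L2[OF v']]] by simp
  qed simp
  have "(\<lambda>n. inner_W0 (wd1 (v n)) (wd1 \<phi>) + inner_W0 (wd2 (v n)) (wd2 \<phi>) - 2 * \<i> * \<alpha> n * inner_W0 (wd1 (v n)) \<phi>
       - inner_W0 (potential (v n)) \<phi> + (\<alpha> n)\<^sup>2 * inner_W0 (v n) \<phi>)
    \<longlonglongrightarrow> inner_W0 (wd1 v') (wd1 \<phi>) + inner_W0 (wd2 v') (wd2 \<phi>) - 2 * \<i> * \<alpha>' * inner_W0 (wd1 v') \<phi>
       - inner_W0 (potential v') \<phi> + \<alpha>'\<^sup>2 * inner_W0 v' \<phi>"
    by (intro tendsto_add tendsto_diff tendsto_mult tendsto_power tendsto_const lim(1) inner_tendsto \<phi>L tv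
        td Basis_plane_mem tp H1_wd[OF vH] H1_wd[OF v'] H1_L2[OF vH] H1_L2[OF v'] potential_L2)
  moreover have "(\<lambda>n. - inner_W0 (f n) \<phi>) \<longlonglongrightarrow> 0"
  proof (rule Lim_null_comparison)
    show "\<forall>\<^sub>F n in sequentially. norm (- inner_W0 (f n) \<phi>) \<le> L2_norm W0 (f n) * L2_norm W0 \<phi>"
      using inner_bound[OF f \<phi>L(1)] by simp
    show "(\<lambda>n. L2_norm W0 (f n) * L2_norm W0 \<phi>) \<longlonglongrightarrow> 0" by (rule tendsto_mult_left_zero[OF lim(2)])
  qed
  ultimately have "inner_W0 (wd1 v') (wd1 \<phi>) + inner_W0 (wd2 v') (wd2 \<phi>) - 2 * \<i> * \<alpha>' * inner_W0 (wd1 v') \<phi>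
       - inner_W0 (potential v') \<phi> + \<alpha>'\<^sup>2 * inner_W0 v' \<phi> = 0"
    unfolding sol_eq[OF sol \<phi>] by (rule LIMSEQ_unique)
  then show "inner_W0 (wd1 v') (wd1 \<phi>) + inner_W0 (wd2 v') (wd2 \<phi>) - 2 * \<i> * \<alpha>' * inner_W0 (wd1 v') \<phi>
       - inner_W0 (potential v') \<phi> + \<alpha>'\<^sup>2 * inner_W0 v' \<phi> = - inner_W0 (\<lambda>_. 0) \<phi>" by simp
qed

subsection \<open>The symbol and a priori estimates\<close>

text \<open>The factor by which - (d/dx1 + i \<alpha>)^2 - d^2/dx2^2 multiplies the wave with
  indices j and l; the potential is not part of it.\<close>

definition symbol :: "complex \<Rightarrow> int \<Rightarrow> nat \<Rightarrow> complex" where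
  "symbol \<alpha> j l = (complex_of_real (2 * pi * j) + \<alpha>)\<^sup>2 + (complex_of_real (pi * l))\<^sup>2"

text \<open>The equation tested with one wave. The potential couples the modes and is therefore
  counted among the data.\<close>

lemma sol_coeff:
  assumes sol: "sol \<alpha> f v" and f: "f \<in> L2 W0"
  shows "symbol \<alpha> j l * coeff_sin v j l = coeff_sin (\<lambda>x. potential v x - f x) j l"
proof -
  let ?\<phi> = "trig_sin j l" and ?c = "coeff_sin v j l"
  note vH = sol_H1[OF sol]
  have 1: "inner_W0 (wd1 v) ?\<phi> = 2 * pi * j * \<i> * ?c"
    using coeff_weak_deriv(1)[OF sol_Vqp[OF sol], of j l] by (simp only: coeff_sin_def)
  \<comment> \<open>Conjugating the derivative of the wave changes the sign of 2 pi i j.\<close>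
  have "inner_W0 (wd1 v) (wd1 ?\<phi>) = (LINT x|lebesgue_on W0. wd1 v x * (- (2 * pi * j * \<i>) * cnj (?\<phi> x)))"
    by (simp add: inner_weak_deriv_smooth[OF smooth_trig(1) Basis_plane_mem(1) H1_wd(1)[OF vH]] frechet_derivative_trig)
  also have "\<dots> = - (2 * pi * j * \<i>) * (2 * pi * j * \<i> * ?c)"
    unfolding LINT_mult_scalar 1 ..
  finally have 2: "inner_W0 (wd1 v) (wd1 ?\<phi>) = - (2 * pi * j * \<i>) * (2 * pi * j * \<i> * ?c)" .
  have cc: "cnj (trig_cos j l x) = trig_cos (- j) l x" for x by (simp add: trig_cos_eq exp_cnj)
  have "inner_W0 (wd2 v) (wd2 ?\<phi>) = (LINT x|lebesgue_on W0. wd2 v x * ((pi * l) * trig_cos (- j) l x))"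
    by (simp add: inner_weak_deriv_smooth[OF smooth_trig(1) Basis_plane_mem(2) H1_wd(2)[OF vH]] frechet_derivative_trig cc)
  also have "\<dots> = (pi * l) * (pi * l * ?c)"
    unfolding LINT_mult_scalar coeff_weak_deriv(2)[OF sol_Vqp[OF sol]] by simp
  finally have 3: "inner_W0 (wd2 v) (wd2 ?\<phi>) = (pi * l) * (pi * l * ?c)" .
  have 4: "coeff_sin (\<lambda>x. potential v x - f x) j l = inner_W0 (potential v) ?\<phi> - inner_W0 f ?\<phi>"
    unfolding coeff_sin_def by (rule inner_diff[OF potential_L2(1)[OF H1_L2[OF vH]] f trig_L2(1)])
  have "- (2 * pi * j * \<i>) * (2 * pi * j * \<i> * ?c) + (pi * l) * (pi * l * ?c) - 2 * \<i> * \<alpha> * (2 * pi * j * \<i> * ?c)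
      - inner_W0 (potential v) ?\<phi> + \<alpha>\<^sup>2 * ?c = - inner_W0 f ?\<phi>"
    using sol_eq[OF sol trig_sin_Vqp, of j l] unfolding 1 2 3 by (simp only: coeff_sin_def)
  then have "- (2 * pi * j * \<i>) * (2 * pi * j * \<i> * ?c) + (pi * l) * (pi * l * ?c) - 2 * \<i> * \<alpha> * (2 * pi * j * \<i> * ?c)
      + \<alpha>\<^sup>2 * ?c = inner_W0 (potential v) ?\<phi> - inner_W0 f ?\<phi>"
    by (simp add: algebra_simps)
  moreover have "- (J * \<i>) * (J * \<i> * c) + L * (L * c) - 2 * \<i> * \<alpha> * (J * \<i> * c) + \<alpha>\<^sup>2 * c = ((J + \<alpha>)\<^sup>2 + L\<^sup>2) * c" for J L c :: complex
    by (simp add: power2_eq_square algebra_simps)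
  ultimately show ?thesis unfolding 4 symbol_def by (simp only:)
qed

lemma sol_rhs:
  assumes "v \<in> L2 W0" "f \<in> L2 W0"
  shows "(\<lambda>x. potential v x - f x) \<in> L2 W0" "L2_norm W0 (\<lambda>x. potential v x - f x) \<le> Q * L2_norm W0 v + L2_norm W0 f"
  using potential_L2[OF assms(1)] L2_norm_triangle_diff[OF potential_L2(1)[OF assms(1)] assms(2)]
  by (auto intro: L2_diff assms)

text \<open>The symbol has to be large only on \<open>F\<close>. With all modes this gives the
  resolvent bound; with the modes outside a finite block it gives the tail estimate of the
  compactness argument.\<close>

lemma sol_high_modes:
  assumes sol: "sol \<alpha> f v" and f: "f \<in> L2 W0" and F: "finite F" "\<And>j l. (j, l) \<in> F \<Longrightarrow> l \<ge> 1"
    and \<Lambda>: "\<Lambda> > 0" "\<And>j l. (j, l) \<in> F \<Longrightarrow> \<Lambda> \<le> cmod (symbol \<alpha> j l)"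
  shows "cmod (inner_W0 v (trig_sum F a)) \<le> (Q * L2_norm W0 v + L2_norm W0 f) / \<Lambda> * L2_norm W0 (trig_sum F a)"
proof -
  note vL = sol_L2[OF sol]
  have "cmod (inner_W0 v (trig_sum F a)) \<le> L2_norm W0 (\<lambda>x. potential v x - f x) / \<Lambda> * L2_norm W0 (trig_sum F a)"
    by (rule multiplier_bound[OF vL sol_rhs(1)[OF vL f] F sol_coeff[OF sol f] \<Lambda>])
  also have "\<dots> \<le> (Q * L2_norm W0 v + L2_norm W0 f) / \<Lambda> * L2_norm W0 (trig_sum F a)"
    using sol_rhs(2)[OF vL f] \<Lambda>(1) by (intro mult_right_mono divide_right_mono) auto
  finally show ?thesis .
qed

text \<open>The norm of \<open>v\<close> also appears on the right, where it can be absorbed as soon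
  as Q is small against \<Lambda>.\<close>

lemma sol_resolvent_bound:
  assumes sol: "sol \<alpha> f v" and f: "f \<in> L2 W0"
    and \<Lambda>: "\<Lambda> > 0" "\<And>j l. l \<ge> 1 \<Longrightarrow> \<Lambda> \<le> cmod (symbol \<alpha> j l)"
  shows "L2_norm W0 v \<le> (Q * L2_norm W0 v + L2_norm W0 f) / \<Lambda>"
proof (rule L2_norm_le_dual[OF sol_L2[OF sol]])
  show "0 \<le> (Q * L2_norm W0 v + L2_norm W0 f) / \<Lambda>" using Q_nonneg \<Lambda>(1) by simp
  fix s assume s: "s \<in> trig_sums"
  obtain F a where F: "finite F" "\<And>j l. (j, l) \<in> F \<Longrightarrow> l \<ge> 1" "s = trig_sum F a"
    by (rule trig_sums_cases[OF s], rule that)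
  show "cmod (inner_W0 v s) \<le> (Q * L2_norm W0 v + L2_norm W0 f) / \<Lambda> * L2_norm W0 s"
    unfolding F(3) by (rule sol_high_modes[OF sol f F(1,2) \<Lambda>(1) \<Lambda>(2)[OF F(2)]])
qed

text \<open>The equation tested with \<open>v\<close> itself. Young's inequality splits the
  first-order term, and half of the squared derivative is moved back to the left.\<close>

lemma sol_energy:
  assumes sol: "sol \<alpha> f v" and f: "f \<in> L2 W0"
  shows "H1_norm W0 v \<le> (3 * cmod \<alpha> + Q + 2) * L2_norm W0 v + L2_norm W0 f"
proof -
  note vH = sol_H1[OF sol] and vL = sol_L2[OF sol]
  let ?v = "L2_norm W0 v" and ?d = "L2_norm W0 (wd1 v)" and ?e = "L2_norm W0 (wd2 v)" and ?f = "L2_norm W0 f"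
  have "complex_of_real (?d\<^sup>2 + ?e\<^sup>2) = 2 * \<i> * \<alpha> * inner_W0 (wd1 v) v + inner_W0 (potential v) v - \<alpha>\<^sup>2 * inner_W0 v v - inner_W0 f v"
    using sol_eq[OF sol sol_Vqp[OF sol]] unfolding inner_self[of "wd1 v"] inner_self[of "wd2 v"]
    by (simp add: algebra_simps)
  from arg_cong[OF this, of cmod]
  have "?d\<^sup>2 + ?e\<^sup>2 = cmod (2 * \<i> * \<alpha> * inner_W0 (wd1 v) v + inner_W0 (potential v) v - \<alpha>\<^sup>2 * inner_W0 v v - inner_W0 f v)"
    unfolding norm_of_real by (simp only: abs_of_nonneg[OF add_nonneg_nonneg[OF zero_le_power2 zero_le_power2]])
  also have "\<dots> \<le> cmod (2 * \<i> * \<alpha> * inner_W0 (wd1 v) v) + cmod (inner_W0 (potential v) v) + cmod (\<alpha>\<^sup>2 * inner_W0 v v) + cmod (inner_W0 f v)"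
    by (intro order_trans[OF norm_triangle_ineq4] add_mono order_trans[OF norm_triangle_ineq] order_refl)
  also have "\<dots> \<le> 2 * cmod \<alpha> * (?d * ?v) + Q * ?v * ?v + (cmod \<alpha>)\<^sup>2 * (?v * ?v) + ?f * ?v"
  proof (intro add_mono)
    show "cmod (2 * \<i> * \<alpha> * inner_W0 (wd1 v) v) \<le> 2 * cmod \<alpha> * (?d * ?v)"
      using inner_bound[OF H1_wd(1)[OF vH] vL] by (simp add: norm_mult mult_left_mono)
    show "cmod (inner_W0 (potential v) v) \<le> Q * ?v * ?v"
      using inner_bound[OF potential_L2(1)[OF vL] vL] mult_right_mono[OF potential_L2(2)[OF vL], of ?v] by simp
    show "cmod (\<alpha>\<^sup>2 * inner_W0 v v) \<le> (cmod \<alpha>)\<^sup>2 * (?v * ?v)"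
      using inner_bound[OF vL vL] by (simp add: norm_mult norm_power mult_left_mono)
    show "cmod (inner_W0 f v) \<le> ?f * ?v" by (rule inner_bound[OF f vL])
  qed
  finally have 1: "?d\<^sup>2 + ?e\<^sup>2 \<le> 2 * cmod \<alpha> * (?d * ?v) + Q * ?v\<^sup>2 + (cmod \<alpha>)\<^sup>2 * ?v\<^sup>2 + ?f * ?v"
    by (simp only: power2_eq_square mult.assoc)
  have 2: "2 * cmod \<alpha> * (?d * ?v) \<le> ?d\<^sup>2 / 2 + 2 * ((cmod \<alpha>)\<^sup>2 * ?v\<^sup>2)"
    using zero_le_power2[of "?d - 2 * cmod \<alpha> * ?v"] by (simp add: power2_eq_square algebra_simps)
  have 3: "?f * ?v \<le> ?f\<^sup>2 / 2 + ?v\<^sup>2 / 2"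
    using zero_le_power2[of "?f - ?v"] by (simp add: power2_eq_square algebra_simps)
  have "(H1_norm W0 v)\<^sup>2 \<le> (6 * (cmod \<alpha>)\<^sup>2 + 2 * Q + 2) * ?v\<^sup>2 + ?f\<^sup>2"
  proof -
    have "(6 * (cmod \<alpha>)\<^sup>2 + 2 * Q + 2) * ?v\<^sup>2 = 6 * ((cmod \<alpha>)\<^sup>2 * ?v\<^sup>2) + 2 * (Q * ?v\<^sup>2) + 2 * ?v\<^sup>2"
      by (simp add: algebra_simps)
    then show ?thesis using 1 2 3 zero_le_power2[of ?e] unfolding H1_norm_square by linarith
  qed
  \<comment> \<open>Completed to a square, so that the final bound is linear in both norms.\<close>
  also have "\<dots> \<le> (3 * cmod \<alpha> + Q + 2)\<^sup>2 * ?v\<^sup>2 + ?f\<^sup>2 + 2 * (((3 * cmod \<alpha> + Q + 2) * ?v) * ?f)"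
  proof -
    have A: "6 * (cmod \<alpha>)\<^sup>2 + 2 * Q + 2 \<le> (3 * cmod \<alpha> + Q + 2)\<^sup>2"
    proof -
      have "(3 * cmod \<alpha> + Q + 2)\<^sup>2 - (6 * (cmod \<alpha>)\<^sup>2 + 2 * Q + 2) = 3 * (cmod \<alpha>)\<^sup>2 + Q\<^sup>2 + 2 * Q + 2 + 6 * (cmod \<alpha> * Q) + 12 * cmod \<alpha>"
        by (simp add: power2_eq_square algebra_simps)
      also have "\<dots> \<ge> 0" using Q_nonneg by simp
      finally show ?thesis by simp
    qed
    have "0 \<le> ((3 * cmod \<alpha> + Q + 2) * ?v) * ?f" using Q_nonneg by simp
    moreover have "(6 * (cmod \<alpha>)\<^sup>2 + 2 * Q + 2) * ?v\<^sup>2 \<le> (3 * cmod \<alpha> + Q + 2)\<^sup>2 * ?v\<^sup>2"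
      by (rule mult_right_mono[OF A]) simp
    ultimately show ?thesis by linarith
  qed
  also have "\<dots> = ((3 * cmod \<alpha> + Q + 2) * ?v + ?f)\<^sup>2"
    by (simp add: power2_sum power_mult_distrib)
  finally show ?thesis by (rule power2_le_imp_le) (use Q_nonneg in simp)
qed

text \<open>The change of exponent acts as data of size |\<alpha> - \<beta>| times the H1 norm of
  \<open>u\<close>, because \<alpha>^2 - \<beta>^2 contains the factor \<alpha> - \<beta>.\<close>

lemma sol_diff_energy:
  assumes v: "sol \<alpha> f v" and u: "sol \<beta> g u" and f: "f \<in> L2 W0" and g: "g \<in> L2 W0"
  shows "H1_norm W0 (\<lambda>x. v x - u x) \<le> (3 * cmod \<alpha> + Q + 2) * L2_norm W0 (\<lambda>x. v x - u x)
    + (L2_norm W0 f + L2_norm W0 g + cmod (\<alpha> - \<beta>) * (2 + cmod \<alpha> + cmod \<beta>) * H1_norm W0 u)"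
proof -
  note uH = sol_H1[OF u]
  note L = H1_L2[OF uH] H1_wd(1)[OF uH]
  let ?a = "\<lambda>x. 2 * \<i> * (\<alpha> - \<beta>) * wd1 u x" and ?b = "\<lambda>x. (\<alpha>\<^sup>2 - \<beta>\<^sup>2) * u x"
  have aL: "?a \<in> L2 W0" and bL: "?b \<in> L2 W0" by (rule L2_cmult[OF L(2)], rule L2_cmult[OF L(1)])
  have F: "(\<lambda>x. (f x - g x) - (?a x - ?b x)) \<in> L2 W0"
    by (rule L2_diff[OF L2_diff[OF f g] L2_diff[OF aL bL]])
  have "L2_norm W0 (\<lambda>x. (f x - g x) - (?a x - ?b x)) \<le> (L2_norm W0 f + L2_norm W0 g) + (L2_norm W0 ?a + L2_norm W0 ?b)"
    using L2_norm_triangle_diff[OF L2_diff[OF f g] L2_diff[OF aL bL]] L2_norm_triangle_diff[OF f g] L2_norm_triangle_diff[OF aL bL]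
    by linarith
  moreover have "L2_norm W0 ?a + L2_norm W0 ?b \<le> cmod (\<alpha> - \<beta>) * (2 + cmod \<alpha> + cmod \<beta>) * H1_norm W0 u"
  proof -
    have "L2_norm W0 ?a \<le> 2 * cmod (\<alpha> - \<beta>) * H1_norm W0 u"
      unfolding L2_norm_cmult using L2_norm_weak_deriv_le_H1_norm[OF Basis_plane_mem(1), of u]
      by (simp add: norm_mult mult_left_mono)
    moreover have "L2_norm W0 ?b \<le> cmod (\<alpha> - \<beta>) * (cmod \<alpha> + cmod \<beta>) * H1_norm W0 u"
    proof -
      have "\<alpha>\<^sup>2 - \<beta>\<^sup>2 = (\<alpha> - \<beta>) * (\<alpha> + \<beta>)" by (simp add: power2_eq_square algebra_simps)
      then have "cmod (\<alpha>\<^sup>2 - \<beta>\<^sup>2) \<le> cmod (\<alpha> - \<beta>) * (cmod \<alpha> + cmod \<beta>)"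
        by (simp add: norm_mult mult_left_mono norm_triangle_ineq)
      then show ?thesis unfolding L2_norm_cmult
        by (intro mult_mono L2_norm_le_H1_norm) auto
    qed
    ultimately show ?thesis by (simp add: algebra_simps)
  qed
  ultimately have "L2_norm W0 (\<lambda>x. (f x - g x) - (?a x - ?b x))
      \<le> L2_norm W0 f + L2_norm W0 g + cmod (\<alpha> - \<beta>) * (2 + cmod \<alpha> + cmod \<beta>) * H1_norm W0 u"
    by linarith
  with sol_energy[OF sol_diff[OF v u f g] F] show ?thesis by linarith
qed

end

section \<open>Passing between quasi-periodic and periodic functions\<close>

section \<open>Exponential factors\<close>

definition qexp :: "complex \<Rightarrow> real \<times> real \<Rightarrow> complex" where
  "qexp \<beta> x = exp (\<i> * \<beta> * complex_of_real (fst x))"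

lemma qexp_wave: "qexp \<beta> = trig_wave (\<i> * \<beta>) (1, 0)"
  by (simp add: qexp_def trig_wave_def inner_unit fun_eq_iff)

lemma smooth_qexp: "smooth (qexp \<beta>)"
  unfolding qexp_wave by (rule smooth_trig_wave)

lemma frechet_derivative_qexp: "pderiv1 (qexp \<beta>) x = \<i> * \<beta> * qexp \<beta> x" "pderiv2 (qexp \<beta>) x = 0"
  unfolding qexp_wave trig_wave_def[abs_def] frechet_derivative_exp_affine by simp_all

lemma qexp_add: "qexp a x * qexp b x = qexp (a + b) x"
  by (simp add: qexp_def exp_add[symmetric] algebra_simps)

lemma qexp_mult_assoc: "qexp a x * (qexp b x * y) = qexp (a + b) x * y"
  by (simp only: mult.assoc[symmetric] qexp_add)

lemma qexp_0 [simp]: "qexp 0 x = 1"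
  by (simp add: qexp_def)

text \<open>The modulus exp (- Im \<beta> x1) is monotone in x1, so its supremum is the value at x1
  = 0 or at x1 = 1.\<close>

lemma qexp_bound:
  assumes "x \<in> W0" shows "cmod (qexp \<beta> x) \<le> max 1 (exp (- Im \<beta>))"
proof -
  have x: "0 < fst x" "fst x < 1" using assms by (auto simp: W0_def)
  have c: "cmod (qexp \<beta> x) = exp (- Im \<beta> * fst x)" by (simp add: qexp_def)
  show ?thesis
  proof (cases "0 \<le> Im \<beta>")
    case True
    then have "- Im \<beta> * fst x \<le> 0" using x by simp
    then show ?thesis unfolding c by (simp add: le_max_iff_disj)
  next
    case False
    then have "- Im \<beta> * fst x \<le> - Im \<beta> * 1" using x by (intro mult_left_mono) auto
    then show ?thesis unfolding c by (simp add: le_max_iff_disj)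
  qed
qed

lemma qexp_L2:
  assumes "f \<in> L2 W0"
  shows "(\<lambda>x. qexp \<beta> x * f x) \<in> L2 W0" "L2_norm W0 (\<lambda>x. qexp \<beta> x * f x) \<le> max 1 (exp (- Im \<beta>)) * L2_norm W0 f"
proof -
  have m: "qexp \<beta> \<in> borel_measurable (lebesgue_on W0)"
    by (intro continuous_measurable_W0 smooth_continuous smooth_qexp)
  have ae: "AE x in lebesgue_on W0. cmod (qexp \<beta> x) \<le> max 1 (exp (- Im \<beta>))"
    by (rule AE_I2) (simp only: space_lebesgue_on qexp_bound)
  show "(\<lambda>x. qexp \<beta> x * f x) \<in> L2 W0" "L2_norm W0 (\<lambda>x. qexp \<beta> x * f x) \<le> max 1 (exp (- Im \<beta>)) * L2_norm W0 f"
    by (rule L2_bounded_mult[OF assms m _ ae], simp)+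
qed

text \<open>Differentiating the exponential in x1 produces i \<beta> v. The term with |\<beta>| is
  kept apart because \<beta> is unbounded as the circles vary.\<close>

lemma H1_norm_qexp:
  assumes v: "v \<in> H1 W0"
  shows "H1_norm W0 (\<lambda>x. qexp \<beta> x * v x) \<le> max 1 (exp (- Im \<beta>)) * (3 * H1_norm W0 v + cmod \<beta> * L2_norm W0 v)"
proof -
  let ?S = "max 1 (exp (- Im \<beta>))" and ?n = "H1_norm W0 v"
  have S: "0 \<le> ?S" by simp
  note L = H1_L2[OF v] H1_wd[OF v] and wL = H1_wd[OF H1_mult[OF smooth_qexp v]]
  have D1: "(\<lambda>x. wd1 v x + \<i> * \<beta> * v x) \<in> L2 W0" by (intro L2_add L2_cmult L)
  have "L2_norm W0 (wd1 (\<lambda>x. qexp \<beta> x * v x)) = L2_norm W0 (\<lambda>x. qexp \<beta> x * (wd1 v x + \<i> * \<beta> * v x))"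
  proof (rule L2_norm_cong_AE[OF _ L2_measurable[OF wL(1)] L2_measurable[OF qexp_L2(1)[OF D1]]])
    show "AE x in lebesgue_on W0. wd1 (\<lambda>x. qexp \<beta> x * v x) x = qexp \<beta> x * (wd1 v x + \<i> * \<beta> * v x)"
      using weak_deriv_mult_AE(1)[OF smooth_qexp v Basis_plane_mem(1)]
      by eventually_elim (simp add: frechet_derivative_qexp algebra_simps)
  qed
  also have "\<dots> \<le> ?S * L2_norm W0 (\<lambda>x. wd1 v x + \<i> * \<beta> * v x)" by (rule qexp_L2(2)[OF D1])
  also have "\<dots> \<le> ?S * (?n + cmod \<beta> * L2_norm W0 v)"
  proof (rule mult_left_mono[OF _ S])
    have "L2_norm W0 (\<lambda>x. wd1 v x + \<i> * \<beta> * v x) \<le> L2_norm W0 (wd1 v) + L2_norm W0 (\<lambda>x. (\<i> * \<beta>) * v x)"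
      by (rule L2_norm_triangle[OF L(2) L2_cmult[OF L(1)]])
    then show "L2_norm W0 (\<lambda>x. wd1 v x + \<i> * \<beta> * v x) \<le> ?n + cmod \<beta> * L2_norm W0 v"
      using L2_norm_weak_deriv_le_H1_norm[OF Basis_plane_mem(1), of v] unfolding L2_norm_cmult by (simp add: norm_mult)
  qed
  finally have 1: "L2_norm W0 (wd1 (\<lambda>x. qexp \<beta> x * v x)) \<le> ?S * (?n + cmod \<beta> * L2_norm W0 v)" .
  have "L2_norm W0 (wd2 (\<lambda>x. qexp \<beta> x * v x)) = L2_norm W0 (\<lambda>x. qexp \<beta> x * wd2 v x)"
  proof (rule L2_norm_cong_AE[OF _ L2_measurable[OF wL(2)] L2_measurable[OF qexp_L2(1)[OF L(3)]]])
    show "AE x in lebesgue_on W0. wd2 (\<lambda>x. qexp \<beta> x * v x) x = qexp \<beta> x * wd2 v x"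
      using weak_deriv_mult_AE(1)[OF smooth_qexp v Basis_plane_mem(2)]
      by eventually_elim (simp add: frechet_derivative_qexp)
  qed
  also have "\<dots> \<le> ?S * ?n"
    using qexp_L2(2)[OF L(3), of \<beta>] mult_left_mono[OF L2_norm_weak_deriv_le_H1_norm[OF Basis_plane_mem(2), of v] S] by linarith
  finally have 2: "L2_norm W0 (wd2 (\<lambda>x. qexp \<beta> x * v x)) \<le> ?S * ?n" .
  have 0: "L2_norm W0 (\<lambda>x. qexp \<beta> x * v x) \<le> ?S * ?n"
    using qexp_L2(2)[OF L(1), of \<beta>] mult_left_mono[OF L2_norm_le_H1_norm[of v] S] by linarith
  have "H1_norm W0 (\<lambda>x. qexp \<beta> x * v x) \<le> ?S * ?n + ?S * (?n + cmod \<beta> * L2_norm W0 v) + ?S * ?n"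
  proof -
    have "L2_norm W0 (weak_deriv W0 e (\<lambda>x. qexp \<beta> x * v x)) \<le> (if e = (1,0) then ?S * (?n + cmod \<beta> * L2_norm W0 v) else ?S * ?n)"
      if "e \<in> Basis" for e
      using that 1 2 by (auto simp: Basis_plane)
    from H1_norm_le[OF 0 this] show ?thesis by simp
  qed
  also have "\<dots> = ?S * (3 * ?n + cmod \<beta> * L2_norm W0 v)"
    by (simp only: distrib_left[symmetric]) (simp add: algebra_simps)
  finally show ?thesis .
qed

lemma Vqp_qexp:
  assumes "u \<in> Vqp z" shows "(\<lambda>x. qexp \<beta> x * u x) \<in> Vqp (exp (\<i> * \<beta>) * z)"
  by (rule Vqp_mult[OF assms smooth_qexp]) (simp add: qexp_def)

section \<open>Norm bounds for contour integrals with values in the space of representatives\<close>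

section \<open>Contour integrals\<close>

lemma H1_sum:
  assumes "finite I" "\<And>i. i \<in> I \<Longrightarrow> f i \<in> H1 W0"
  shows "(\<lambda>x. \<Sum>i\<in>I. f i x) \<in> H1 W0 \<and> H1_norm W0 (\<lambda>x. \<Sum>i\<in>I. f i x) \<le> (\<Sum>i\<in>I. H1_norm W0 (f i))"
  using assms
proof (induction I rule: finite_induct)
  case (insert i I)
  then have i: "f i \<in> H1 W0" and I: "(\<lambda>x. \<Sum>i\<in>I. f i x) \<in> H1 W0" "H1_norm W0 (\<lambda>x. \<Sum>i\<in>I. f i x) \<le> (\<Sum>i\<in>I. H1_norm W0 (f i))"
    by auto
  show ?case
    unfolding sum.insert[OF insert(1,2)]
    using H1_add[OF i I(1)] H1_norm_triangle[OF i I(1)] I(2) by auto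
qed (simp add: H1_zero)

text \<open>Every Riemann sum obeys the bound length times maximum, and the bound passes to the
  limit along the division filter. Where no integral exists, the default value 0 obeys it
  too.\<close>

lemma V_contour_integral_bound:
  assumes r: "r > 0" and B: "B \<ge> 0" and F: "\<And>z. z \<in> sphere 0 r \<Longrightarrow> F z \<in> H1 W0 \<and> H1_norm W0 (F z) \<le> B"
  shows "H1_norm W0 (V_contour_integral (circlepath 0 r) F) \<le> 2 * pi * r * B"
proof (cases "\<exists>u. has_V_contour_integral F u (circlepath 0 r)")
  case False
  then have "V_contour_integral (circlepath 0 r) F = (\<lambda>_. 0)" unfolding V_contour_integral_def by (simp only: if_False)
  then show ?thesis using r B by simp
next
  case True
  define u where "u = V_contour_integral (circlepath 0 r) F"
  have "has_V_contour_integral F u (circlepath 0 r)"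
    unfolding u_def V_contour_integral_def if_P[OF True] by (rule someI_ex[OF True])
  then have uH: "u \<in> H1 W0" and lim: "((\<lambda>\<D>. H1_norm W0 (\<lambda>x.
          (\<Sum>(t, K)\<in>\<D>. measure lborel K *\<^sub>R (F (circlepath 0 r t) x * vector_derivative (circlepath 0 r) (at t within {0..1}))) - u x))
        \<longlongrightarrow> 0) (division_filter (cbox 0 1))"
    unfolding has_V_contour_integral_def V_def by auto
  let ?d = "\<lambda>t. vector_derivative (circlepath 0 r) (at t within {0..1})"
  let ?S = "\<lambda>\<D> x. \<Sum>(t, K)\<in>\<D>. measure lborel K *\<^sub>R (F (circlepath 0 r t) x * ?d t)"
  have S: "?S \<D> \<in> H1 W0 \<and> H1_norm W0 (?S \<D>) \<le> 2 * pi * r * B" if D: "\<D> tagged_division_of cbox 0 1" for \<D>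
  proof -
    define c where "c p = complex_of_real (measure lborel (snd p)) * ?d (fst p)" for p :: "real \<times> real set"
    have eq: "?S \<D> = (\<lambda>x. \<Sum>p\<in>\<D>. c p * F (circlepath 0 r (fst p)) x)"
      by (simp add: c_def case_prod_beta scaleR_conv_of_real fun_eq_iff mult_ac)
    have t: "F (circlepath 0 r (fst p)) \<in> H1 W0" "H1_norm W0 (F (circlepath 0 r (fst p))) \<le> B"
      "cmod (c p) = measure lborel (snd p) * (2 * pi * r)" if p: "p \<in> \<D>" for p
    proof -
      have p2: "(fst p, snd p) \<in> \<D>" using p by simp
      have "fst p \<in> snd p" "snd p \<subseteq> cbox 0 1" using tagged_division_ofD(2,3)[OF D p2] by auto
      then have t01: "0 \<le> fst p" "fst p \<le> 1" by auto
      have "circlepath 0 r (fst p) \<in> path_image (circlepath 0 r)" unfolding path_image_def using t01 by auto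
      then have "circlepath 0 r (fst p) \<in> sphere 0 r" using r by simp
      from F[OF this] show "F (circlepath 0 r (fst p)) \<in> H1 W0" "H1_norm W0 (F (circlepath 0 r (fst p))) \<le> B" by auto
      have "?d (fst p) = 2 * pi * \<i> * r * exp (2 * of_real pi * \<i> * (fst p))"
        by (rule vector_derivative_circlepath01[OF t01])
      then show "cmod (c p) = measure lborel (snd p) * (2 * pi * r)"
        using r by (simp add: c_def norm_mult abs_mult)
    qed
    have fin: "finite \<D>" by (rule tagged_division_of_finite[OF D])
    have sm: "?S \<D> \<in> H1 W0 \<and> H1_norm W0 (?S \<D>) \<le> (\<Sum>p\<in>\<D>. H1_norm W0 (\<lambda>x. c p * F (circlepath 0 r (fst p)) x))"
      unfolding eq by (rule H1_sum[OF fin H1_cmult[OF t(1)]])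
    have "(\<Sum>p\<in>\<D>. H1_norm W0 (\<lambda>x. c p * F (circlepath 0 r (fst p)) x)) \<le> (\<Sum>p\<in>\<D>. measure lborel (snd p) * (2 * pi * r) * B)"
    proof (rule sum_mono)
      fix p assume p: "p \<in> \<D>"
      show "H1_norm W0 (\<lambda>x. c p * F (circlepath 0 r (fst p)) x) \<le> measure lborel (snd p) * (2 * pi * r) * B"
        unfolding H1_norm_cmult[OF t(1)[OF p]] t(3)[OF p] by (rule mult_left_mono[OF t(2)[OF p]]) (use r in simp)
    qed
    also have "\<dots> = (\<Sum>(x, K)\<in>\<D>. measure lborel K) * (2 * pi * r) * B"
      by (simp add: sum_distrib_right case_prod_beta)
    \<comment> \<open>The cells of a tagged division fill the parameter interval, which has length
      1.\<close>
    also have "(\<Sum>(x, K)\<in>\<D>. measure lborel K) = 1"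
      using additive_content_tagged_division[OF D] by simp
    finally show ?thesis using sm by simp
  qed
  have "((\<lambda>\<D>. 2 * pi * r * B + H1_norm W0 (\<lambda>x. ?S \<D> x - u x)) \<longlongrightarrow> 2 * pi * r * B + 0) (division_filter (cbox 0 1))"
    by (intro tendsto_add tendsto_const lim)
  moreover have "\<forall>\<^sub>F \<D> in division_filter (cbox 0 1). H1_norm W0 u \<le> 2 * pi * r * B + H1_norm W0 (\<lambda>x. ?S \<D> x - u x)"
    using eventually_division_filter_tagged_division[of "cbox 0 1"]
  proof eventually_elim
    case (elim \<D>)
    note SD = S[OF elim]
    show ?case
      using H1_norm_triangle_sub[OF uH conjunct1[OF SD]] H1_norm_minus_commute[OF uH conjunct1[OF SD]] conjunct2[OF SD]
      by linarith
  qed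
  ultimately have "H1_norm W0 u \<le> 2 * pi * r * B + 0"
    by (rule tendsto_lowerbound) (rule division_filter_not_empty)
  then show ?thesis by (simp add: u_def)
qed

section \<open>How far the symbol stays from zero\<close>

section \<open>Lower bounds for the symbol\<close>

context helmholtz
begin

text \<open>With w = 2 pi j + \<alpha> and P = pi l the symbol factors as (w + i P) (w - i P). Since
  2 pi j is real, the imaginary parts Im \<alpha> + P and Im \<alpha> - P bound the two factors from
  below.\<close>

lemma symbol_lower_bound: "\<bar>(Im \<alpha>)\<^sup>2 - (pi * real l)\<^sup>2\<bar> \<le> cmod (symbol \<alpha> j l)"
proof -
  define w where "w = complex_of_real (2 * pi * j) + \<alpha>"
  define P where "P = pi * real l"
  have "symbol \<alpha> j l = (w + \<i> * P) * (w - \<i> * P)"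
    unfolding symbol_def w_def P_def by (simp add: power2_eq_square algebra_simps)
  then have "cmod (symbol \<alpha> j l) = cmod (w + \<i> * P) * cmod (w - \<i> * P)" by (simp add: norm_mult)
  moreover have "\<bar>Im \<alpha> + P\<bar> \<le> cmod (w + \<i> * P)" "\<bar>Im \<alpha> - P\<bar> \<le> cmod (w - \<i> * P)"
    using abs_Im_le_cmod[of "w + \<i> * P"] abs_Im_le_cmod[of "w - \<i> * P"] by (simp_all add: w_def)
  ultimately have "\<bar>Im \<alpha> + P\<bar> * \<bar>Im \<alpha> - P\<bar> \<le> cmod (symbol \<alpha> j l)"
    by (simp add: mult_mono)
  then show ?thesis
    unfolding abs_mult[symmetric] P_def by (simp add: power2_eq_square algebra_simps)
qed

lemma symbol_large:
  assumes "\<bar>Im \<alpha>\<bar> = pi * sqrt (((real m)\<^sup>2 + (real m + 1)\<^sup>2) / 2)"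
  shows "pi\<^sup>2 * (real m + 1/2) \<le> cmod (symbol \<alpha> j l)"
proof -
  have "(Im \<alpha>)\<^sup>2 = (pi * sqrt (((real m)\<^sup>2 + (real m + 1)\<^sup>2) / 2))\<^sup>2" by (metis assms power2_abs)
  then have I: "(Im \<alpha>)\<^sup>2 = pi\<^sup>2 * ((real m)\<^sup>2 + real m + 1/2)"
    by (simp add: power_mult_distrib power2_eq_square algebra_simps)
  \<comment> \<open>The number m^2 + m + 1/2 is the midpoint of the consecutive squares m^2 and (m +
    1)^2, at distance exactly m + 1/2 from both.\<close>
  have "real m + 1/2 \<le> \<bar>(real m)\<^sup>2 + real m + 1/2 - (real l)\<^sup>2\<bar>"
  proof (cases "l \<le> m")
    case True
    then have "(real l)\<^sup>2 \<le> (real m)\<^sup>2" by (intro power_mono) auto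
    then show ?thesis by linarith
  next
    case False
    then have "(real m + 1)\<^sup>2 \<le> (real l)\<^sup>2" by (intro power_mono) auto
    then show ?thesis by (simp add: power2_sum)
  qed
  then have "pi\<^sup>2 * (real m + 1/2) \<le> pi\<^sup>2 * \<bar>(real m)\<^sup>2 + real m + 1/2 - (real l)\<^sup>2\<bar>"
    by (rule mult_left_mono) simp
  also have "\<dots> = \<bar>(Im \<alpha>)\<^sup>2 - (pi * real l)\<^sup>2\<bar>"
    unfolding I power_mult_distrib right_diff_distrib[symmetric] abs_mult by simp
  also have "\<dots> \<le> cmod (symbol \<alpha> j l)" by (rule symbol_lower_bound)
  finally show ?thesis .
qed

text \<open>Here the real part of the symbol is used. Either l > N, or |j| > N and then |2 pi j + Re
  \<alpha>| >= 2 pi (N + 1) - pi, which exceeds pi N.\<close>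

lemma symbol_high:
  assumes "\<bar>Re \<alpha>\<bar> \<le> pi" "\<not> (\<bar>j\<bar> \<le> int N \<and> l \<le> N)"
  shows "(pi * real N)\<^sup>2 - (Im \<alpha>)\<^sup>2 \<le> cmod (symbol \<alpha> j l)"
proof -
  define t where "t = 2 * pi * real_of_int j + Re \<alpha>"
  have "Re (symbol \<alpha> j l) = t\<^sup>2 - (Im \<alpha>)\<^sup>2 + (pi * real l)\<^sup>2"
    unfolding symbol_def t_def by (simp add: power2_eq_square)
  moreover have "(pi * real N)\<^sup>2 \<le> t\<^sup>2 + (pi * real l)\<^sup>2"
  proof (cases "N < l")
    case True
    then have "(pi * real N)\<^sup>2 \<le> (pi * real l)\<^sup>2" by (intro power_mono mult_left_mono) auto
    then show ?thesis using zero_le_power2[of t] by linarith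
  next
    case False
    then have "int N + 1 \<le> \<bar>j\<bar>" using assms(2) by auto
    then have "real_of_int (int N + 1) \<le> real_of_int \<bar>j\<bar>" by (rule of_int_le_iff[THEN iffD2])
    then have "pi * (real N + 1) \<le> pi * \<bar>real_of_int j\<bar>" by (intro mult_left_mono) auto
    moreover have "\<bar>2 * pi * real_of_int j\<bar> = 2 * (pi * \<bar>real_of_int j\<bar>)" by (simp add: abs_mult)
    moreover have "0 \<le> pi * real N" by simp
    ultimately have "pi * real N \<le> \<bar>t\<bar>"
      using assms(1) unfolding t_def by (simp add: distrib_left)
    then have "(pi * real N)\<^sup>2 \<le> \<bar>t\<bar>\<^sup>2" by (intro power_mono) auto
    then show ?thesis using zero_le_power2[of "pi * real l"] unfolding power2_abs by linarith
  qed
  ultimately have "(pi * real N)\<^sup>2 - (Im \<alpha>)\<^sup>2 \<le> Re (symbol \<alpha> j l)" by linarith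
  then show ?thesis using complex_Re_le_cmod[of "symbol \<alpha> j l"] by linarith
qed

end

section \<open>Limits of normalised approximate solutions\<close>

section \<open>Compactness\<close>

context helmholtz
begin

text \<open>The exponents \<open>\<alpha> + \<beta>\<close> with \<open>exp (\<i> * \<beta>) = 1\<close> are those belonging to the same quasi-periodicity.\<close>

definition qsol :: "complex \<Rightarrow> (real \<times> real \<Rightarrow> complex) \<Rightarrow> (real \<times> real \<Rightarrow> complex) \<Rightarrow> bool" where
  "qsol \<alpha> f v \<longleftrightarrow> (\<forall>\<beta>. exp (\<i> * \<beta>) = 1 \<longrightarrow> sol (\<alpha> + \<beta>) (\<lambda>x. qexp (- \<beta>) x * f x) (\<lambda>x. qexp (- \<beta>) x * v x))"

lemma qsol_sol: "qsol \<alpha> f v \<Longrightarrow> sol \<alpha> f v"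
  unfolding qsol_def by (drule spec[of _ 0]) simp

lemma qsol_cmult:
  assumes "qsol \<alpha> f v" shows "qsol \<alpha> (\<lambda>x. c * f x) (\<lambda>x. c * v x)"
  unfolding qsol_def mult.left_commute[of "qexp _ _" c]
  using assms unfolding qsol_def by (intro allI impI sol_cmult) simp

lemma variational_solution_iff_sol_qexp:
  "variational_solution k q g \<alpha> v \<longleftrightarrow> sol \<alpha> (\<lambda>x. qexp (- \<alpha>) x * g x) v"
proof -
  have "(\<lambda>x. exp (- \<i> * \<alpha> * complex_of_real (fst x)) * g x) = (\<lambda>x. qexp (- \<alpha>) x * g x)"
    by (simp add: qexp_def fun_eq_iff)
  then show ?thesis unfolding variational_solution_iff_sol by (simp only:)
qed

lemma qp_solution_iff_sol:
  "qp_solution k q g z w \<longleftrightarrow> z \<noteq> 0 \<and> w \<in> Vqp z \<and>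
     (\<forall>\<alpha>. exp (\<i> * \<alpha>) = z \<longrightarrow> sol \<alpha> (\<lambda>x. qexp (- \<alpha>) x * g x) (\<lambda>x. qexp (- \<alpha>) x * w x))"
proof -
  have "(\<lambda>x. exp (- \<i> * \<alpha> * complex_of_real (fst x)) * w x) = (\<lambda>x. qexp (- \<alpha>) x * w x)" for \<alpha>
    by (simp add: qexp_def fun_eq_iff)
  then show ?thesis unfolding qp_solution_def variational_solution_iff_sol_qexp by (simp only:)
qed

lemma qp_solution_imp_qsol:
  assumes "qp_solution k q g (exp (\<i> * \<alpha>)) w"
  shows "qsol \<alpha> (\<lambda>x. qexp (- \<alpha>) x * g x) (\<lambda>x. qexp (- \<alpha>) x * w x)"
  unfolding qsol_def
proof (intro allI impI)
  fix \<beta> :: complex assume "exp (\<i> * \<beta>) = 1"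
  then have "exp (\<i> * (\<alpha> + \<beta>)) = exp (\<i> * \<alpha>)" by (simp add: distrib_left exp_add)
  then have "sol (\<alpha> + \<beta>) (\<lambda>x. qexp (- (\<alpha> + \<beta>)) x * g x) (\<lambda>x. qexp (- (\<alpha> + \<beta>)) x * w x)"
    using assms unfolding qp_solution_iff_sol by blast
  then show "sol (\<alpha> + \<beta>) (\<lambda>x. qexp (- \<beta>) x * (qexp (- \<alpha>) x * g x)) (\<lambda>x. qexp (- \<beta>) x * (qexp (- \<alpha>) x * w x))"
    unfolding qexp_mult_assoc by (simp add: add.commute)
qed

text \<open>Any two exponents of the same point differ by some \<beta> with exp (i \<beta>) = 1, so
  \<open>qsol\<close> contains every equation that membership in the exceptional set
  demands.\<close>

lemma qsol_imp_qp_solution: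
  assumes "qsol \<alpha> (\<lambda>_. 0) v"
  shows "qp_solution k q (\<lambda>_. 0) (exp (\<i> * \<alpha>)) (\<lambda>x. qexp \<alpha> x * v x)"
  unfolding qp_solution_iff_sol
proof (intro conjI allI impI)
  show "exp (\<i> * \<alpha>) \<noteq> 0" by simp
  show "(\<lambda>x. qexp \<alpha> x * v x) \<in> Vqp (exp (\<i> * \<alpha>))"
    using Vqp_qexp[OF sol_Vqp[OF qsol_sol[OF assms]], of \<alpha>] by simp
  fix \<alpha>' :: complex assume e: "exp (\<i> * \<alpha>') = exp (\<i> * \<alpha>)"
  have "exp (\<i> * (\<alpha>' - \<alpha>)) = 1" using e by (simp add: right_diff_distrib exp_diff)
  then have "sol (\<alpha> + (\<alpha>' - \<alpha>)) (\<lambda>x. qexp (- (\<alpha>' - \<alpha>)) x * 0) (\<lambda>x. qexp (- (\<alpha>' - \<alpha>)) x * v x)"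
    using assms unfolding qsol_def by blast
  then show "sol \<alpha>' (\<lambda>x. qexp (- \<alpha>') x * 0) (\<lambda>x. qexp (- \<alpha>') x * (qexp \<alpha> x * v x))"
    unfolding qexp_mult_assoc by simp
qed

text \<open>Each \<beta> is treated separately: multiplication by a fixed exponential is continuous
  on L2 and H1, so \<open>sol_limit\<close> applies to the shifted equations.\<close>

lemma qsol_limit:
  assumes sol: "\<And>n. qsol (\<alpha> n) (f n) (v n)" and f: "\<And>n. f n \<in> L2 W0"
    and lim: "\<alpha> \<longlonglongrightarrow> \<alpha>'" "(\<lambda>n. L2_norm W0 (f n)) \<longlonglongrightarrow> 0" "(\<lambda>n. H1_norm W0 (\<lambda>x. v n x - v' x)) \<longlonglongrightarrow> 0"
    and v': "v' \<in> H1 W0"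
  shows "qsol \<alpha>' (\<lambda>_. 0) v'"
  unfolding qsol_def
proof (intro allI impI)
  fix \<beta> :: complex assume \<beta>: "exp (\<i> * \<beta>) = 1"
  note vH = sol_H1[OF qsol_sol[OF sol]]
  obtain K where K: "K \<ge> 0" "\<And>u. u \<in> H1 W0 \<Longrightarrow> H1_norm W0 (\<lambda>x. qexp (- \<beta>) x * u x) \<le> K * H1_norm W0 u"
    by (rule H1_norm_mult_bound[OF smooth_qexp[of "- \<beta>"]], rule that)
  have "sol (\<alpha>' + \<beta>) (\<lambda>_. 0) (\<lambda>x. qexp (- \<beta>) x * v' x)"
  proof (rule sol_limit)
    show "sol (\<alpha> n + \<beta>) (\<lambda>x. qexp (- \<beta>) x * f n x) (\<lambda>x. qexp (- \<beta>) x * v n x)" for n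
      using sol[of n] \<beta> unfolding qsol_def by blast
    show "(\<lambda>x. qexp (- \<beta>) x * f n x) \<in> L2 W0" for n by (rule qexp_L2(1)[OF f])
    show "(\<lambda>n. \<alpha> n + \<beta>) \<longlonglongrightarrow> \<alpha>' + \<beta>" by (intro tendsto_intros lim)
    show "(\<lambda>n. L2_norm W0 (\<lambda>x. qexp (- \<beta>) x * f n x)) \<longlonglongrightarrow> 0"
      by (rule tendsto_sandwich[OF _ _ tendsto_const tendsto_mult_right_zero[OF lim(2), of "max 1 (exp (- Im (- \<beta>)))"]])
        (simp, intro always_eventually allI qexp_L2(2)[OF f])
    have "H1_norm W0 (\<lambda>x. qexp (- \<beta>) x * v n x - qexp (- \<beta>) x * v' x) \<le> K * H1_norm W0 (\<lambda>x. v n x - v' x)" for n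
      using K(2)[OF H1_diff[OF vH[of n] v']] by (simp only: right_diff_distrib)
    then show "(\<lambda>n. H1_norm W0 (\<lambda>x. qexp (- \<beta>) x * v n x - qexp (- \<beta>) x * v' x)) \<longlonglongrightarrow> 0"
      by (intro tendsto_sandwich[OF _ _ tendsto_const tendsto_mult_right_zero[OF lim(3), of K]]) simp_all
    show "(\<lambda>x. qexp (- \<beta>) x * v' x) \<in> H1 W0" by (rule H1_mult[OF smooth_qexp v'])
  qed
  then show "sol (\<alpha>' + \<beta>) (\<lambda>x. qexp (- \<beta>) x * 0) (\<lambda>x. qexp (- \<beta>) x * v' x)" by simp
qed

lemma trig_sin_norm_le: "l \<ge> 1 \<Longrightarrow> L2_norm W0 (trig_sin j l) \<le> 1"
proof -
  assume l: "l \<ge> 1"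
  have "complex_of_real ((L2_norm W0 (trig_sin j l))\<^sup>2) = 1 / 2"
    unfolding inner_self[symmetric] using coeff_sin_trig_sin[OF l l, of j j] by (simp add: coeff_sin_def)
  then have "(L2_norm W0 (trig_sin j l))\<^sup>2 = 1 / 2"
    by (metis of_real_1 of_real_divide of_real_eq_iff of_real_numeral)
  then have "(L2_norm W0 (trig_sin j l))\<^sup>2 \<le> 1\<^sup>2" by simp
  then show ?thesis by (rule power2_le_imp_le) simp
qed

definition low_modes :: "nat \<Rightarrow> (int \<times> nat) set" where
  "low_modes N = {- int N..int N} \<times> {1..N}"

text \<open>A test sum is split at the block of low modes. On the block the coefficients of the two
  solutions are compared directly; outside it the symbol is at least \<Lambda>, and each solution is
  small by itself.\<close>

lemma low_modes_estimate:
  assumes v: "sol \<alpha> f v" and u: "sol \<beta> g u" and f: "f \<in> L2 W0" and g: "g \<in> L2 W0"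
    and \<alpha>: "\<bar>Re \<alpha>\<bar> \<le> pi" "(Im \<alpha>)\<^sup>2 = y\<^sup>2" and \<beta>: "\<bar>Re \<beta>\<bar> \<le> pi" "(Im \<beta>)\<^sup>2 = y\<^sup>2"
    and \<Lambda>: "\<Lambda> = (pi * real N)\<^sup>2 - y\<^sup>2" "\<Lambda> > 0"
  shows "L2_norm W0 (\<lambda>x. v x - u x) \<le> 2 * (\<Sum>(j, l)\<in>low_modes N. cmod (coeff_sin v j l - coeff_sin u j l))
    + ((Q * L2_norm W0 v + L2_norm W0 f) + (Q * L2_norm W0 u + L2_norm W0 g)) / \<Lambda>"
proof -
  note vL = sol_L2[OF v] and uL = sol_L2[OF u]
  define A where "A = (\<Sum>(j, l)\<in>low_modes N. cmod (coeff_sin v j l - coeff_sin u j l))"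
  define Bv where "Bv = (Q * L2_norm W0 v + L2_norm W0 f) / \<Lambda>"
  define Bu where "Bu = (Q * L2_norm W0 u + L2_norm W0 g) / \<Lambda>"
  have A0: "0 \<le> A" unfolding A_def by (intro sum_nonneg) auto
  have B0: "0 \<le> Bv" "0 \<le> Bu" unfolding Bv_def Bu_def using Q_nonneg \<Lambda>(2) by auto
  have "L2_norm W0 (\<lambda>x. v x - u x) \<le> 2 * A + (Bv + Bu)"
  proof (rule L2_norm_le_dual[OF L2_diff[OF vL uL]])
    show "0 \<le> 2 * A + (Bv + Bu)" using A0 B0 by simp
    fix s assume s: "s \<in> trig_sums"
    obtain F a where F: "finite F" "\<And>j l. (j, l) \<in> F \<Longrightarrow> l \<ge> 1" "s = trig_sum F a"
      by (rule trig_sums_cases[OF s], rule that)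
    let ?n = "L2_norm W0 s"
    have n2: "?n\<^sup>2 = (\<Sum>p\<in>F. (cmod (a p))\<^sup>2) / 2" unfolding F(3) by (rule trig_sum_norm[OF F(1,2)])
    define L where "L = F \<inter> low_modes N"
    define H where "H = F - low_modes N"
    have LH: "finite L" "finite H" "L \<inter> H = {}" "F = L \<union> H" unfolding L_def H_def using F(1) by auto
    have H1: "l \<ge> 1" if "(j, l) \<in> H" for j l using that F(2) unfolding H_def by auto
    have Hn: "\<not> (\<bar>j\<bar> \<le> int N \<and> l \<le> N)" if "(j, l) \<in> H" for j l
      using that H1[OF that] unfolding H_def low_modes_def by auto
    have split: "inner_W0 w s = inner_W0 w (trig_sum L a) + inner_W0 w (trig_sum H a)" if "w \<in> L2 W0" for w
      unfolding F(3) inner_trig_sum_right[OF F(1) that] inner_trig_sum_right[OF LH(1) that] inner_trig_sum_right[OF LH(2) that]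
      unfolding LH(4) by (rule sum.union_disjoint[OF LH(1-3)])
    have "(L2_norm W0 (trig_sum H a))\<^sup>2 \<le> ?n\<^sup>2"
    proof -
      have "(L2_norm W0 (trig_sum H a))\<^sup>2 = (\<Sum>p\<in>H. (cmod (a p))\<^sup>2) / 2" by (rule trig_sum_norm[OF LH(2) H1])
      also have "\<dots> \<le> (\<Sum>p\<in>F. (cmod (a p))\<^sup>2) / 2"
        by (intro divide_right_mono sum_mono2 F(1)) (auto simp: H_def)
      finally show ?thesis unfolding n2 .
    qed
    then have Hle: "L2_norm W0 (trig_sum H a) \<le> ?n" by (rule power2_le_imp_le) simp
    have hv: "cmod (inner_W0 v (trig_sum H a)) \<le> Bv * ?n"
    proof -
      have "cmod (inner_W0 v (trig_sum H a)) \<le> Bv * L2_norm W0 (trig_sum H a)"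
        unfolding Bv_def
        by (rule sol_high_modes[OF v f LH(2) H1 \<Lambda>(2)]) (use symbol_high[OF \<alpha>(1) Hn] \<alpha>(2) \<Lambda>(1) in auto)
      then show ?thesis using mult_left_mono[OF Hle B0(1)] by linarith
    qed
    have hu: "cmod (inner_W0 u (trig_sum H a)) \<le> Bu * ?n"
    proof -
      have "cmod (inner_W0 u (trig_sum H a)) \<le> Bu * L2_norm W0 (trig_sum H a)"
        unfolding Bu_def
        by (rule sol_high_modes[OF u g LH(2) H1 \<Lambda>(2)]) (use symbol_high[OF \<beta>(1) Hn] \<beta>(2) \<Lambda>(1) in auto)
      then show ?thesis using mult_left_mono[OF Hle B0(2)] by linarith
    qed
    \<comment> \<open>Finite Parseval gives sqrt 2 times the norm; 2 is a convenient upper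
      bound.\<close>
    have ap: "cmod (a p) \<le> 2 * ?n" if "p \<in> F" for p
    proof -
      have "(cmod (a p))\<^sup>2 \<le> (\<Sum>p\<in>F. (cmod (a p))\<^sup>2)"
        by (rule member_le_sum[OF that _ F(1)]) simp
      also have "\<dots> = 2 * ?n\<^sup>2" unfolding n2 by simp
      also have "\<dots> \<le> (2 * ?n)\<^sup>2" by (simp add: power_mult_distrib)
      finally show ?thesis by (rule power2_le_imp_le) simp
    qed
    have "inner_W0 v (trig_sum L a) - inner_W0 u (trig_sum L a)
        = (\<Sum>(j, l)\<in>L. cnj (a (j, l)) * (coeff_sin v j l - coeff_sin u j l))"
      unfolding inner_trig_sum_right[OF LH(1) vL] inner_trig_sum_right[OF LH(1) uL] sum_subtractf[symmetric]
      by (intro sum.cong refl) (auto simp: algebra_simps)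
    then have "cmod (inner_W0 v (trig_sum L a) - inner_W0 u (trig_sum L a))
        \<le> (\<Sum>p\<in>L. cmod (case p of (j, l) \<Rightarrow> cnj (a (j, l)) * (coeff_sin v j l - coeff_sin u j l)))"
      by (simp only: norm_sum)
    also have "\<dots> \<le> (\<Sum>p\<in>L. (2 * ?n) * (case p of (j, l) \<Rightarrow> cmod (coeff_sin v j l - coeff_sin u j l)))"
    proof (rule sum_mono)
      fix p assume p: "p \<in> L"
      then have "p \<in> F" by (simp add: L_def)
      from ap[OF this] show "cmod (case p of (j, l) \<Rightarrow> cnj (a (j, l)) * (coeff_sin v j l - coeff_sin u j l))
          \<le> (2 * ?n) * (case p of (j, l) \<Rightarrow> cmod (coeff_sin v j l - coeff_sin u j l))"
        by (cases p) (simp add: norm_mult mult_right_mono)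
    qed
    also have "\<dots> = (2 * ?n) * (\<Sum>p\<in>L. case p of (j, l) \<Rightarrow> cmod (coeff_sin v j l - coeff_sin u j l))"
      by (simp only: sum_distrib_left)
    also have "\<dots> \<le> (2 * ?n) * A"
      unfolding A_def by (intro mult_left_mono sum_mono2) (auto simp: L_def low_modes_def)
    finally have low: "cmod (inner_W0 v (trig_sum L a) - inner_W0 u (trig_sum L a)) \<le> 2 * A * ?n" by (simp add: mult_ac)
    have sL: "s \<in> L2 W0" using s trig_sums.sub by auto
    have "inner_W0 (\<lambda>x. v x - u x) s = (inner_W0 v (trig_sum L a) - inner_W0 u (trig_sum L a))
        + (inner_W0 v (trig_sum H a) - inner_W0 u (trig_sum H a))"
      unfolding inner_diff[OF vL uL sL] split[OF vL] split[OF uL] by simp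
    then have "cmod (inner_W0 (\<lambda>x. v x - u x) s) \<le> cmod (inner_W0 v (trig_sum L a) - inner_W0 u (trig_sum L a))
        + cmod (inner_W0 v (trig_sum H a) - inner_W0 u (trig_sum H a))"
      by (simp only: norm_triangle_ineq)
    also have "\<dots> \<le> 2 * A * ?n + (Bv * ?n + Bu * ?n)"
      using low hv hu norm_triangle_ineq4[of "inner_W0 v (trig_sum H a)" "inner_W0 u (trig_sum H a)"] by linarith
    finally show "cmod (inner_W0 (\<lambda>x. v x - u x) s) \<le> (2 * A + (Bv + Bu)) * ?n"
      by (simp only: distrib_right)
  qed
  then show ?thesis unfolding A_def Bv_def Bu_def add_divide_distrib .
qed

text \<open>High modes are uniformly small and the remaining finitely many coefficients converge along a
  subsequence; the energy estimate for differences upgrades convergence in \<open>L2\<close> to \<open>H1\<close>.\<close>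

lemma qsol_compactness:
  assumes sol: "\<And>n. qsol (\<alpha> n) (f n) (v n)" and f: "\<And>n. f n \<in> L2 W0"
    and \<alpha>: "\<And>n. \<bar>Re (\<alpha> n)\<bar> \<le> pi" "\<And>n. Im (\<alpha> n) = y"
    and v1: "\<And>n. L2_norm W0 (v n) = 1" and f0: "(\<lambda>n. L2_norm W0 (f n)) \<longlonglongrightarrow> 0" and f1: "\<And>n. L2_norm W0 (f n) \<le> 1"
  obtains a u where "Im a = y" "qsol a (\<lambda>_. 0) u" "L2_norm W0 u = 1"
proof -
  define R where "R = pi + \<bar>y\<bar>"
  have R: "cmod (\<alpha> n) \<le> R" for n
    using cmod_le[of "\<alpha> n"] \<alpha>[of n] unfolding R_def by simp
  have R0: "0 \<le> R" by (simp add: R_def)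
  obtain a r1 where r1: "strict_mono (r1 :: nat \<Rightarrow> nat)" "(\<alpha> \<circ> r1) \<longlonglongrightarrow> a"
  proof -
    have "seq_compact (cball (0::complex) R)" by (rule compact_imp_seq_compact[OF compact_cball])
    moreover have "\<forall>n. \<alpha> n \<in> cball 0 R" using R by simp
    ultimately show ?thesis using that unfolding seq_compact_def by blast
  qed
  have "(\<lambda>n. Im ((\<alpha> \<circ> r1) n)) \<longlonglongrightarrow> Im a" by (intro tendsto_Im r1)
  then have Ima: "Im a = y" unfolding comp_def \<alpha>(2) by (simp add: LIMSEQ_const_iff)
  have cb: "norm (coeff_sin (v (r1 n)) (fst p) (snd p)) \<le> 1" if "p \<in> {p :: int \<times> nat. snd p \<ge> 1}" for n p
  proof -
    have "norm (coeff_sin (v (r1 n)) (fst p) (snd p)) \<le> L2_norm W0 (v (r1 n)) * L2_norm W0 (trig_sin (fst p) (snd p))"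
      unfolding coeff_sin_def by (rule inner_bound[OF sol_L2[OF qsol_sol[OF sol]] trig_L2(1)])
    then show ?thesis using trig_sin_norm_le[of "snd p" "fst p"] that unfolding v1 by simp
  qed
  \<comment> \<open>The modes are countable and each coefficient is bounded by 1, so a diagonal
    subsequence makes all of them converge at once.\<close>
  obtain r2 where r2: "strict_mono (r2 :: nat \<Rightarrow> nat)"
    "\<And>p. p \<in> {p :: int \<times> nat. snd p \<ge> 1} \<Longrightarrow> \<exists>l. (\<lambda>n. coeff_sin (v (r1 (r2 n))) (fst p) (snd p)) \<longlonglongrightarrow> l"
    by (rule function_convergent_subsequence[of "{p :: int \<times> nat. snd p \<ge> 1}" "\<lambda>n p. coeff_sin (v (r1 n)) (fst p) (snd p)" 1])
      (auto intro: cb countableI_type that)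
  define r where "r n = r1 (r2 n)" for n
  have r: "strict_mono r" unfolding r_def using r1(1) r2(1) by (simp add: strict_mono_def)
  have \<alpha>r: "(\<lambda>n. \<alpha> (r n)) \<longlonglongrightarrow> a"
    using LIMSEQ_subseq_LIMSEQ[OF r1(2) r2(1)] by (simp add: comp_def r_def)
  have fr: "(\<lambda>n. L2_norm W0 (f (r n))) \<longlonglongrightarrow> 0"
    using LIMSEQ_subseq_LIMSEQ[OF f0 r] by (simp add: comp_def)
  note solr = qsol_sol[OF sol]
  note vH = sol_H1[OF solr]
  have L2_Cauchy: "\<exists>N. \<forall>m\<ge>N. \<forall>n\<ge>N. L2_norm W0 (\<lambda>x. v (r m) x - v (r n) x) < e" if e: "e > 0" for e
  proof -
    have "filterlim (\<lambda>N. (pi * real N)\<^sup>2) at_top sequentially"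
      by (intro filterlim_pow_at_top filterlim_tendsto_pos_mult_at_top[OF tendsto_const pi_gt_zero] filterlim_real_sequentially) simp
    then have "eventually (\<lambda>N. (pi * real N)\<^sup>2 \<ge> y\<^sup>2 + 1 + 4 * (Q + 1) / e) sequentially"
      by (simp only: filterlim_at_top)
    \<comment> \<open>For this \<open>N\<close> the symbol of the high modes exceeds 4 (Q + 1) / e,
      so the contribution 2 (Q + 1) / \<Lambda> of two normalised solutions is below e / 2.\<close>
    then obtain N where N: "(pi * real N)\<^sup>2 \<ge> y\<^sup>2 + 1 + 4 * (Q + 1) / e" by (auto simp: eventually_sequentially)
    define \<Lambda> where "\<Lambda> = (pi * real N)\<^sup>2 - y\<^sup>2"
    have q: "0 \<le> 4 * (Q + 1) / e" using Q_nonneg e by simp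
    have \<Lambda>: "\<Lambda> > 0" "4 * (Q + 1) / e < \<Lambda>" unfolding \<Lambda>_def using N q by linarith+
    have tail: "2 * (Q + 1) / \<Lambda> < e / 2"
      using \<Lambda> e by (simp add: field_simps)
    have fin: "finite (low_modes N)" by (simp add: low_modes_def)
    \<comment> \<open>The tolerance e / 4 is shared among the low modes; the added 1 keeps the
      denominator positive when the block is empty.\<close>
    have "\<exists>M. \<forall>m\<ge>M. \<forall>n\<ge>M. cmod (coeff_sin (v (r m)) (fst p) (snd p) - coeff_sin (v (r n)) (fst p) (snd p)) < e / (4 * (real (card (low_modes N)) + 1))"
      if p: "p \<in> low_modes N" for p
    proof -
      have "p \<in> {p. snd p \<ge> 1}" using p by (auto simp: low_modes_def)
      from r2(2)[OF this] have "Cauchy (\<lambda>n. coeff_sin (v (r n)) (fst p) (snd p))"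
        unfolding r_def using LIMSEQ_imp_Cauchy by blast
      moreover have "0 < e / (4 * (real (card (low_modes N)) + 1))" using e by simp
      ultimately show ?thesis by (rule CauchyD)
    qed
    then have "\<forall>p\<in>low_modes N. \<exists>M. \<forall>m\<ge>M. \<forall>n\<ge>M. cmod (coeff_sin (v (r m)) (fst p) (snd p) - coeff_sin (v (r n)) (fst p) (snd p)) < e / (4 * (real (card (low_modes N)) + 1))"
      by simp
    from bchoice[OF this] obtain M where M: "\<forall>p\<in>low_modes N. \<forall>m\<ge>M p. \<forall>n\<ge>M p. cmod (coeff_sin (v (r m)) (fst p) (snd p) - coeff_sin (v (r n)) (fst p) (snd p)) < e / (4 * (real (card (low_modes N)) + 1))" ..
    have "L2_norm W0 (\<lambda>x. v (r m) x - v (r n) x) < e" if mn: "m \<ge> (\<Sum>p\<in>low_modes N. M p)" "n \<ge> (\<Sum>p\<in>low_modes N. M p)" for m n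
    proof -
      have "(\<Sum>(j, l)\<in>low_modes N. cmod (coeff_sin (v (r m)) j l - coeff_sin (v (r n)) j l))
          \<le> (\<Sum>p\<in>low_modes N. e / (4 * (real (card (low_modes N)) + 1)))"
      proof (rule sum_mono)
        fix p assume p: "p \<in> low_modes N"
        have "M p \<le> (\<Sum>p\<in>low_modes N. M p)" by (rule member_le_sum[OF p _ fin]) simp
        then have "m \<ge> M p" "n \<ge> M p" using mn by auto
        with M p have "cmod (coeff_sin (v (r m)) (fst p) (snd p) - coeff_sin (v (r n)) (fst p) (snd p)) < e / (4 * (real (card (low_modes N)) + 1))"
          by blast
        then show "(case p of (j, l) \<Rightarrow> cmod (coeff_sin (v (r m)) j l - coeff_sin (v (r n)) j l)) \<le> e / (4 * (real (card (low_modes N)) + 1))"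
          by (simp add: case_prod_beta)
      qed
      also have "\<dots> \<le> e / 4"
      proof -
        have "real (card (low_modes N)) * (e / (4 * (real (card (low_modes N)) + 1))) = (e / 4) * (real (card (low_modes N)) / (real (card (low_modes N)) + 1))"
          by simp
        also have "\<dots> \<le> (e / 4) * 1" using e by (intro mult_left_mono) auto
        finally show ?thesis by simp
      qed
      finally have low: "(\<Sum>(j, l)\<in>low_modes N. cmod (coeff_sin (v (r m)) j l - coeff_sin (v (r n)) j l)) \<le> e / 4" .
      have "L2_norm W0 (\<lambda>x. v (r m) x - v (r n) x)
          \<le> 2 * (\<Sum>(j, l)\<in>low_modes N. cmod (coeff_sin (v (r m)) j l - coeff_sin (v (r n)) j l))
          + ((Q * L2_norm W0 (v (r m)) + L2_norm W0 (f (r m))) + (Q * L2_norm W0 (v (r n)) + L2_norm W0 (f (r n)))) / \<Lambda>"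
        by (rule low_modes_estimate[OF solr solr f f \<alpha>(1) _ \<alpha>(1) _ \<Lambda>_def \<Lambda>(1)]) (simp_all add: \<alpha>(2))
      also have "\<dots> \<le> 2 * (e / 4) + 2 * (Q + 1) / \<Lambda>"
      proof (intro add_mono mult_left_mono low divide_right_mono)
        show "Q * L2_norm W0 (v (r m)) + L2_norm W0 (f (r m)) + (Q * L2_norm W0 (v (r n)) + L2_norm W0 (f (r n))) \<le> 2 * (Q + 1)"
          unfolding v1 using f1[of "r m"] f1[of "r n"] by simp
      qed (use \<Lambda>(1) in simp_all)
      finally show ?thesis using tail by linarith
    qed
    then show ?thesis by blast
  qed
  \<comment> \<open>Bounds the factor in the energy estimate and, since the solutions are normalised
    and the data at most 1, also their H1 norms.\<close>
  define C where "C = 3 * R + Q + 3"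
  have C: "C > 0" unfolding C_def using R0 Q_nonneg by linarith
  have vb: "H1_norm W0 (v n) \<le> C" for n
  proof -
    have "H1_norm W0 (v n) \<le> (3 * cmod (\<alpha> n) + Q + 2) + L2_norm W0 (f n)"
      using sol_energy[OF solr f, of n] unfolding v1 mult_1_right .
    then show ?thesis using R[of n] f1[of n] unfolding C_def by linarith
  qed
  have H1_Cauchy: "\<exists>N. \<forall>m\<ge>N. \<forall>n\<ge>N. H1_norm W0 (\<lambda>x. v (r m) x - v (r n) x) < e" if e: "e > 0" for e
  proof -
    \<comment> \<open>Bounds what multiplies the difference of exponents. The tolerances below
      contribute e/4 each from the solutions, the data and the exponents.\<close>
    define D where "D = (2 + 2 * R) * C"
    have D: "D > 0" unfolding D_def using R0 C by simp
    have e1: "0 < e / (4 * C)" "0 < e / 8" "0 < e / (4 * D)" using e C D by simp_all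
    obtain N1 where N1: "\<forall>m\<ge>N1. \<forall>n\<ge>N1. L2_norm W0 (\<lambda>x. v (r m) x - v (r n) x) < e / (4 * C)"
      using L2_Cauchy[OF e1(1)] ..
    obtain N2 where N2: "\<forall>n\<ge>N2. L2_norm W0 (f (r n)) < e / 8"
      using order_tendstoD(2)[OF fr e1(2)] unfolding eventually_sequentially ..
    obtain N3 where N3: "\<forall>m\<ge>N3. \<forall>n\<ge>N3. cmod (\<alpha> (r m) - \<alpha> (r n)) < e / (4 * D)"
      using CauchyD[OF LIMSEQ_imp_Cauchy[OF \<alpha>r] e1(3)] ..
    have "H1_norm W0 (\<lambda>x. v (r m) x - v (r n) x) < e" if mn: "m \<ge> max N1 (max N2 N3)" "n \<ge> max N1 (max N2 N3)" for m n
    proof -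
      have b: "L2_norm W0 (\<lambda>x. v (r m) x - v (r n) x) < e / (4 * C)" "L2_norm W0 (f (r m)) < e / 8" "L2_norm W0 (f (r n)) < e / 8"
        "cmod (\<alpha> (r m) - \<alpha> (r n)) < e / (4 * D)"
        using N1 N2 N3 mn by auto
      have "H1_norm W0 (\<lambda>x. v (r m) x - v (r n) x) \<le> (3 * cmod (\<alpha> (r m)) + Q + 2) * L2_norm W0 (\<lambda>x. v (r m) x - v (r n) x)
        + (L2_norm W0 (f (r m)) + L2_norm W0 (f (r n)) + cmod (\<alpha> (r m) - \<alpha> (r n)) * (2 + cmod (\<alpha> (r m)) + cmod (\<alpha> (r n))) * H1_norm W0 (v (r n)))"
        by (rule sol_diff_energy[OF solr solr f f])
      also have "\<dots> \<le> C * (e / (4 * C)) + (e / 8 + e / 8 + (e / (4 * D)) * (2 + 2 * R) * C)"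
      proof -
        have t1: "(3 * cmod (\<alpha> (r m)) + Q + 2) * L2_norm W0 (\<lambda>x. v (r m) x - v (r n) x) \<le> C * (e / (4 * C))"
          by (rule mult_mono) (use R[of "r m"] b(1) C in \<open>simp_all add: C_def\<close>)
        have t2: "cmod (\<alpha> (r m) - \<alpha> (r n)) * (2 + cmod (\<alpha> (r m)) + cmod (\<alpha> (r n))) \<le> (e / (4 * D)) * (2 + 2 * R)"
          by (rule mult_mono) (use R[of "r m"] R[of "r n"] b(4) e1(3) in simp_all)
        have t3: "cmod (\<alpha> (r m) - \<alpha> (r n)) * (2 + cmod (\<alpha> (r m)) + cmod (\<alpha> (r n))) * H1_norm W0 (v (r n)) \<le> (e / (4 * D)) * (2 + 2 * R) * C"
        proof (rule mult_mono[OF t2 vb])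
          show "0 \<le> (e / (4 * D)) * (2 + 2 * R)"
            by (rule mult_nonneg_nonneg[OF less_imp_le[OF e1(3)]]) (use R0 in simp)
        qed simp
        show ?thesis using t1 t3 b(2,3) by linarith
      qed
      also have "\<dots> = e / 4 + (e / 8 + e / 8 + e / 4)"
      proof -
        have "(e / (4 * D)) * (2 + 2 * R) * C = (e / (4 * D)) * D" by (simp only: D_def mult.assoc)
        also have "\<dots> = e / 4" using D by simp
        finally show ?thesis using C by simp
      qed
      also have "\<dots> < e" using e by simp
      finally show ?thesis .
    qed
    then show ?thesis by blast
  qed
  obtain u where u: "u \<in> H1 W0" "(\<lambda>n. H1_norm W0 (\<lambda>x. v (r n) x - u x)) \<longlonglongrightarrow> 0"
    by (rule H1_complete[of "\<lambda>n. v (r n)", OF vH H1_Cauchy], assumption, rule that)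
  have "qsol a (\<lambda>_. 0) u" by (rule qsol_limit[OF sol f \<alpha>r fr u(2,1)])
  moreover have "L2_norm W0 u = 1"
    using L2_norm_tendsto[OF H1_L2[OF vH] H1_L2[OF u(1)] H1_tendsto_L2(1)[OF vH u]] unfolding v1
    by (simp add: LIMSEQ_const_iff)
  ultimately show ?thesis using that Ima by blast
qed

end

section \<open>Uniform bounds and the exponential rate\<close>

section \<open>Bounds on the circles\<close>

context helmholtz
begin

lemma qsol_bound_fixed_circle:
  assumes disj: "sphere 0 (exp (- y)) \<inter> exceptional_set k q = {}"
  shows "\<exists>C\<ge>0. \<forall>\<alpha> f v. \<bar>Re \<alpha>\<bar> \<le> pi \<longrightarrow> Im \<alpha> = y \<longrightarrow> f \<in> L2 W0 \<longrightarrow> qsol \<alpha> f v \<longrightarrow> L2_norm W0 v \<le> C * L2_norm W0 f"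
proof (rule ccontr)
  assume neg: "\<not> ?thesis"
  have "\<forall>n. \<exists>p. \<bar>Re (fst p)\<bar> \<le> pi \<and> Im (fst p) = y \<and> fst (snd p) \<in> L2 W0 \<and> qsol (fst p) (fst (snd p)) (snd (snd p))
      \<and> (real n + 1) * L2_norm W0 (fst (snd p)) < L2_norm W0 (snd (snd p))"
  proof
    fix n :: nat
    have "\<not> (\<forall>\<alpha> f v. \<bar>Re \<alpha>\<bar> \<le> pi \<longrightarrow> Im \<alpha> = y \<longrightarrow> f \<in> L2 W0 \<longrightarrow> qsol \<alpha> f v \<longrightarrow> L2_norm W0 v \<le> (real n + 1) * L2_norm W0 f)"
    proof
      assume h: "\<forall>\<alpha> f v. \<bar>Re \<alpha>\<bar> \<le> pi \<longrightarrow> Im \<alpha> = y \<longrightarrow> f \<in> L2 W0 \<longrightarrow> qsol \<alpha> f v \<longrightarrow> L2_norm W0 v \<le> (real n + 1) * L2_norm W0 f"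
      have "0 \<le> real n + 1" by simp
      with h neg show False by blast
    qed
    then obtain \<alpha> f v where "\<bar>Re \<alpha>\<bar> \<le> pi" "Im \<alpha> = y" "f \<in> L2 W0" "qsol \<alpha> f v" "(real n + 1) * L2_norm W0 f < L2_norm W0 v"
      by (auto simp: not_le)
    then show "\<exists>p. \<bar>Re (fst p)\<bar> \<le> pi \<and> Im (fst p) = y \<and> fst (snd p) \<in> L2 W0 \<and> qsol (fst p) (fst (snd p)) (snd (snd p))
      \<and> (real n + 1) * L2_norm W0 (fst (snd p)) < L2_norm W0 (snd (snd p))"
      by (intro exI[of _ "(\<alpha>, f, v)"]) simp
  qed
  from choice[OF this] obtain p where p: "\<forall>n. \<bar>Re (fst (p n))\<bar> \<le> pi \<and> Im (fst (p n)) = y \<and> fst (snd (p n)) \<in> L2 W0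
      \<and> qsol (fst (p n)) (fst (snd (p n))) (snd (snd (p n)))
      \<and> (real n + 1) * L2_norm W0 (fst (snd (p n))) < L2_norm W0 (snd (snd (p n)))" ..
  define \<alpha> f v where "\<alpha> n = fst (p n)" and "f n = fst (snd (p n))" and "v n = snd (snd (p n))" for n
  have P: "\<bar>Re (\<alpha> n)\<bar> \<le> pi" "Im (\<alpha> n) = y" "f n \<in> L2 W0" "qsol (\<alpha> n) (f n) (v n)"
    "(real n + 1) * L2_norm W0 (f n) < L2_norm W0 (v n)" for n
    using p unfolding \<alpha>_def f_def v_def by auto
  have vpos: "0 < L2_norm W0 (v n)" for n
    by (rule le_less_trans[OF _ P(5)[of n]]) simp
  define c where "c n = complex_of_real (1 / L2_norm W0 (v n))" for n
  have cn: "cmod (c n) = 1 / L2_norm W0 (v n)" for n unfolding c_def norm_of_real using vpos[of n] by simp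
  \<comment> \<open>The failure of the constant n + 1 means precisely that the rescaled data have
    norm below 1 / (n + 1).\<close>
  have F: "L2_norm W0 (\<lambda>x. c n * f n x) \<le> 1 / (real n + 1)" for n
    unfolding L2_norm_cmult cn using P(5)[of n] vpos[of n] by (simp add: field_simps)
  have z: "(\<lambda>n. 1 / (real n + 1)) \<longlonglongrightarrow> 0"
    using LIMSEQ_inverse_real_of_nat by (simp add: inverse_eq_divide add.commute)
  obtain a u where au: "Im a = y" "qsol a (\<lambda>_. 0) u" "L2_norm W0 u = 1"
  proof (rule qsol_compactness[of \<alpha> "\<lambda>n x. c n * f n x" "\<lambda>n x. c n * v n x" y])
    show "qsol (\<alpha> n) (\<lambda>x. c n * f n x) (\<lambda>x. c n * v n x)" for n by (rule qsol_cmult[OF P(4)])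
    show "(\<lambda>x. c n * f n x) \<in> L2 W0" for n by (rule L2_cmult[OF P(3)])
    show "L2_norm W0 (\<lambda>x. c n * v n x) = 1" for n unfolding L2_norm_cmult cn using vpos[of n] by simp
    show "(\<lambda>n. L2_norm W0 (\<lambda>x. c n * f n x)) \<longlonglongrightarrow> 0"
      by (rule tendsto_sandwich[OF _ _ tendsto_const z]) (simp, intro always_eventually allI F)
    have "1 / (real n + 1) \<le> 1" for n by simp
    then show "L2_norm W0 (\<lambda>x. c n * f n x) \<le> 1" for n using F[of n] order_trans by blast
  qed (use P that in auto)
  have uL: "u \<in> L2 W0" by (rule sol_L2[OF qsol_sol[OF au(2)]])
  have "\<not> (AE x in lebesgue_on W0. qexp a x * u x = 0)"
  proof
    assume "AE x in lebesgue_on W0. qexp a x * u x = 0"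
    then have "AE x in lebesgue_on W0. u x = 0" by eventually_elim (simp add: qexp_def)
    then show False using L2_norm_zero_iff[OF uL] au(3) by simp
  qed
  then have "exp (\<i> * a) \<in> exceptional_set k q"
    unfolding exceptional_set_def using qsol_imp_qp_solution[OF au(2)] by blast
  moreover have "exp (\<i> * a) \<in> sphere 0 (exp (- y))" using au(1) by simp
  ultimately show False using disj by blast
qed

text \<open>Three times this quantity controls the H1 norm of exp (i \<alpha> x1) v up to the
  supremum of the exponential, with a constant that does not depend on \<alpha>.\<close>

abbreviation energy :: "complex \<Rightarrow> (real \<times> real \<Rightarrow> complex) \<Rightarrow> real" where
  "energy \<alpha> v \<equiv> H1_norm W0 v + cmod \<alpha> * L2_norm W0 v"

lemma energy_bound_fixed_circle:
  assumes disj: "sphere 0 (exp (- y)) \<inter> exceptional_set k q = {}"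
  shows "\<exists>C\<ge>0. \<forall>\<alpha> f v. \<bar>Re \<alpha>\<bar> \<le> pi \<longrightarrow> Im \<alpha> = y \<longrightarrow> f \<in> L2 W0 \<longrightarrow> qsol \<alpha> f v \<longrightarrow> energy \<alpha> v \<le> C * L2_norm W0 f"
proof -
  obtain C where C: "C \<ge> 0" "\<And>\<alpha> f v. \<bar>Re \<alpha>\<bar> \<le> pi \<Longrightarrow> Im \<alpha> = y \<Longrightarrow> f \<in> L2 W0 \<Longrightarrow> qsol \<alpha> f v \<Longrightarrow> L2_norm W0 v \<le> C * L2_norm W0 f"
    using qsol_bound_fixed_circle[OF disj] by blast
  \<comment> \<open>The 4 collects the 3 of the energy estimate and the extra |\<alpha>| in
    \<open>energy\<close>; here |\<alpha>| <= pi + |y|.\<close>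
  define R where "R = 4 * (pi + \<bar>y\<bar>) + Q + 2"
  have R0: "0 \<le> R" unfolding R_def using Q_nonneg by simp
  have "energy \<alpha> v \<le> (R * C + 1) * L2_norm W0 f"
    if h: "\<bar>Re \<alpha>\<bar> \<le> pi" "Im \<alpha> = y" "f \<in> L2 W0" "qsol \<alpha> f v" for \<alpha> f v
  proof -
    have "4 * cmod \<alpha> + Q + 2 \<le> R" using cmod_le[of \<alpha>] h(1,2) unfolding R_def by simp
    then have "(4 * cmod \<alpha> + Q + 2) * L2_norm W0 v \<le> R * (C * L2_norm W0 f)"
      using C(2)[OF h] R0 by (intro mult_mono) auto
    moreover have "energy \<alpha> v \<le> (4 * cmod \<alpha> + Q + 2) * L2_norm W0 v + L2_norm W0 f"
      using sol_energy[OF qsol_sol[OF h(4)] h(3)] by (simp add: algebra_simps)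
    ultimately show ?thesis by (simp add: algebra_simps)
  qed
  moreover have "0 \<le> R * C + 1" using R0 C(1) by simp
  ultimately show ?thesis by blast
qed

text \<open>The root mean square of m and m + 1, equal to |ln |z|| / pi on both circles with index
  m.\<close>

definition level :: "nat \<Rightarrow> real" where
  "level m = sqrt (((real m)\<^sup>2 + (real m + 1)\<^sup>2) / 2)"

lemma level_bounds: "real m \<le> level m" "level m \<le> real m + 1" "0 \<le> level m"
proof -
  show "real m \<le> level m" unfolding level_def
    by (rule real_le_rsqrt) (simp add: power2_eq_square algebra_simps)
  show "level m \<le> real m + 1" unfolding level_def
    by (rule real_le_lsqrt) (simp_all add: power2_eq_square algebra_simps)
  show "0 \<le> level m" by (simp add: level_def)
qed

text \<open>On these circles the symbol is bounded below by \<open>pi\<^sup>2 (m + 1/2)\<close>, so for large \<open>m\<close> the potential is a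
  small perturbation.\<close>

lemma energy_bound_large:
  assumes m: "2 * Q \<le> pi\<^sup>2 * (real m + 1/2)" and \<alpha>: "\<bar>Re \<alpha>\<bar> \<le> pi" "\<bar>Im \<alpha>\<bar> = pi * level m"
    and f: "f \<in> L2 W0" and sol: "sol \<alpha> f v"
  shows "energy \<alpha> v \<le> 20 * L2_norm W0 f"
proof -
  define \<Lambda> where "\<Lambda> = pi\<^sup>2 * (real m + 1/2)"
  let ?v = "L2_norm W0 v" and ?f = "L2_norm W0 f"
  have pi4: "4 \<le> pi\<^sup>2" using power_mono[of 2 pi 2] pi_ge_two by simp
  have "4 * (1/2) \<le> \<Lambda>" unfolding \<Lambda>_def by (rule mult_mono[OF pi4]) auto
  then have \<Lambda>2: "2 \<le> \<Lambda>" by simp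
  have "?v \<le> (Q * ?v + ?f) / \<Lambda>"
    by (rule sol_resolvent_bound[OF sol f])
      (use \<Lambda>2 symbol_large[OF \<alpha>(2)[unfolded level_def]] in \<open>auto simp: \<Lambda>_def\<close>)
  then have "\<Lambda> * ?v \<le> Q * ?v + ?f" using \<Lambda>2 by (simp add: field_simps)
  \<comment> \<open>The potential takes up at most half of the left-hand side and is absorbed
    there.\<close>
  moreover have "2 * (Q * ?v) \<le> \<Lambda> * ?v"
    using mult_right_mono[OF m L2_norm_nonneg[of W0 v]] unfolding \<Lambda>_def by simp
  ultimately have v: "\<Lambda> * ?v \<le> 2 * ?f" by linarith
  \<comment> \<open>This is where the growth of |\<alpha>| is matched by the gap in the symbol: both
    sides grow linearly in m.\<close>
  have "cmod \<alpha> \<le> 2 * \<Lambda>"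
  proof -
    have "cmod \<alpha> \<le> pi + pi * level m" using cmod_le[of \<alpha>] \<alpha> by linarith
    also have "\<dots> \<le> pi + pi * (real m + 1)" using level_bounds(2)[of m] by (intro add_mono mult_left_mono) auto
    also have "\<dots> = pi * (real m + 2)" by (simp add: algebra_simps)
    also have "\<dots> \<le> pi * (2 * pi * (real m + 1/2))"
    proof (rule mult_left_mono)
      have "2 * 2 * (real m + 1/2) \<le> 2 * pi * (real m + 1/2)" using pi_ge_two by (intro mult_right_mono) auto
      then show "real m + 2 \<le> 2 * pi * (real m + 1/2)" by simp
    qed simp
    also have "\<dots> = 2 * \<Lambda>" unfolding \<Lambda>_def by (simp add: power2_eq_square)
    finally show ?thesis .
  qed
  \<comment> \<open>The sum 19/2 = 8 + 1/2 + 1 comes from |\<alpha>| <= 2 \<Lambda>, Q <= \<Lambda>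
    / 2 and 2 <= \<Lambda>. Together with \<Lambda> ||v|| <= 2 ||f|| it yields 19 + 1 = 20.\<close>
  then have "4 * cmod \<alpha> + Q + 2 \<le> (19/2) * \<Lambda>" using m \<Lambda>2 unfolding \<Lambda>_def by linarith
  then have "(4 * cmod \<alpha> + Q + 2) * ?v \<le> (19/2) * \<Lambda> * ?v" by (rule mult_right_mono) simp
  moreover have "energy \<alpha> v \<le> (4 * cmod \<alpha> + Q + 2) * ?v + ?f"
    using sol_energy[OF sol f] by (simp add: algebra_simps)
  ultimately show ?thesis using v by linarith
qed

lemma energy_bound_uniform:
  "\<exists>C>0. \<forall>m y \<alpha> f v. \<bar>y\<bar> = pi * level m \<longrightarrow> sphere 0 (exp (- y)) \<inter> exceptional_set k q = {} \<longrightarrow>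
    \<bar>Re \<alpha>\<bar> \<le> pi \<longrightarrow> Im \<alpha> = y \<longrightarrow> f \<in> L2 W0 \<longrightarrow> qsol \<alpha> f v \<longrightarrow> energy \<alpha> v \<le> C * L2_norm W0 f"
proof -
  \<comment> \<open>The constants are collected into a total function of y, with 0 where the circle
    meets the exceptional set.\<close>
  have "\<forall>y. \<exists>C. C \<ge> 0 \<and> (sphere 0 (exp (- y)) \<inter> exceptional_set k q = {} \<longrightarrow> (\<forall>\<alpha> f v. \<bar>Re \<alpha>\<bar> \<le> pi \<longrightarrow> Im \<alpha> = y \<longrightarrow> f \<in> L2 W0 \<longrightarrow>
      qsol \<alpha> f v \<longrightarrow> energy \<alpha> v \<le> C * L2_norm W0 f))"
  proof
    fix y
    show "\<exists>C. C \<ge> 0 \<and> (sphere 0 (exp (- y)) \<inter> exceptional_set k q = {} \<longrightarrow> (\<forall>\<alpha> f v. \<bar>Re \<alpha>\<bar> \<le> pi \<longrightarrow> Im \<alpha> = y \<longrightarrow> f \<in> L2 W0 \<longrightarrow>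
      qsol \<alpha> f v \<longrightarrow> energy \<alpha> v \<le> C * L2_norm W0 f))"
    proof (cases "sphere 0 (exp (- y)) \<inter> exceptional_set k q = {}")
      case True
      from energy_bound_fixed_circle[OF True] show ?thesis by blast
    qed (intro exI[of _ 0], simp)
  qed
  from choice[OF this] obtain c where c: "\<forall>y. c y \<ge> 0 \<and> (sphere 0 (exp (- y)) \<inter> exceptional_set k q = {} \<longrightarrow> (\<forall>\<alpha> f v. \<bar>Re \<alpha>\<bar> \<le> pi \<longrightarrow> Im \<alpha> = y \<longrightarrow> f \<in> L2 W0 \<longrightarrow>
      qsol \<alpha> f v \<longrightarrow> energy \<alpha> v \<le> c y * L2_norm W0 f))" ..
  have c0: "0 \<le> c y" for y using c by blast
  \<comment> \<open>From \<open>m0\<close> on the gap pi^2 (m + 1/2) exceeds 2 Q.\<close>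
  obtain m0 :: nat where m0: "2 * Q < real m0" using reals_Archimedean2 by blast
  \<comment> \<open>The 20 serves all large m and the sum the finitely many others; the two signs
    stand for the inner and the outer circle.\<close>
  define C where "C = 20 + (\<Sum>m<m0. c (pi * level m) + c (- (pi * level m)))"
  have s0: "0 \<le> (\<Sum>m<m0. c (pi * level m) + c (- (pi * level m)))"
    by (intro sum_nonneg add_nonneg_nonneg c0)
  have "energy \<alpha> v \<le> C * L2_norm W0 f"
    if h: "\<bar>y\<bar> = pi * level m" "sphere 0 (exp (- y)) \<inter> exceptional_set k q = {}"
      "\<bar>Re \<alpha>\<bar> \<le> pi" "Im \<alpha> = y" "f \<in> L2 W0" "qsol \<alpha> f v" for m y \<alpha> f v
  proof (cases "m < m0")
    case True
    have "c (pi * level m) + c (- (pi * level m)) \<le> (\<Sum>m<m0. c (pi * level m) + c (- (pi * level m)))"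
      by (rule member_le_sum[of m]) (use True c0 in \<open>auto intro: add_nonneg_nonneg\<close>)
    moreover have "c y \<le> c (pi * level m) + c (- (pi * level m))"
    proof (cases "0 \<le> y")
      case True then have "y = pi * level m" using h(1) by simp
      then show ?thesis using c0[of "- (pi * level m)"] by simp
    next
      case False then have "y = - (pi * level m)" using h(1) by simp
      then show ?thesis using c0[of "pi * level m"] by simp
    qed
    ultimately have "c y \<le> C" unfolding C_def by linarith
    then have "c y * L2_norm W0 f \<le> C * L2_norm W0 f" by (rule mult_right_mono) simp
    moreover have "energy \<alpha> v \<le> c y * L2_norm W0 f" using c h by blast
    ultimately show ?thesis by linarith
  next
    case False
    have "1 * (real m + 1/2) \<le> pi\<^sup>2 * (real m + 1/2)"
      using power_mono[of 2 pi 2] pi_ge_two by (intro mult_right_mono) auto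
    then have "real m + 1/2 \<le> pi\<^sup>2 * (real m + 1/2)" unfolding mult_1_left .
    moreover have "real m0 \<le> real m" using False by simp
    ultimately have "2 * Q \<le> pi\<^sup>2 * (real m + 1/2)" using m0 by linarith
    from energy_bound_large[OF this h(3) _ h(5) qsol_sol[OF h(6)]] have "energy \<alpha> v \<le> 20 * L2_norm W0 f"
      using h(1,4) by simp
    moreover have "20 * L2_norm W0 f \<le> C * L2_norm W0 f" by (rule mult_right_mono) (use s0 in \<open>simp_all add: C_def\<close>)
    ultimately show ?thesis by linarith
  qed
  moreover have "0 < C" unfolding C_def using s0 by linarith
  ultimately show ?thesis by blast
qed

text \<open>Passing from w to v and back costs the supremum of each exponential. One of the two
  suprema is 1 and the other exp |y|, which is the single exponential factor in the bound.\<close>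

lemma qp_solution_bound:
  obtains C where "C > 0" "\<And>m y g z w. \<bar>y\<bar> = pi * level m \<Longrightarrow> sphere 0 (exp (- y)) \<inter> exceptional_set k q = {} \<Longrightarrow>
    g \<in> L2 W0 \<Longrightarrow> z \<in> sphere 0 (exp (- y)) \<Longrightarrow> qp_solution k q g z w \<Longrightarrow>
    w \<in> H1 W0 \<and> H1_norm W0 w \<le> C * exp (pi * level m) * L2_norm W0 g"
proof -
  obtain C where C: "C > 0" "\<And>m y \<alpha> f v. \<bar>y\<bar> = pi * level m \<Longrightarrow> sphere 0 (exp (- y)) \<inter> exceptional_set k q = {} \<Longrightarrow>
    \<bar>Re \<alpha>\<bar> \<le> pi \<Longrightarrow> Im \<alpha> = y \<Longrightarrow> f \<in> L2 W0 \<Longrightarrow> qsol \<alpha> f v \<Longrightarrow> energy \<alpha> v \<le> C * L2_norm W0 f"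
    using energy_bound_uniform by blast
  have "w \<in> H1 W0 \<and> H1_norm W0 w \<le> (3 * C) * exp (pi * level m) * L2_norm W0 g"
    if y: "\<bar>y\<bar> = pi * level m" "sphere 0 (exp (- y)) \<inter> exceptional_set k q = {}" and g: "g \<in> L2 W0"
      and z: "z \<in> sphere 0 (exp (- y))" and w: "qp_solution k q g z w" for m y g z w
  proof
    \<comment> \<open>The principal logarithm gives |Re \<alpha>| <= pi and Im \<alpha> = - ln |z| =
      y.\<close>
    define \<alpha> where "\<alpha> = - \<i> * Ln z"
    have cz: "cmod z = exp (- y)" using z by simp
    have z0: "z \<noteq> 0" using cz by auto
    have e: "exp (\<i> * \<alpha>) = z" unfolding \<alpha>_def using z0 by (simp add: mult.assoc[symmetric])
    have Re: "\<bar>Re \<alpha>\<bar> \<le> pi" unfolding \<alpha>_def using mpi_less_Im_Ln[OF z0] Im_Ln_le_pi[OF z0] by simp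
    have Im: "Im \<alpha> = y" unfolding \<alpha>_def using Re_Ln[OF z0] cz by simp
    define f where "f x = qexp (- \<alpha>) x * g x" for x
    define v where "v x = qexp (- \<alpha>) x * w x" for x
    have f: "f \<in> L2 W0" "L2_norm W0 f \<le> max 1 (exp y) * L2_norm W0 g"
      unfolding f_def[abs_def] using qexp_L2[OF g, of "- \<alpha>"] Im by simp_all
    have sol: "qsol \<alpha> f v"
      unfolding f_def[abs_def] v_def[abs_def] by (rule qp_solution_imp_qsol) (simp add: e w)
    have vH: "v \<in> H1 W0" by (rule sol_H1[OF qsol_sol[OF sol]])
    have wv: "w = (\<lambda>x. qexp \<alpha> x * v x)" unfolding v_def qexp_mult_assoc by simp
    show "w \<in> H1 W0" unfolding wv by (rule H1_mult[OF smooth_qexp vH])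
    have "0 \<le> cmod \<alpha> * L2_norm W0 v" by simp
    then have "3 * H1_norm W0 v + cmod \<alpha> * L2_norm W0 v \<le> 3 * (C * L2_norm W0 f)"
      using C(2)[OF y Re Im f(1) sol] by linarith
    moreover have "H1_norm W0 w \<le> max 1 (exp (- y)) * (3 * H1_norm W0 v + cmod \<alpha> * L2_norm W0 v)"
      unfolding wv using H1_norm_qexp[OF vH, of \<alpha>] Im by simp
    ultimately have "H1_norm W0 w \<le> max 1 (exp (- y)) * (3 * (C * L2_norm W0 f))"
      by (meson le_max_iff_disj mult_left_mono order_trans zero_le_one)
    also have "\<dots> \<le> max 1 (exp (- y)) * (3 * (C * (max 1 (exp y) * L2_norm W0 g)))"
      using f(2) C(1) by (intro mult_left_mono) auto
    also have "\<dots> = (3 * C) * (max 1 (exp (- y)) * max 1 (exp y)) * L2_norm W0 g" by simp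
    also have "max 1 (exp (- y)) * max 1 (exp y) = exp (pi * level m)"
      unfolding y(1)[symmetric] by (cases "0 \<le> y") (simp_all add: max_def)
    finally show "H1_norm W0 w \<le> (3 * C) * exp (pi * level m) * L2_norm W0 g" .
  qed
  moreover have "0 < 3 * C" using C(1) by simp
  ultimately show ?thesis using that by blast
qed

text \<open>Where no solution exists \<open>qp_sol\<close> is 0, so a bound for solutions bounds the
  integrand on the whole circle.\<close>

lemma qp_sol_integral_bound:
  assumes C: "C > 0" "\<And>z w. z \<in> sphere 0 r \<Longrightarrow> qp_solution k q g z w \<Longrightarrow> w \<in> H1 W0 \<and> H1_norm W0 w \<le> C" and r: "r > 0"
  shows "H1_norm W0 (V_contour_integral (circlepath 0 r) (\<lambda>z x. qp_sol k q g z x * z powi p)) \<le> 2 * pi * r * (r powi p * C)"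
proof (rule V_contour_integral_bound[OF r])
  show "0 \<le> r powi p * C" using r C(1) by simp
  fix z :: complex assume z: "z \<in> sphere 0 r"
  have q: "qp_sol k q g z \<in> H1 W0 \<and> H1_norm W0 (qp_sol k q g z) \<le> C"
  proof (cases "\<exists>w. qp_solution k q g z w")
    case True
    then have "qp_solution k q g z (qp_sol k q g z)"
      unfolding qp_sol_def if_P[OF True] by (rule someI_ex)
    then show ?thesis by (rule C(2)[OF z])
  next
    case False
    then have "qp_sol k q g z = (\<lambda>_. 0)" unfolding qp_sol_def by (simp only: if_False)
    then show ?thesis using C(1) H1_zero by simp
  qed
  have "cmod (z powi p) = r powi p" using z by (simp add: norm_power_int)
  then have "H1_norm W0 (\<lambda>x. z powi p * qp_sol k q g z x) \<le> r powi p * C"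
    unfolding H1_norm_cmult[OF conjunct1[OF q]] using q r by (intro mult_mono) auto
  then show "(\<lambda>x. qp_sol k q g z x * z powi p) \<in> H1 W0 \<and> H1_norm W0 (\<lambda>x. qp_sol k q g z x * z powi p) \<le> r powi p * C"
    using H1_cmult[OF conjunct1[OF q], of "z powi p"] by (simp only: mult.commute)
qed

lemma powi_exp: "exp t powi p = exp (real_of_int p * t)" for t :: real
  by (simp add: exp_power_int mult.commute)

theorem contour_integral_bounds:
  "\<exists>C>0. \<forall>n::nat. n \<ge> 1 \<longrightarrow> (\<forall>g\<in>L2 W0. \<forall>m::nat.
    (sphere 0 (r_m m) \<inter> exceptional_set k q = {} \<longrightarrow>
       H1_norm W0 (I_plus k q n (r_m m) g) \<le> C * exp (- pi * (real n - 1) * real m) * L2_norm W0 g) \<and>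
    (sphere 0 (R_m m) \<inter> exceptional_set k q = {} \<longrightarrow>
       H1_norm W0 (I_minus k q n (R_m m) g) \<le> C * exp (- pi * (real n - 1) * real m) * L2_norm W0 g))"
proof -
  obtain C where C: "C > 0" "\<And>m y g z w. \<bar>y\<bar> = pi * level m \<Longrightarrow> sphere 0 (exp (- y)) \<inter> exceptional_set k q = {} \<Longrightarrow>
    g \<in> L2 W0 \<Longrightarrow> z \<in> sphere 0 (exp (- y)) \<Longrightarrow> qp_solution k q g z w \<Longrightarrow>
    w \<in> H1 W0 \<and> H1_norm W0 w \<le> C * exp (pi * level m) * L2_norm W0 g"
    by (rule qp_solution_bound, rule that)
  have rR: "r_m m = exp (- (pi * level m))" "R_m m = exp (- (- (pi * level m)))" for m
    by (simp_all add: r_m_def R_m_def level_def)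
  have lev: "0 \<le> pi * level m" for m using level_bounds(3)[of m] by simp
  \<comment> \<open>Both integrals at once. The condition on \<open>p\<close> says that
    circumference and power together contribute |z|^(p + 1) = exp (- pi n level): either y = pi
    level and p = n - 1, or y = - pi level and p = - n - 1.\<close>
  have key: "H1_norm W0 (V_contour_integral (circlepath 0 (exp (- y))) (\<lambda>z x. qp_sol k q g z x * z powi p))
      \<le> (2 * pi * C) * exp (- pi * (real n - 1) * real m) * L2_norm W0 g"
    if n: "n \<ge> 1" and g: "g \<in> L2 W0" and y: "\<bar>y\<bar> = pi * level m" and disj: "sphere 0 (exp (- y)) \<inter> exceptional_set k q = {}"
      and p: "- y + real_of_int p * (- y) = - (pi * level m) * real n" for n m y p g
  proof -
    \<comment> \<open>The slack \<open>e\<close> makes the bound strictly positive even when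
      \<open>g\<close> vanishes almost everywhere; it tends to zero afterwards.\<close>
    have B: "w \<in> H1 W0 \<and> H1_norm W0 w \<le> C * exp (pi * level m) * L2_norm W0 g + e"
      if "z \<in> sphere 0 (exp (- y))" "qp_solution k q g z w" "e > 0" for z w e
      using C(2)[OF y disj g that(1,2)] that(3) by auto
    have D: "(2 * pi * exp (- y)) * (exp (- y) powi p) = 2 * pi * exp (- (pi * level m) * real n)"
      unfolding powi_exp p[symmetric] exp_add by simp
    have "H1_norm W0 (V_contour_integral (circlepath 0 (exp (- y))) (\<lambda>z x. qp_sol k q g z x * z powi p))
      \<le> 2 * pi * exp (- (pi * level m) * real n) * (C * exp (pi * level m) * L2_norm W0 g) + d" if d: "d > 0" for d
    proof -
      define E where "E = 2 * pi * exp (- (pi * level m) * real n)"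
      have E: "E > 0" by (simp add: E_def)
      have "0 < C * exp (pi * level m) * L2_norm W0 g + d / E"
        using C(1) d E by (intro add_nonneg_pos) auto
      moreover have "0 < d / E" using d E by simp
      ultimately have "H1_norm W0 (V_contour_integral (circlepath 0 (exp (- y))) (\<lambda>z x. qp_sol k q g z x * z powi p))
          \<le> 2 * pi * exp (- y) * (exp (- y) powi p * (C * exp (pi * level m) * L2_norm W0 g + d / E))"
        by (intro qp_sol_integral_bound B) auto
      also have "\<dots> = E * (C * exp (pi * level m) * L2_norm W0 g + d / E)"
        unfolding E_def D[symmetric] by (simp only: mult.assoc)
      also have "\<dots> = E * (C * exp (pi * level m) * L2_norm W0 g) + d" using E by (simp add: distrib_left)
      finally show ?thesis unfolding E_def .
    qed
    then have "H1_norm W0 (V_contour_integral (circlepath 0 (exp (- y))) (\<lambda>z x. qp_sol k q g z x * z powi p))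
      \<le> 2 * pi * exp (- (pi * level m) * real n) * (C * exp (pi * level m) * L2_norm W0 g)"
      by (rule field_le_epsilon)
    also have "\<dots> = (2 * pi * C) * (exp (- (pi * level m) * real n) * exp (pi * level m)) * L2_norm W0 g" by simp
    \<comment> \<open>The cost exp (pi level) of the exponential factors consumes one of the n
      powers and leaves n - 1.\<close>
    also have "exp (- (pi * level m) * real n) * exp (pi * level m) = exp (- (pi * (real n - 1)) * level m)"
      unfolding exp_add[symmetric] by (simp add: algebra_simps)
    also have "(2 * pi * C) * exp (- (pi * (real n - 1)) * level m) * L2_norm W0 g
        \<le> (2 * pi * C) * exp (- (pi * (real n - 1)) * real m) * L2_norm W0 g"
    proof -
      have "pi * (real n - 1) * real m \<le> pi * (real n - 1) * level m"
        using n level_bounds(1)[of m] by (intro mult_left_mono) auto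
      then show ?thesis using C(1) by (intro mult_right_mono mult_left_mono) auto
    qed
    finally show ?thesis by simp
  qed
  show ?thesis
  proof (intro exI[of _ "2 * pi * C"] conjI allI impI ballI)
    show "0 < 2 * pi * C" using C(1) by simp
  next
    fix n m :: nat and g assume n: "n \<ge> 1" and g: "g \<in> L2 W0" and d: "sphere 0 (r_m m) \<inter> exceptional_set k q = {}"
    show "H1_norm W0 (I_plus k q n (r_m m) g) \<le> 2 * pi * C * exp (- pi * (real n - 1) * real m) * L2_norm W0 g"
      unfolding I_plus_def rR(1)
      by (rule key[OF n g _ d[unfolded rR(1)]]) (use lev[of m] in \<open>simp_all add: algebra_simps\<close>)
  next
    fix n m :: nat and g assume n: "n \<ge> 1" and g: "g \<in> L2 W0" and d: "sphere 0 (R_m m) \<inter> exceptional_set k q = {}"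
    show "H1_norm W0 (I_minus k q n (R_m m) g) \<le> 2 * pi * C * exp (- pi * (real n - 1) * real m) * L2_norm W0 g"
      unfolding I_minus_def rR(2)
      by (rule key[OF n g _ d[unfolded rR(2)]]) (use lev[of m] in \<open>simp_all add: algebra_simps\<close>)
  qed
qed

end

theorem theorem6:
  fixes k c :: real and q :: "real \<times> real \<Rightarrow> real"
  assumes "k > 0"
    and "q \<in> borel_measurable (lebesgue_on W)"
    and "\<exists>M. AE x in lebesgue_on W. \<bar>q x\<bar> \<le> M"
    and "AE x in lebesgue_on W. q (fst x + 1, snd x) = q x"
    and "c > 0"
    and "AE x in lebesgue_on W. c \<le> q x"
  shows "\<exists>C>0. \<forall>n::nat. n \<ge> 1 \<longrightarrow> (\<forall>g\<in>L2 W0. \<forall>m::nat.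
    (sphere 0 (r_m m) \<inter> exceptional_set k q = {} \<longrightarrow>
       H1_norm W0 (I_plus k q n (r_m m) g) \<le> C * exp (- pi * (real n - 1) * real m) * L2_norm W0 g) \<and>
    (sphere 0 (R_m m) \<inter> exceptional_set k q = {} \<longrightarrow>
       H1_norm W0 (I_minus k q n (R_m m) g) \<le> C * exp (- pi * (real n - 1) * real m) * L2_norm W0 g))"
proof -
  have sub: "W0 \<subseteq> W" by (auto simp: W0_def W_def)
  have "open W" unfolding W_def by (intro open_Times) auto
  then have W: "W \<in> sets lebesgue" by (simp add: borel_open)
  obtain M where "AE x in lebesgue_on W. \<bar>q x\<bar> \<le> M" using assms(3) by blast
  then have "AE x in lebesgue. x \<in> W \<longrightarrow> \<bar>q x\<bar> \<le> M" using W by (simp add: AE_restrict_space_iff)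
  \<comment> \<open>Taking \<open>max M 0\<close> supplies the nonnegative bound of the locale
    without discussing the sign of \<open>M\<close>.\<close>
  then have "AE x in lebesgue. x \<in> W0 \<longrightarrow> \<bar>q x\<bar> \<le> max M 0"
    by eventually_elim (use sub in auto)
  then have "AE x in lebesgue_on W0. \<bar>q x\<bar> \<le> max M 0" by (simp add: AE_restrict_space_iff W0_sets)
  then interpret helmholtz k "max M 0" q
    by unfold_locales (use measurable_restrict_mono[OF assms(2) sub] in simp_all)
  show ?thesis by (rule contour_integral_bounds)
qed

end
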